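(* Let $d\ge2$, $a,b>0$. The completion (in the sense specified in the context) of $\mathcal I_0([0,1],\mathbb R^d)$ with the $G^{a,b}$ metric is the space of absolutely continuous open curves $AC_0([0,1],\mathbb R^d)$. For any two curves $c_1,c_2\in AC_0([0,1],\mathbb R^d)$ their corresponding geodesic distance is given by $$\operatorname{dist}_{a,b}(c_1,c_2)=2b\sqrt{\ell_{c_1}+\ell_{c_2}-2\int_0^1\sqrt{|c_1'|\,|c_2'|}\,\cos\left(\tfrac{a}{2b}\theta\right)du},$$ where $\ell_{c_j}$ is the length of $c_j$ and $$\theta(u)=\begin{cases}\min\left(\cos^{-1}\left(\dfrac{c_1'(u)\cdot c_2'(u)}{|c_1'(u)|\,|c_2'(u)|}\right),\dfrac{2b\pi}{a}\right)&\text{if }c_1'(u),c_2'(u)\ne0,\\[2mm] \dfrac{2b\pi}{a}&\text{otherwise.}\end{cases}$$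
   Context: $\mathcal I_0([0,1],\mathbb R^d)$ is the Fréchet manifold of smooth curves $c\in C^\infty([0,1],\mathbb R^d)$ with $c'(u)\neq0$ for all $u$ and $c(0)=0$. $AC_0([0,1],\mathbb R^d)$ is the space of absolutely continuous curves $c:[0,1]\to\mathbb R^d$ with $c(0)=0$. $\ell_c=\int_0^1|c'|\,du$. The elastic metric is $$G^{a,b}_c(h,k)=\int_0^1\left[a^2(D_sh^\bot\cdot D_sk^\bot)+b^2(D_sh^\top\cdot D_sk^\top)\right]ds,$$ with $D_s=\frac1{|c'|}\frac{d}{du}$, $ds=|c'|\,du$, $D_sh^\top=\left(D_sh\cdot\frac{c'}{|c'|}\right)\frac{c'}{|c'|}$, $D_sh^\bot=D_sh-D_sh^\top$, where tangent vectors $h,k$ at $c$ are smooth vector fields $[0,1]\to\mathbb R^d$ along $c$ with $h(0)=k(0)=0$. Its geodesic distance on $\mathcal I_0$ is the infimum of the $G^{a,b}$-lengths of paths in $\mathcal I_0$ joining two given curves. Sense of completion. Put $\lambda=\frac{a}{2b}$ and let $R(c)(u)=c'(u)/\sqrt{|c'(u)|}$ where $c'(u)\neq0$, and $R(c)(u)=0$ otherwise. Let $g^\lambda_q(v,w)=\lambda^2(v^\bot\cdot w^\bot)+(v^\top\cdot w^\top)$ be the Riemannian metric on $\mathbb R^d\setminus\{0\}$, where $\top,\bot$ denote the components parallel and orthogonal to $q$, and let $\mathbb R^d_\lambda$ denote the metric completion of $(\mathbb R^d\setminus\{0\},g^\lambda)$, obtained by adding the origin (so $\mathbb R^d_\lambda=\mathbb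 R^d$ as a set). $R$ maps $\mathcal I_0([0,1],\mathbb R^d)$ bijectively onto $C^\infty([0,1],\mathbb R^d\setminus\{0\})$. The geodesic completion is obtained by extending geodesics across the origin, replacing $C^\infty([0,1],\mathbb R^d\setminus\{0\})$ by $C^\infty([0,1],\mathbb R^d_\lambda)$, i.e. it consists of the curves $c\in AC_0([0,1],\mathbb R^d)$ with $R(c)\in C^\infty([0,1],\mathbb R^d_\lambda)$. The statement about the completion means: $(AC_0([0,1],\mathbb R^d),\operatorname{dist}_{a,b})$ is the metric completion of this geodesic completion; and if $d\ge3$ it is also the metric completion of $\mathcal I_0([0,1],\mathbb R^d)$ with the geodesic distance of $G^{a,b}$. *)

theory Defs
  imports "HOL-Analysis.Analysis"
begin

section \<open>Smoothness and absolute continuity on the closed unit interval\<close>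

text \<open>
  Derivatives are taken relative to \<open>S\<close>, hence one-sided at boundary points. The notion is meant
  for convex sets with nonempty interior (here the unit interval and the unit square), on which
  such derivatives are unique.
\<close>

primrec Ck_on :: "nat \<Rightarrow> 'a::real_normed_vector set \<Rightarrow> ('a \<Rightarrow> 'b::real_normed_vector) \<Rightarrow> bool" where
  "Ck_on 0 S f \<longleftrightarrow> continuous_on S f"
| "Ck_on (Suc k) S f \<longleftrightarrow>
     (\<exists>D. (\<forall>x\<in>S. (f has_derivative D x) (at x within S)) \<and> (\<forall>v. Ck_on k S (\<lambda>x. D x v)))"

definition smooth_on :: "'a::real_normed_vector set \<Rightarrow> ('a \<Rightarrow> 'b::real_normed_vector) \<Rightarrow> bool" where
  "smooth_on S f \<longleftrightarrow> (\<forall>k. Ck_on k S f)"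

definition abs_continuous_on :: "real set \<Rightarrow> (real \<Rightarrow> 'b::real_normed_vector) \<Rightarrow> bool" where
  "abs_continuous_on S f \<longleftrightarrow>
     (\<forall>\<epsilon>>0. \<exists>\<delta>>0. \<forall>(n::nat) x y.
        (\<forall>i<n. x i \<le> y i \<and> {x i..y i} \<subseteq> S) \<and>
        disjoint_family_on (\<lambda>i. {x i<..<y i}) {..<n} \<and>
        (\<Sum>i<n. y i - x i) < \<delta>
        \<longrightarrow> (\<Sum>i<n. norm (f (y i) - f (x i))) < \<epsilon>)"

section \<open>Spaces of open curves\<close>

text \<open>
  A curve on the unit interval is an element of \<^term>\<open>extensional {0..1}\<close>, so that equality of
  curves is equality on the unit interval.
\<close>

type_synonym 'd curve = "real \<Rightarrow> real ^ 'd"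

text \<open>
  Where the derivative does not exist the value of \<open>vel\<close> is unspecified; for absolutely continuous
  curves this concerns only a null set.
\<close>

definition vel :: "'d::finite curve \<Rightarrow> real \<Rightarrow> real ^ 'd" where
  "vel c u = vector_derivative c (at u within {0..1})"

definition curve_length :: "'d::finite curve \<Rightarrow> real" where
  "curve_length c = (LINT u:{0..1}|lebesgue. norm (vel c u))"

definition Imm0 :: "'d::finite curve set" where
  "Imm0 = {c \<in> extensional {0..1}. smooth_on {0..1} c \<and> (\<forall>u\<in>{0..1}. vel c u \<noteq> 0) \<and> c 0 = 0}"

definition AC0 :: "'d::finite curve set" where
  "AC0 = {c \<in> extensional {0..1}. abs_continuous_on {0..1} c \<and> c 0 = 0}"

definition srv :: "'d::finite curve \<Rightarrow> real \<Rightarrow> real ^ 'd" where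
  "srv c u = (if vel c u \<noteq> 0 then vel c u /\<^sub>R sqrt (norm (vel c u)) else 0)"

text \<open>
  The geodesic completion of \<open>Imm0\<close>. The completed punctured space equals the whole space as a
  set, so smooth maps into it are smooth vector-valued maps that may vanish. If \<open>srv c\<close> agrees
  almost everywhere with a smooth map, then \<open>c\<close> is continuously differentiable and the agreement
  holds everywhere, so nothing depends on the unspecified values of \<open>vel\<close>.
\<close>

definition GeoCompl :: "'d::finite curve set" where
  "GeoCompl = {c \<in> AC0. smooth_on {0..1} (srv c)}"

section \<open>The elastic metric and its geodesic distance\<close>

definition arc_deriv :: "'d::finite curve \<Rightarrow> 'd curve \<Rightarrow> real \<Rightarrow> real ^ 'd" where
  "arc_deriv c h u = vel h u /\<^sub>R norm (vel c u)"

definition arc_deriv_top :: "'d::finite curve \<Rightarrow> 'd curve \<Rightarrow> real \<Rightarrow> real ^ 'd" where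
  "arc_deriv_top c h u =
     (let T = vel c u /\<^sub>R norm (vel c u) in (arc_deriv c h u \<bullet> T) *\<^sub>R T)"

definition arc_deriv_bot :: "'d::finite curve \<Rightarrow> 'd curve \<Rightarrow> real \<Rightarrow> real ^ 'd" where
  "arc_deriv_bot c h u = arc_deriv c h u - arc_deriv_top c h u"

text \<open>
  The integration variable is \<open>u\<close>, with \<open>ds = norm (vel c u) du\<close>. Parameters with \<open>vel c u = 0\<close>,
  which occur only outside \<open>Imm0\<close>, contribute nothing. Along a path of curves whose \<open>srv\<close>
  transform \<open>q\<close> is smooth in time and parameter this convention is immaterial: for every \<open>u\<close>, the
  times at which \<open>q\<close> vanishes but its time derivative does not are isolated, so for almost every
  time the exceptional parameters form a null set.
\<close>

definition elastic :: "real \<Rightarrow> real \<Rightarrow> 'd::finite curve \<Rightarrow> 'd curve \<Rightarrow> 'd curve \<Rightarrow> real" where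
  "elastic a b c h k =
     (LINT u:{0..1}|lebesgue.
        (a\<^sup>2 * (arc_deriv_bot c h u \<bullet> arc_deriv_bot c k u)
         + b\<^sup>2 * (arc_deriv_top c h u \<bullet> arc_deriv_top c k u)) * norm (vel c u))"

text \<open>A path of curves is written \<open>\<gamma> t u\<close> with time \<open>t\<close> and curve parameter \<open>u\<close>.\<close>

definition path_vel :: "(real \<Rightarrow> 'd::finite curve) \<Rightarrow> real \<Rightarrow> 'd curve" where
  "path_vel \<gamma> t u = vector_derivative (\<lambda>s. \<gamma> s u) (at t within {0..1})"

definition elastic_length :: "real \<Rightarrow> real \<Rightarrow> (real \<Rightarrow> 'd::finite curve) \<Rightarrow> real" where
  "elastic_length a b \<gamma> =
     (LINT t:{0..1}|lebesgue. sqrt (elastic a b (\<gamma> t) (path_vel \<gamma> t) (path_vel \<gamma> t)))"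

text \<open>
  Smooth paths in the Frechet space of smooth maps on the unit interval are the maps that are
  jointly smooth on the unit square. In \<open>GeoCompl\<close>, which is parametrised by \<open>srv\<close>, a smooth
  path is one whose \<open>srv\<close> transform is jointly smooth.
\<close>

definition Imm0_paths :: "(real \<Rightarrow> 'd::finite curve) set" where
  "Imm0_paths =
     {\<gamma>. (\<forall>t\<in>{0..1}. \<gamma> t \<in> Imm0) \<and> smooth_on ({0..1} \<times> {0..1}) (\<lambda>(t, u). \<gamma> t u)}"

definition GeoCompl_paths :: "(real \<Rightarrow> 'd::finite curve) set" where
  "GeoCompl_paths =
     {\<gamma>. (\<forall>t\<in>{0..1}. \<gamma> t \<in> GeoCompl) \<and> smooth_on ({0..1} \<times> {0..1}) (\<lambda>(t, u). srv (\<gamma> t) u)}"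

definition geodesic_dist ::
  "(real \<Rightarrow> 'd::finite curve) set \<Rightarrow> real \<Rightarrow> real \<Rightarrow> 'd curve \<Rightarrow> 'd curve \<Rightarrow> real" where
  "geodesic_dist P a b c1 c2 = Inf (elastic_length a b ` {\<gamma> \<in> P. \<gamma> 0 = c1 \<and> \<gamma> 1 = c2})"

section \<open>Metric completions and the angle function\<close>

text \<open>\<open>(N, D)\<close> is a metric completion of \<open>(M, d)\<close> via the inclusion of \<open>M\<close> in \<open>N\<close>.\<close>

definition metric_completion ::
  "'x set \<Rightarrow> ('x \<Rightarrow> 'x \<Rightarrow> real) \<Rightarrow> 'x set \<Rightarrow> ('x \<Rightarrow> 'x \<Rightarrow> real) \<Rightarrow> bool" where
  "metric_completion M d N D \<longleftrightarrow>
     Metric_space N D \<and> Metric_space.mcomplete N D \<and>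
     M \<subseteq> N \<and> (\<forall>x\<in>M. \<forall>y\<in>M. D x y = d x y) \<and>
     Metric_space.mtopology N D closure_of M = N"

definition theta :: "real \<Rightarrow> real \<Rightarrow> 'd::finite curve \<Rightarrow> 'd curve \<Rightarrow> real \<Rightarrow> real" where
  "theta a b c1 c2 u =
     (if vel c1 u \<noteq> 0 \<and> vel c2 u \<noteq> 0
      then min (arccos ((vel c1 u \<bullet> vel c2 u) / (norm (vel c1 u) * norm (vel c2 u)))) (2 * b * pi / a)
      else 2 * b * pi / a)"

end

theory Submission
  imports Defs
begin

text \<open>
  Write \<open>q = srv c\<close>, so that \<open>c\<close> is the integral of \<open>\<bar>q\<bar> q\<close> and the elastic metric with parameters
  \<open>a, b\<close> becomes \<open>4 b\<^sup>2\<close> times the \<open>L\<^sup>2\<close> metric of maps into the cone over the unit sphere whose angles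
  are scaled by \<open>l = a / (2 b)\<close>. The distance of this cone is bi-Lipschitz to the Euclidean one, so
  absolutely continuous curves with the integrated cone distance form a complete space, in which
  polynomial \<open>q\<close> are dense; a small generic shift makes them avoid the origin.

  Lower bound: along a smooth path the distance to the starting point is a Lipschitz function of
  time whose derivative is at most the elastic speed. Here the times and parameters where \<open>q\<close>
  vanishes but its time derivative does not form a null set, because for each parameter such
  times are isolated. Upper bound: the pointwise cone geodesics form a
  path of the right length that is merely measurable in the parameter; its velocity field is the
  almost everywhere limit of bounded polynomials, which yield smooth paths with convergent lengths.
  For \<open>d \<ge> 3\<close> the image of a smooth surface is a null set, so that a small generic bump term, vanishing
  at both end times, makes these paths avoid the origin.
\<close>

section \<open>Smooth maps\<close>

text \<open>Since the velocity is \<open>norm q *\<^sub>R q\<close>, its norm is the square of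
  \<open>norm q\<close>: \<open>srv\<close> and \<open>curve_of\<close> identify \<open>AC0\<close>
  with the square integrable maps modulo null sets, and length with the squared norm. The metric
  claims thereby become pointwise facts about the cone, integrated over the parameter. Two obstacles
  shape the rest. The cone distance is not smooth at the apex nor where the cut-off at
  \<open>pi\<close> sets in, so the lower bound never differentiates it at a distance: by the
  triangle inequality only neighbouring times matter, where the squared distance over the squared
  time step tends to \<open>cone_metric\<close>. And minimizers with scaled angle at least
  \<open>pi\<close> run through the apex, while the kind of minimizer may change with the parameter;
  so even between immersed curves the pointwise minimizers need not form a smooth family, and smooth
  paths are only made to approach the infimum. The integral representation of absolutely continuous
  functions serves twice: in the parameter for the curves themselves, and in time for the distance
  to the start and for the pointwise geodesics.\<close>

lemma Ck_on_cong:
  assumes "\<And>x. x \<in> S \<Longrightarrow> f x = g x"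
  shows "Ck_on k S f \<longleftrightarrow> Ck_on k S g"
proof (cases k)
  case 0
  then show ?thesis using assms continuous_on_cong[of S S f g] by simp
next
  case (Suc n)
  have "(f has_derivative D x) (at x within S) \<longleftrightarrow> (g has_derivative D x) (at x within S)"
    if "x \<in> S" for D :: "'a \<Rightarrow> 'a \<Rightarrow> 'b" and x
    using has_derivative_transform[OF that, of f g] has_derivative_transform[OF that, of g f] assms
    by auto
  then show ?thesis unfolding Suc Ck_on.simps by meson
qed

lemma Ck_on_continuous: "Ck_on k S f \<Longrightarrow> continuous_on S f"
  by (cases k) (auto simp: continuous_on_eq_continuous_within intro: has_derivative_continuous)

lemma Ck_on_SucD: "Ck_on (Suc k) S f \<Longrightarrow> Ck_on k S f"
proof (induction k arbitrary: f)
  case 0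
  then show ?case using Ck_on_continuous[OF 0] by simp
next
  case (Suc k)
  from Suc.prems obtain D where
    "\<forall>x\<in>S. (f has_derivative D x) (at x within S)" "\<forall>v. Ck_on (Suc k) S (\<lambda>x. D x v)"
    using Ck_on.simps(2)[of "Suc k"] by blast
  then show ?case using Suc.IH by (auto simp del: Ck_on.simps simp: Ck_on.simps(2)[of k])
qed

lemma Ck_on_const [simp]: "Ck_on k S (\<lambda>x. c)"
proof (induction k arbitrary: c)
  case (Suc k)
  then show ?case by (auto intro!: exI[of _ "\<lambda>x v. 0"])
qed simp

lemma Ck_on_add: "Ck_on k S f \<Longrightarrow> Ck_on k S g \<Longrightarrow> Ck_on k S (\<lambda>x. f x + g x)"
proof (induction k arbitrary: f g)
  case 0
  then show ?case by (simp add: continuous_on_add)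
next
  case (Suc k)
  from Suc.prems obtain D E where
    "\<forall>x\<in>S. (f has_derivative D x) (at x within S)" "\<forall>v. Ck_on k S (\<lambda>x. D x v)"
    "\<forall>x\<in>S. (g has_derivative E x) (at x within S)" "\<forall>v. Ck_on k S (\<lambda>x. E x v)"
    by auto
  then show ?case using Suc.IH
    by (auto intro!: exI[of _ "\<lambda>x v. D x v + E x v"] has_derivative_add)
qed

lemma Ck_on_bilinear:
  assumes "bounded_bilinear pr"
  shows "Ck_on k S f \<Longrightarrow> Ck_on k S g \<Longrightarrow> Ck_on k S (\<lambda>x. pr (f x) (g x))"
proof (induction k arbitrary: f g)
  case 0
  then show ?case by (simp add: bounded_bilinear.continuous_on[OF assms])
next
  case (Suc k)
  from Suc.prems obtain D E where
    "\<forall>x\<in>S. (f has_derivative D x) (at x within S)" "\<forall>v. Ck_on k S (\<lambda>x. D x v)"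
    "\<forall>x\<in>S. (g has_derivative E x) (at x within S)" "\<forall>v. Ck_on k S (\<lambda>x. E x v)"
    by auto
  then show ?case using Suc.IH Suc.prems[THEN Ck_on_SucD]
    by (auto intro!: exI[of _ "\<lambda>x v. pr (f x) (E x v) + pr (D x v) (g x)"]
        bounded_bilinear.FDERIV[OF assms] Ck_on_add)
qed

lemma Ck_on_bounded_linear:
  assumes "bounded_linear h"
  shows "Ck_on k S f \<Longrightarrow> Ck_on k S (\<lambda>x. h (f x))"
proof (induction k arbitrary: f)
  case 0
  then show ?case by (simp add: bounded_linear.continuous_on[OF assms])
next
  case (Suc k)
  from Suc.prems obtain D where
    "\<forall>x\<in>S. (f has_derivative D x) (at x within S)" "\<forall>v. Ck_on k S (\<lambda>x. D x v)"
    by auto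
  then show ?case using Suc.IH
    by (auto intro!: exI[of _ "\<lambda>x v. h (D x v)"] bounded_linear.has_derivative[OF assms])
qed

text \<open>Affine substitutions have a constant differential, so the induction needs only
  \<open>D\<close> in the fixed direction \<open>L v\<close>. Slices, projections, restrictions and
  the swap of coordinates are all of this kind.\<close>

lemma Ck_on_compose_affine:
  assumes L: "bounded_linear L" and "(\<lambda>x. L x + c) ` T \<subseteq> S"
  shows "Ck_on k S f \<Longrightarrow> Ck_on k T (\<lambda>x. f (L x + c))"
proof (induction k arbitrary: f)
  case 0
  then show ?case
    using continuous_on_compose2[of S f T "\<lambda>x. L x + c"] assms(2)
      continuous_on_add[OF linear_continuous_on[OF L] continuous_on_const] by simp
next
  case (Suc k)
  from Suc.prems obtain D where D:
    "\<forall>x\<in>S. (f has_derivative D x) (at x within S)" "\<forall>v. Ck_on k S (\<lambda>x. D x v)"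
    by auto
  have "((\<lambda>x. f (L x + c)) has_derivative (\<lambda>v. D (L x + c) (L v))) (at x within T)" if "x \<in> T" for x
  proof -
    have "(f has_derivative D (L x + c)) (at (L x + c) within (\<lambda>x. L x + c) ` T)"
      using D(1) that assms(2) by (meson has_derivative_subset image_subset_iff)
    moreover have "((\<lambda>x. L x + c) has_derivative L) (at x within T)"
      using has_derivative_add[OF bounded_linear_imp_has_derivative[OF L] has_derivative_const] by simp
    ultimately show ?thesis by (rule has_derivative_in_compose[rotated])
  qed
  then show ?case using Suc.IH[of "\<lambda>x. D x _"] D(2)
    by (auto intro!: exI[of _ "\<lambda>x v. D (L x + c) (L v)"])
qed

text \<open>Real powers provide the norm, its inverse root and reciprocals away from zero. The
  exponent is generalised in the induction because differentiation lowers it by one.\<close>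

lemma Ck_on_powr:
  fixes f :: "'a::real_normed_vector \<Rightarrow> real"
  assumes "\<And>x. x \<in> S \<Longrightarrow> f x > 0"
  shows "Ck_on k S f \<Longrightarrow> Ck_on k S (\<lambda>x. f x powr r)"
proof (induction k arbitrary: r)
  case 0
  then show ?case using assms
    by (auto intro!: continuous_on_powr' continuous_on_const dest: less_imp_le simp: less_imp_neq[THEN not_sym] order_less_imp_le)
next
  case (Suc k)
  from Suc.prems obtain D where D:
    "\<forall>x\<in>S. (f has_derivative D x) (at x within S)" "\<forall>v. Ck_on k S (\<lambda>x. D x v)"
    by auto
  have "((\<lambda>x. f x powr r) has_derivative (\<lambda>v. (r * f x powr (r - 1)) * D x v)) (at x within S)"
    if "x \<in> S" for x
  proof -
    have "((\<lambda>z. z powr r) has_derivative (\<lambda>v. (r * f x powr (r - 1)) * v)) (at (f x))"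
      using has_real_derivative_powr[OF assms[OF that], of r] by (simp add: has_field_derivative_def)
    then show ?thesis
      using has_derivative_compose[OF bspec[OF D(1) that]] by blast
  qed
  moreover have "Ck_on k S (\<lambda>x. (r * f x powr (r - 1)) * D x v)" for v
    using Ck_on_bilinear[OF bounded_bilinear_mult]
      Ck_on_bounded_linear[OF bounded_linear_mult_right[of r] Suc.IH[OF Ck_on_SucD[OF Suc.prems]]]
      D(2) by blast
  ultimately show ?case
    by (auto intro!: exI[of _ "\<lambda>x v. (r * f x powr (r - 1)) * D x v"])
qed

lemma smooth_on_cong:
  assumes "\<And>x. x \<in> S \<Longrightarrow> f x = g x"
  shows "smooth_on S f \<longleftrightarrow> smooth_on S g"
  using Ck_on_cong[of S f g, OF assms] by (simp add: smooth_on_def)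

lemma smooth_on_continuous: "smooth_on S f \<Longrightarrow> continuous_on S f"
  using Ck_on_continuous smooth_on_def by blast

lemma smooth_on_const [simp]: "smooth_on S (\<lambda>x. c)"
  by (simp add: smooth_on_def)

lemma smooth_on_add: "smooth_on S f \<Longrightarrow> smooth_on S g \<Longrightarrow> smooth_on S (\<lambda>x. f x + g x)"
  by (simp add: smooth_on_def Ck_on_add)

lemma smooth_on_bilinear:
  assumes "bounded_bilinear pr" "smooth_on S f" "smooth_on S g"
  shows "smooth_on S (\<lambda>x. pr (f x) (g x))"
  using assms(2,3) Ck_on_bilinear[OF assms(1)] unfolding smooth_on_def by blast

lemmas smooth_on_scaleR = smooth_on_bilinear[OF bounded_bilinear_scaleR]
lemmas smooth_on_mult = smooth_on_bilinear[OF bounded_bilinear_mult]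
lemmas smooth_on_inner = smooth_on_bilinear[OF bounded_bilinear_inner]

lemma smooth_on_bounded_linear:
  "bounded_linear h \<Longrightarrow> smooth_on S f \<Longrightarrow> smooth_on S (\<lambda>x. h (f x))"
  by (simp add: smooth_on_def Ck_on_bounded_linear)

lemma smooth_on_compose_affine:
  "bounded_linear L \<Longrightarrow> (\<lambda>x. L x + c) ` T \<subseteq> S \<Longrightarrow> smooth_on S f \<Longrightarrow> smooth_on T (\<lambda>x. f (L x + c))"
  by (simp add: smooth_on_def Ck_on_compose_affine[where S = S])

lemma smooth_on_compose_linear:
  "bounded_linear L \<Longrightarrow> L ` T \<subseteq> S \<Longrightarrow> smooth_on S f \<Longrightarrow> smooth_on T (\<lambda>x. f (L x))"
  using smooth_on_compose_affine[of L 0 T S f] by simp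

lemma smooth_on_subset: "smooth_on S f \<Longrightarrow> T \<subseteq> S \<Longrightarrow> smooth_on T f"
  using smooth_on_compose_affine[OF bounded_linear_ident, of 0 T S f] by simp

lemma smooth_on_minus: "smooth_on S f \<Longrightarrow> smooth_on S (\<lambda>x. - f x)"
  by (rule smooth_on_bounded_linear[OF bounded_linear_minus[OF bounded_linear_ident]])

lemma smooth_on_diff: "smooth_on S f \<Longrightarrow> smooth_on S g \<Longrightarrow> smooth_on S (\<lambda>x. f x - g x)"
  using smooth_on_add[OF _ smooth_on_minus] by fastforce

lemma smooth_on_powr:
  fixes f :: "'a::real_normed_vector \<Rightarrow> real"
  assumes "\<And>x. x \<in> S \<Longrightarrow> f x > 0" "smooth_on S f"
  shows "smooth_on S (\<lambda>x. f x powr r)"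
  using assms Ck_on_powr by (metis smooth_on_def)

lemma Ck_on_id: "Ck_on k S (\<lambda>x. x)"
  by (cases k) (auto intro!: exI[of _ "\<lambda>x v. v"])

lemma smooth_on_id: "smooth_on S (\<lambda>x. x)"
  by (simp add: smooth_on_def Ck_on_id)

lemma smooth_on_linear: "bounded_linear h \<Longrightarrow> smooth_on S h"
  using smooth_on_bounded_linear[OF _ smooth_on_id, of h S] by simp

lemma smooth_on_sum:
  "finite A \<Longrightarrow> (\<And>i. i \<in> A \<Longrightarrow> smooth_on S (f i)) \<Longrightarrow> smooth_on S (\<lambda>x. \<Sum>i\<in>A. f i x)"
  by (induction A rule: finite_induct) (auto intro: smooth_on_add)

lemma smooth_on_real_polynomial_function:
  "real_polynomial_function p \<Longrightarrow> smooth_on S p"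
  by (induction p rule: real_polynomial_function.induct)
    (auto intro: smooth_on_linear smooth_on_add smooth_on_mult)

lemma smooth_on_polynomial_function:
  fixes p :: "'a::real_normed_vector \<Rightarrow> 'b::euclidean_space"
  assumes "polynomial_function p"
  shows "smooth_on S p"
proof -
  have "smooth_on S (\<lambda>x. \<Sum>b\<in>Basis. (p x \<bullet> b) *\<^sub>R b)"
    using assms
    by (intro smooth_on_sum smooth_on_scaleR smooth_on_const smooth_on_real_polynomial_function)
      (auto simp: polynomial_function_iff_Basis_inner)
  then show ?thesis by (simp add: euclidean_representation)
qed

lemma smooth_on_SucE:
  assumes "smooth_on S f"
  obtains D where "\<And>x. x \<in> S \<Longrightarrow> (f has_derivative D x) (at x within S)"
    "\<And>v. continuous_on S (\<lambda>x. D x v)"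
proof -
  from assms have "Ck_on (Suc 0) S f" by (simp add: smooth_on_def)
  then show ?thesis using that by auto
qed

lemma Ck_on_vector_derivativeI:
  assumes "\<And>x. x \<in> S \<Longrightarrow> (f has_vector_derivative f' x) (at x within S)" "Ck_on k S f'"
  shows "Ck_on (Suc k) S f"
  using assms Ck_on_bounded_linear[OF bounded_linear_scaleR_right _] unfolding has_vector_derivative_def
  by (auto intro!: exI[of _ "\<lambda>x v. v *\<^sub>R f' x"])

lemma smooth_on_vector_derivativeI:
  assumes "\<And>x. x \<in> S \<Longrightarrow> (f has_vector_derivative f' x) (at x within S)" "smooth_on S f'"
  shows "smooth_on S f"
  unfolding smooth_on_def
proof
  show "Ck_on k S f" for k
    using Ck_on_vector_derivativeI[OF assms(1)] assms(2) Ck_on_SucD[of k S f]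
    by (simp add: smooth_on_def del: Ck_on.simps)
qed

section \<open>Integrals depending on parameters in the unit square\<close>

abbreviation unit_square :: "(real \<times> real) set" where "unit_square \<equiv> {0..1} \<times> {0..1}"

lemma has_derivative_slices:
  assumes "((\<lambda>(t, u). w (t, u)) has_derivative D) (at (t, u) within A \<times> B)" "t \<in> A" "u \<in> B"
  shows "((\<lambda>t. w (t, u)) has_vector_derivative D (1, 0)) (at t within A)"
    and "((\<lambda>u. w (t, u)) has_vector_derivative D (0, 1)) (at u within B)"
proof -
  interpret D: bounded_linear D using assms(1) by (rule has_derivative_bounded_linear)
  have w: "(w has_derivative D) (at (t, u) within A \<times> B)" using assms(1) by simp
  have "((\<lambda>t. w (t, u)) has_derivative (\<lambda>s. D (s, 0))) (at t within A)"
  proof (rule has_derivative_in_compose[of "\<lambda>t. (t, u)" "\<lambda>s. (s, 0)", simplified])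
    show "((\<lambda>t. (t, u)) has_derivative (\<lambda>s. (s, 0))) (at t within A)"
      by (auto intro!: derivative_eq_intros)
    show "(w has_derivative D) (at (t, u) within (\<lambda>t. (t, u)) ` A)"
      by (rule has_derivative_subset[OF w]) (use assms in auto)
  qed
  moreover have "(\<lambda>s. D (s, 0)) = (\<lambda>s. s *\<^sub>R D (1, 0))"
  proof
    show "D (s, 0) = s *\<^sub>R D (1, 0)" for s using D.scaleR[of s "(1, 0)"] by simp
  qed
  ultimately show "((\<lambda>t. w (t, u)) has_vector_derivative D (1, 0)) (at t within A)"
    by (simp add: has_vector_derivative_def)
  have "((\<lambda>u. w (t, u)) has_derivative (\<lambda>s. D (0, s))) (at u within B)"
  proof (rule has_derivative_in_compose[of "\<lambda>u. (t, u)" "\<lambda>s. (0, s)", simplified])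
    show "((\<lambda>u. (t, u)) has_derivative (\<lambda>s. (0, s))) (at u within B)"
      by (auto intro!: derivative_eq_intros)
    show "(w has_derivative D) (at (t, u) within (\<lambda>u. (t, u)) ` B)"
      by (rule has_derivative_subset[OF w]) (use assms in auto)
  qed
  moreover have "(\<lambda>s. D (0, s)) = (\<lambda>s. s *\<^sub>R D (0, 1))"
  proof
    show "D (0, s) = s *\<^sub>R D (0, 1)" for s using D.scaleR[of s "(0, 1)"] by simp
  qed
  ultimately show "((\<lambda>u. w (t, u)) has_vector_derivative D (0, 1)) (at u within B)"
    by (simp add: has_vector_derivative_def)
qed

text \<open>Rescaling the variable to \<open>u * s\<close> moves the varying upper limit into the
  integrand; over the fixed interval continuity in the parameters is standard.\<close>

lemma continuous_on_integral_upto: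
  fixes w :: "real \<times> real \<Rightarrow> 'b::euclidean_space"
  assumes "continuous_on unit_square w"
  shows "continuous_on unit_square (\<lambda>x. integral {0..snd x} (\<lambda>s. w (fst x, s)))"
proof -
  have eq: "integral {0..u} (\<lambda>s. w (t, s)) = u *\<^sub>R integral {0..1} (\<lambda>s. w (t, u * s))"
    if "t \<in> {0..1}" "u \<in> {0..1}" for t u
  proof (cases "u = 0")
    case False
    with that have "u > 0" by auto
    have "((\<lambda>s. w (t, s)) has_integral integral {0..u} (\<lambda>s. w (t, s))) (cbox 0 u)"
      using that by (auto simp: cbox_interval intro!: integrable_integral integrable_continuous_real
          continuous_on_compose2[OF assms] continuous_intros)
    from has_integral_affinity[OF this, of u 0] \<open>u > 0\<close>
    have "((\<lambda>s. w (t, u * s)) has_integral (1 / u) *\<^sub>R integral {0..u} (\<lambda>s. w (t, s))) {0..1}"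
      by (simp add: image_affinity_cbox cbox_interval image_image)
    then show ?thesis using \<open>u > 0\<close> by (simp add: integral_unique)
  qed simp
  have "continuous_on (unit_square \<times> cbox 0 1) (\<lambda>(x, s). w (fst x, snd x * s))"
    unfolding split_def
    by (rule continuous_on_compose2[OF assms])
      (auto intro!: continuous_intros simp: mult_le_one)
  then have "continuous_on unit_square (\<lambda>x. integral (cbox 0 1) (\<lambda>s. w (fst x, snd x * s)))"
    by (rule integral_continuous_on_param)
  then have "continuous_on unit_square (\<lambda>x. snd x *\<^sub>R integral {0..1} (\<lambda>s. w (fst x, snd x * s)))"
    by (intro continuous_intros) simp
  then show ?thesis by (rule continuous_on_eq) (auto simp: eq)
qed

lemma leibniz_upto:
  fixes w :: "real \<times> real \<Rightarrow> 'b::euclidean_space"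
  assumes "continuous_on unit_square w" "continuous_on unit_square wt"
    and "\<And>t u. t \<in> {0..1} \<Longrightarrow> u \<in> {0..1} \<Longrightarrow>
      ((\<lambda>t. w (t, u)) has_vector_derivative wt (t, u)) (at t within {0..1})"
    and "t \<in> {0..1}" "u \<in> {0..1}"
  shows "((\<lambda>t. integral {0..u} (\<lambda>s. w (t, s))) has_vector_derivative
            integral {0..u} (\<lambda>s. wt (t, s))) (at t within {0..1})"
  using assms
  by (intro leibniz_rule_vector_derivative[where U="{0..1}" and a=0 and b=u, simplified cbox_interval])
    (auto simp: cbox_interval split_def intro!: integrable_continuous_real
       continuous_on_compose2[OF assms(1)] continuous_on_compose2[OF assms(2)] continuous_intros)

text \<open>The partial derivative in \<open>t\<close> is an integral of the same shape with
  integrand \<open>wt\<close>, one order less smooth, and the one in \<open>u\<close> is the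
  integrand \<open>w\<close> itself; so the induction closes.\<close>

lemma Ck_on_integral_upto:
  fixes w :: "real \<times> real \<Rightarrow> 'b::euclidean_space"
  shows "Ck_on k unit_square w \<Longrightarrow> Ck_on k unit_square (\<lambda>x. integral {0..snd x} (\<lambda>s. w (fst x, s)))"
proof (induction k arbitrary: w)
  case 0
  then show ?case by (simp add: continuous_on_integral_upto)
next
  case (Suc k)
  from Suc.prems obtain D where
    D: "\<And>x. x \<in> unit_square \<Longrightarrow> (w has_derivative D x) (at x within unit_square)" "\<And>v. Ck_on k unit_square (\<lambda>x. D x v)"
    by auto
  have cw: "continuous_on unit_square w" using Ck_on_continuous[OF Suc.prems] .
  define wt where "wt = (\<lambda>x. D x (1, 0))"
  have wt: "Ck_on k unit_square wt" "continuous_on unit_square wt"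
    using D(2) Ck_on_continuous unfolding wt_def by blast+
  have der: "((\<lambda>t. w (t, u)) has_vector_derivative wt (t, u)) (at t within {0..1})"
    if "t \<in> {0..1}" "u \<in> {0..1}" for t u
    unfolding wt_def using D(1)[of "(t, u)"] that by (intro has_derivative_slices(1)) auto
  let ?F = "\<lambda>x. integral {0..snd x} (\<lambda>s. w (fst x, s))"
  let ?E = "\<lambda>x v. fst v *\<^sub>R integral {0..snd x} (\<lambda>s. wt (fst x, s)) + snd v *\<^sub>R w x"
  have "(?F has_derivative ?E (t, u)) (at (t, u) within unit_square)"
    if tu: "t \<in> {0..1}" "u \<in> {0..1}" for t u
  proof -
    have "((\<lambda>(t, u). integral {0..u} (\<lambda>s. w (t, s))) has_derivative
        (\<lambda>(a, b). a *\<^sub>R integral {0..u} (\<lambda>s. wt (t, s)) + blinfun_scaleR_left (w (t, u)) b))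
        (at (t, u) within unit_square)"
    \<comment> \<open>Joint differentiability needs one partial derivative at the point and the
      other one nearby and continuous; the partial derivative in \<open>u\<close> plays the second
      part.\<close>
    proof (rule has_derivative_partialsI[where fy = "\<lambda>t u. blinfun_scaleR_left (w (t, u))"])
      show "((\<lambda>t. integral {0..u} (\<lambda>s. w (t, s))) has_derivative
          (\<lambda>a. a *\<^sub>R integral {0..u} (\<lambda>s. wt (t, s)))) (at t within {0..1})"
        using leibniz_upto[OF cw wt(2) der tu] by (simp add: has_vector_derivative_def)
      show "((\<lambda>u. integral {0..u} (\<lambda>s. w (t, s))) has_derivative
          blinfun_apply (blinfun_scaleR_left (w (t, u)))) (at u within {0..1})"
        if "t \<in> {0..1}" "u \<in> {0..1}" for t u
      proof -
        have "continuous_on {0..1} (\<lambda>s. w (t, s))"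
          using that by (intro continuous_on_compose2[OF cw]) (auto intro!: continuous_intros)
        then show ?thesis
          using integral_has_vector_derivative[of 0 1 "\<lambda>s. w (t, s)" u] that
          by (simp add: has_vector_derivative_def)
      qed
      have "continuous_on unit_square (\<lambda>x. blinfun_scaleR_left (w x))"
        by (intro continuous_intros cw)
      then show "continuous (at (t, u) within unit_square) (\<lambda>(t, u). blinfun_scaleR_left (w (t, u)))"
        using tu by (auto simp: continuous_on_eq_continuous_within split_def)
    qed (use tu in auto)
    then show ?thesis by (simp add: split_def)
  qed
  moreover have "Ck_on k unit_square (\<lambda>x. ?E x v)" for v
    by (intro Ck_on_add Ck_on_bounded_linear[OF bounded_linear_scaleR_right] Suc.IH wt
        Ck_on_SucD[OF Suc.prems])
  ultimately show ?case unfolding Ck_on.simps(2) by (intro exI[of _ ?E]) auto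
qed

lemma smooth_on_integral_upto:
  fixes w :: "real \<times> real \<Rightarrow> 'b::euclidean_space"
  shows "smooth_on unit_square w \<Longrightarrow> smooth_on unit_square (\<lambda>x. integral {0..snd x} (\<lambda>s. w (fst x, s)))"
  by (simp add: smooth_on_def Ck_on_integral_upto)

section \<open>Absolutely continuous functions are integrals of their derivative\<close>

text \<open>Arbitrary finite index sets are allowed so that selected grid cells, and pairs of an
  interval and a subinterval, can index a family directly.\<close>

lemma abs_continuous_on_finite_family:
  assumes "abs_continuous_on S f" "\<epsilon> > 0"
  obtains \<delta> where "\<delta> > 0"
    "\<And>(I :: 'i set) x y. finite I \<Longrightarrow> (\<And>i. i \<in> I \<Longrightarrow> x i \<le> y i \<and> {x i..y i} \<subseteq> S) \<Longrightarrow>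
       disjoint_family_on (\<lambda>i. {x i<..<y i}) I \<Longrightarrow> (\<Sum>i\<in>I. y i - x i) < \<delta> \<Longrightarrow>
       (\<Sum>i\<in>I. norm (f (y i) - f (x i))) < \<epsilon>"
proof -
  obtain \<delta> where \<delta>: "\<delta> > 0" "\<And>(n::nat) x y.
        (\<forall>i<n. x i \<le> y i \<and> {x i..y i} \<subseteq> S) \<and>
        disjoint_family_on (\<lambda>i. {x i<..<y i}) {..<n} \<and>
        (\<Sum>i<n. y i - x i) < \<delta>
        \<longrightarrow> (\<Sum>i<n. norm (f (y i) - f (x i))) < \<epsilon>"
    using assms unfolding abs_continuous_on_def by blast
  show ?thesis
  proof (rule that[OF \<delta>(1)])
    fix I :: "'i set" and x y
    assume I: "finite I" "\<And>i. i \<in> I \<Longrightarrow> x i \<le> y i \<and> {x i..y i} \<subseteq> S"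
       "disjoint_family_on (\<lambda>i. {x i<..<y i}) I" "(\<Sum>i\<in>I. y i - x i) < \<delta>"
    from ex_bij_betw_nat_finite[OF I(1)] obtain h where h: "bij_betw h {..<card I} I"
      by (auto simp: atLeast0LessThan)
    have inj: "inj_on h {..<card I}" and im: "h ` {..<card I} = I"
      using h by (auto simp: bij_betw_def)
    have "disjoint_family_on (\<lambda>i. {x (h i)<..<y (h i)}) {..<card I}"
      unfolding disjoint_family_on_def
    proof (intro ballI impI)
      fix m n assume mn: "m \<in> {..<card I}" "n \<in> {..<card I}" "m \<noteq> n"
      then have "h m \<in> I" "h n \<in> I" "h m \<noteq> h n" using im inj by (auto dest: inj_onD)
      then show "{x (h m)<..<y (h m)} \<inter> {x (h n)<..<y (h n)} = {}"
        using I(3) unfolding disjoint_family_on_def by blast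
    qed
    moreover have "(\<Sum>i<card I. y (h i) - x (h i)) = (\<Sum>i\<in>I. y i - x i)"
      using sum.reindex_bij_betw[OF h, of "\<lambda>i. y i - x i"] by simp
    moreover have "\<forall>i<card I. x (h i) \<le> y (h i) \<and> {x (h i)..y (h i)} \<subseteq> S"
      using I(2) im by blast
    ultimately have "(\<Sum>i<card I. norm (f (y (h i)) - f (x (h i)))) < \<epsilon>"
      using \<delta>(2)[of "card I" "\<lambda>i. x (h i)" "\<lambda>i. y (h i)"] I(4) by simp
    then show "(\<Sum>i\<in>I. norm (f (y i) - f (x i))) < \<epsilon>"
      using sum.reindex_bij_betw[OF h, of "\<lambda>i. norm (f (y i) - f (x i))"] by simp
  qed
qed

lemma abs_continuous_on_continuous:
  assumes "abs_continuous_on {a..b} f"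
  shows "continuous_on {a..b} f"
  unfolding continuous_on_iff
proof (intro ballI allI impI)
  fix x \<epsilon> :: real assume x: "x \<in> {a..b}" and "\<epsilon> > 0"
  from abs_continuous_on_finite_family[OF assms \<open>\<epsilon> > 0\<close>, where 'i=unit]
  obtain \<delta> where \<delta>: "\<delta> > 0"
    "\<And>(I :: unit set) x y. finite I \<Longrightarrow> (\<And>i. i \<in> I \<Longrightarrow> x i \<le> y i \<and> {x i..y i} \<subseteq> {a..b}) \<Longrightarrow>
       disjoint_family_on (\<lambda>i. {x i<..<y i}) I \<Longrightarrow> (\<Sum>i\<in>I. y i - x i) < \<delta> \<Longrightarrow>
       (\<Sum>i\<in>I. norm (f (y i) - f (x i))) < \<epsilon>"
    by blast
  have *: "norm (f z - f y) < \<epsilon>" if "y \<le> z" "y \<in> {a..b}" "z \<in> {a..b}" "z - y < \<delta>" for y z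
    using \<delta>(2)[of "{()}" "\<lambda>_. y" "\<lambda>_. z"] that by (auto simp: disjoint_family_on_def)
  show "\<exists>d>0. \<forall>x'\<in>{a..b}. dist x' x < d \<longrightarrow> dist (f x') (f x) < \<epsilon>"
  proof (intro exI[of _ \<delta>] conjI ballI impI \<delta>(1))
    fix x' assume "x' \<in> {a..b}" "dist x' x < \<delta>"
    then show "dist (f x') (f x) < \<epsilon>"
      using *[of x x'] *[of x' x] x
      by (cases "x \<le> x'") (auto simp: dist_norm norm_minus_commute)
  qed
qed

text \<open>Precomposition with it extends a function on the unit interval to the whole line by
  constants, preserving continuity and monotonicity.\<close>

definition clamp01 :: "real \<Rightarrow> real" where "clamp01 x = max 0 (min 1 x)"

lemma clamp01_in [simp]: "clamp01 x \<in> {0..1}" by (simp add: clamp01_def)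
lemma clamp01_range [simp]: "0 \<le> clamp01 x" "clamp01 x \<le> 1" by (simp_all add: clamp01_def)
lemma clamp01_id [simp]: "x \<in> {0..1} \<Longrightarrow> clamp01 x = x" by (simp add: clamp01_def)
lemma clamp01_mono: "x \<le> y \<Longrightarrow> clamp01 x \<le> clamp01 y" by (simp add: clamp01_def)
lemma continuous_on_clamp01 [continuous_intros]:
  "continuous_on S f \<Longrightarrow> continuous_on S (\<lambda>x. clamp01 (f x))"
  unfolding clamp01_def by (intro continuous_intros)

lemma sum_length_le_emeasure:
  fixes x y :: "'i \<Rightarrow> real"
  assumes "finite I" "\<And>i. i \<in> I \<Longrightarrow> x i \<le> y i" "disjoint_family_on (\<lambda>i. {x i<..<y i}) I"
    "(\<Union>i\<in>I. {x i<..<y i}) \<subseteq> U" "U \<in> sets borel"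
  shows "ennreal (\<Sum>i\<in>I. y i - x i) \<le> emeasure lborel U"
proof -
  have "ennreal (\<Sum>i\<in>I. y i - x i) = (\<Sum>i\<in>I. emeasure lborel {x i<..<y i})"
    using assms(2) by (simp add: sum_ennreal)
  also have "\<dots> = emeasure lborel (\<Union>i\<in>I. {x i<..<y i})"
    by (rule sum_emeasure) (use assms in auto)
  also have "\<dots> \<le> emeasure lborel U" using assms by (intro emeasure_mono) auto
  finally show ?thesis .
qed

text \<open>A compact null set has an open neighbourhood of small measure, and compactness gives it
  a uniform width. Cells of a fine enough grid that meet \<open>K\<close> then lie in the
  neighbourhood, so their total length, and by absolute continuity their total increment, is
  small.\<close>

lemma mono_abs_continuous_null:
  fixes F :: "real \<Rightarrow> real"
  assumes mono: "mono_on {0..1} F" and ac: "abs_continuous_on {0..1} F"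
    and M: "M = interval_measure (\<lambda>x. F (clamp01 x))" and K: "compact K" "emeasure lborel K = 0"
  shows "emeasure M (K \<inter> {0<..1}) = 0"
proof -
  have mono': "F (clamp01 x) \<le> F (clamp01 y)" if "x \<le> y" for x y
    using mono_onD[OF mono, of "clamp01 x" "clamp01 y"] clamp01_mono[OF that] by simp
  have cont: "continuous_on UNIV (\<lambda>x. F (clamp01 x))"
    by (rule continuous_on_compose2[OF abs_continuous_on_continuous[OF ac]])
      (auto intro!: continuous_intros)
  have Ioc: "emeasure M {a<..b} = F (clamp01 b) - F (clamp01 a)" if "a \<le> b" for a b
    unfolding M using that cont mono'
    by (intro emeasure_interval_measure_Ioc)
      (auto simp: continuous_on_eq_continuous_within intro: continuous_within_subset)
  have [measurable]: "K \<in> sets borel" using K(1) by (simp add: borel_compact)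
  have sM [measurable_cong]: "sets M = sets borel" by (simp add: M)
  have "emeasure M (K \<inter> {0<..1}) \<le> ennreal \<epsilon>" if "\<epsilon> > 0" for \<epsilon>
  proof -
    obtain \<delta> where \<delta>: "\<delta> > 0"
      "\<And>(I :: nat set) x y. finite I \<Longrightarrow> (\<And>i. i \<in> I \<Longrightarrow> x i \<le> y i \<and> {x i..y i} \<subseteq> {0..1}) \<Longrightarrow>
       disjoint_family_on (\<lambda>i. {x i<..<y i}) I \<Longrightarrow> (\<Sum>i\<in>I. y i - x i) < \<delta> \<Longrightarrow>
       (\<Sum>i\<in>I. norm (F (y i) - F (x i))) < \<epsilon>"
      using abs_continuous_on_finite_family[OF ac \<open>\<epsilon> > 0\<close>] by blast
    obtain U where U: "open U" "K \<subseteq> U" "emeasure lborel (U - K) < \<delta>"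
      using outer_regular_lborel[of K "\<delta>"] \<delta>(1) by auto
    have "emeasure lborel U \<le> emeasure lborel (U - K) + emeasure lborel K"
      using U(2) emeasure_subadditive[of "U - K" lborel K] U(1) by (simp add: Un_absorb2)
    with U(3) K(2) have U\<delta>: "emeasure lborel U < \<delta>" by simp
    obtain e where e: "e > 0" "(\<Union>x\<in>K. ball x e) \<subseteq> U"
      using compact_subset_open_imp_ball_epsilon_subset[OF K(1) U(1,2)] by blast
    obtain n where n: "n > 0" "1 / real n < e"
      using real_arch_inverse[of e] e(1) by (auto simp: inverse_eq_divide)
    define x where "x = (\<lambda>k::nat. real k / n)"
    define y where "y = (\<lambda>k::nat. real (Suc k) / n)"
    \<comment> \<open>The cells are half-open to match the values of \<open>interval_measure\<close>
      on such intervals; their open interiors are what the definition of absolute continuity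
      takes.\<close>
    define I where "I = {k. k < n \<and> {x k<..y k} \<inter> K \<noteq> {}}"
    have xy: "x k \<le> y k" "y k - x k = 1 / n" for k
      using n by (simp_all add: x_def y_def divide_simps)
    have "finite I" by (simp add: I_def)
    have in01: "{x k..y k} \<subseteq> {0..1}" if "k \<in> I" for k
      using that n by (auto simp: I_def x_def y_def divide_simps)
    have disj: "disjoint_family_on (\<lambda>i. {x i<..<y i}) I"
      unfolding disjoint_family_on_def
    proof (intro ballI impI)
      fix i j :: nat assume "i \<noteq> j"
      then have "i < j \<or> j < i" by linarith
      then have "y i \<le> x j \<or> y j \<le> x i" using n by (auto simp: x_def y_def divide_simps)
      then show "{x i<..<y i} \<inter> {x j<..<y j} = {}" by auto
    qed
    have "(\<Union>i\<in>I. {x i<..<y i}) \<subseteq> U"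
    proof
      fix z assume "z \<in> (\<Union>i\<in>I. {x i<..<y i})"
      then obtain i where i: "i \<in> I" "x i < z" "z < y i" by auto
      then obtain p where p: "p \<in> K" "x i < p" "p \<le> y i" by (auto simp: I_def)
      then have "dist p z < e" using i n xy(2)[of i] by (auto simp: dist_real_def abs_if)
      then have "z \<in> (\<Union>x\<in>K. ball x e)" using p(1) by auto
      then show "z \<in> U" using e(2) by blast
    qed
    then have "ennreal (\<Sum>i\<in>I. y i - x i) \<le> emeasure lborel U"
      using sum_length_le_emeasure[OF \<open>finite I\<close> xy(1) disj] U(1) by auto
    from this U\<delta> have "ennreal (\<Sum>i\<in>I. y i - x i) < ennreal \<delta>" by (rule le_less_trans)
    then have "(\<Sum>i\<in>I. y i - x i) < \<delta>"
      using \<delta>(1) by (simp add: ennreal_less_iff sum_nonneg xy(1))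
    from \<delta>(2)[OF \<open>finite I\<close> _ disj this] xy(1) in01
    have lt: "(\<Sum>i\<in>I. norm (F (y i) - F (x i))) < \<epsilon>" by blast
    have "K \<inter> {0<..1} \<subseteq> (\<Union>i\<in>I. {x i<..y i})"
    proof
      fix z assume z: "z \<in> K \<inter> {0<..1}"
      \<comment> \<open>Cells are closed on the right, so the ceiling minus one is the index of the
        cell containing \<open>z\<close>, also when \<open>z * n\<close> is an integer.\<close>
      define k where "k = nat (\<lceil>z * n\<rceil> - 1)"
      have zn: "0 < z * n" "z * n \<le> n" using z n by (auto simp: mult_le_cancel_right1)
      have k: "real k = of_int \<lceil>z * n\<rceil> - 1" using zn(1) by (simp add: k_def)
      then have "real k < z * n" "z * n \<le> real k + 1" by linarith+
      then have "z \<in> {x k<..y k}" using n by (simp add: x_def y_def divide_simps mult.commute)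
      moreover have "k < n" using k zn(2) \<open>real k < z * n\<close> by linarith
      ultimately have "k \<in> I" using z unfolding I_def by blast
      then show "z \<in> (\<Union>i\<in>I. {x i<..y i})" using \<open>z \<in> {x k<..y k}\<close> by blast
    qed
    then have "emeasure M (K \<inter> {0<..1}) \<le> emeasure M (\<Union>i\<in>I. {x i<..y i})"
      using \<open>finite I\<close> by (intro emeasure_mono) auto
    also have "\<dots> \<le> (\<Sum>i\<in>I. emeasure M {x i<..y i})"
      using \<open>finite I\<close> by (intro emeasure_subadditive_finite) (auto simp: sM)
    also have "\<dots> = (\<Sum>i\<in>I. ennreal (norm (F (y i) - F (x i))))"
    proof (rule sum.cong)
      fix i assume "i \<in> I"
      then have "clamp01 (x i) = x i" "clamp01 (y i) = y i"
        using in01[of i] xy(1)[of i] by auto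
      then show "emeasure M {x i<..y i} = ennreal (norm (F (y i) - F (x i)))"
        using Ioc[OF xy(1)[of i]] mono'[OF xy(1)[of i]] by simp
    qed simp
    also have "\<dots> = ennreal (\<Sum>i\<in>I. norm (F (y i) - F (x i)))"
      by (simp add: sum_ennreal)
    also have "\<dots> \<le> ennreal \<epsilon>" using lt by (simp add: ennreal_leI)
    finally show ?thesis .
  qed
  then have "emeasure M (K \<inter> {0<..1}) \<le> 0"
    using ennreal_le_epsilon[of 0 "emeasure M (K \<inter> {0<..1})"] by simp
  then show ?thesis by simp
qed

text \<open>The integrand is the Radon-Nikodym density of the Stieltjes measure of \<open>F\<close>;
  absolute continuity of \<open>F\<close> becomes absolute continuity of that measure.\<close>

lemma mono_abs_continuous_integral:
  fixes F :: "real \<Rightarrow> real"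
  assumes mono: "mono_on {0..1} F" and ac: "abs_continuous_on {0..1} F"
  obtains w where "w absolutely_integrable_on {0..1}"
    "\<And>t. t \<in> {0..1} \<Longrightarrow> (w has_integral (F t - F 0)) {0..t}"
proof -
  define M where "M = interval_measure (\<lambda>x. F (clamp01 x))"
  have mono': "F (clamp01 x) \<le> F (clamp01 y)" if "x \<le> y" for x y
    using mono_onD[OF mono, of "clamp01 x" "clamp01 y"] clamp01_mono[OF that] by simp
  have cont: "continuous_on UNIV (\<lambda>x. F (clamp01 x))"
    by (rule continuous_on_compose2[OF abs_continuous_on_continuous[OF ac]])
      (auto intro!: continuous_intros)
  have Ioc: "emeasure M {a<..b} = F (clamp01 b) - F (clamp01 a)" if "a \<le> b" for a b
    unfolding M_def using that cont mono'
    by (intro emeasure_interval_measure_Ioc)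
      (auto simp: continuous_on_eq_continuous_within intro: continuous_within_subset)
  have sM [measurable_cong]: "sets M = sets borel" by (simp add: M_def)
  define N where "N = density M (indicator {0<..1})"
  have sN [measurable_cong]: "sets N = sets borel" by (simp add: N_def sM)
  have eN: "emeasure N A = emeasure M (A \<inter> {0<..1})" if "A \<in> sets borel" for A
    using that unfolding N_def
    by (subst emeasure_density) (auto simp: sM indicator_inter_arith[symmetric] Int_commute)
  have "space N = UNIV" using sN sets_eq_imp_space_eq[OF sN] by simp
  then have fin: "emeasure N (space N) \<noteq> \<infinity>"
    using eN[of UNIV] Ioc[of 0 1] by simp
  have "absolutely_continuous lborel N"
    unfolding absolutely_continuous_def
  proof
    fix A :: "real set" assume "A \<in> null_sets lborel"
    then have A: "A \<in> sets borel" "emeasure lborel A = 0" by auto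
    \<comment> \<open>Inner regularity of the finite measure \<open>N\<close> reduces Borel null
      sets to compact ones, where the covering argument applies.\<close>
    have "emeasure N A = (SUP K\<in>{K. K \<subseteq> A \<and> compact K}. emeasure N K)"
      by (rule inner_regular[OF sN fin A(1)])
    also have "\<dots> \<le> 0"
    proof (rule SUP_least)
      fix K assume "K \<in> {K. K \<subseteq> A \<and> compact K}"
      then have K: "K \<subseteq> A" "compact K" by auto
      then have "emeasure lborel K = 0"
        using emeasure_mono[of K A lborel] A by auto
      then show "emeasure N K \<le> 0"
        using mono_abs_continuous_null[OF mono ac M_def K(2)] eN K(2) by (simp add: borel_compact)
    qed
    finally show "A \<in> null_sets N" using A sN by auto
  qed
  then obtain f where f [measurable]: "f \<in> borel_measurable borel" and dens: "density lborel f = N"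
    using sigma_finite_measure.Radon_Nikodym[OF sigma_finite_lborel, of N] sN by auto
  have int: "(\<integral>\<^sup>+x. f x * indicator A x \<partial>lborel) = emeasure M (A \<inter> {0<..1})"
    if "A \<in> sets borel" for A
    using eN[OF that] that unfolding dens[symmetric] by (simp add: emeasure_density)
  \<comment> \<open>The density takes extended values but is finite almost everywhere because the
    total mass is finite, so passing to reals changes no integral.\<close>
  define w where "w = (\<lambda>x. enn2real (f x) * indicator {0..1} x)"
  have [measurable]: "w \<in> borel_measurable borel" unfolding w_def by simp
  have "(\<integral>\<^sup>+x. f x \<partial>lborel) \<noteq> \<infinity>" using int[of UNIV] Ioc[of 0 1] by simp
  then have "AE x in lborel. f x \<noteq> \<infinity>" by (intro nn_integral_PInf_AE) auto
  have main: "(w has_integral (F t - F 0)) {0..t}" if t: "t \<in> {0..1}" for t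
  proof -
    have "(\<integral>\<^sup>+x. ennreal (indicator {0..t} x * w x) \<partial>lborel) = (\<integral>\<^sup>+x. f x * indicator {0..t} x \<partial>lborel)"
      using \<open>AE x in lborel. f x \<noteq> \<infinity>\<close>
      by (intro nn_integral_cong_AE, eventually_elim)
        (use t in \<open>auto simp: w_def indicator_def less_top[symmetric] ennreal_enn2real\<close>)
    also have "\<dots> = emeasure M {0<..t}"
    proof -
      have "{0..t} \<inter> {0<..1} = {0<..t}" using t by auto
      then show ?thesis using int[of "{0..t}"] by simp
    qed
    also have "\<dots> = ennreal (F t - F 0)" using Ioc[of 0 t] t by simp
    finally have "((\<lambda>x. indicator {0..t} x * w x) has_integral (F t - F 0)) UNIV"
      using mono'[of 0 t] t
      by (intro nn_integral_has_integral) (auto simp: w_def)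
    moreover have "(\<lambda>x. indicator {0..t} x * w x) = (\<lambda>x. if x \<in> {0..t} then w x else 0)"
      by (auto simp: fun_eq_iff)
    ultimately show ?thesis by (simp only: has_integral_restrict_UNIV)
  qed
  moreover have "w absolutely_integrable_on {0..1}"
    using main[of 1] by (intro nonnegative_absolutely_integrable_1) (auto simp: w_def)
  ultimately show ?thesis using that by blast
qed

section \<open>Jordan decomposition\<close>

lemma disjoint_open_intervals_sum_le:
  fixes x y :: "'i \<Rightarrow> real"
  assumes "finite I" "\<And>i. i \<in> I \<Longrightarrow> x i \<le> y i \<and> {x i..y i} \<subseteq> {s..t}"
    "disjoint_family_on (\<lambda>i. {x i<..<y i}) I" "s \<le> t"
  shows "(\<Sum>i\<in>I. y i - x i) \<le> t - s"
proof -
  have "(\<Union>i\<in>I. {x i<..<y i}) \<subseteq> {s..t}"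
  proof (rule UN_least)
    fix i assume "i \<in> I"
    moreover have "{x i<..<y i} \<subseteq> {x i..y i}" by auto
    ultimately show "{x i<..<y i} \<subseteq> {s..t}" using assms(2) by blast
  qed
  then have "ennreal (\<Sum>i\<in>I. y i - x i) \<le> emeasure lborel {s..t}"
    using assms by (intro sum_length_le_emeasure) auto
  then show ?thesis using assms by (simp add: ennreal_le_iff)
qed

text \<open>The supremum of \<open>variation_sums f 0 t\<close> is the positive variation of \<open>f\<close> on \<open>{0..t}\<close>, which gives the
  Jordan decomposition below.\<close>

definition variation_sums :: "(real \<Rightarrow> real) \<Rightarrow> real \<Rightarrow> real \<Rightarrow> real set" where
  "variation_sums f s t = {\<Sum>i<n. f (y i) - f (x i) |(n::nat) x y.
     (\<forall>i<n. x i \<le> y i \<and> {x i..y i} \<subseteq> {s..t}) \<and> disjoint_family_on (\<lambda>i. {x i<..<y i}) {..<n}}"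

lemma psumsI:
  fixes n :: nat
  assumes "\<And>i. i < n \<Longrightarrow> x i \<le> y i \<and> s \<le> x i \<and> y i \<le> t"
    "disjoint_family_on (\<lambda>i. {x i<..<y i}) {..<n}"
  shows "(\<Sum>i<n. f (y i) - f (x i)) \<in> variation_sums f s t"
proof -
  have "\<forall>i<n. x i \<le> y i \<and> {x i..y i} \<subseteq> {s..t}" using assms(1) by auto
  then show ?thesis using assms(2) unfolding variation_sums_def by blast
qed

lemma variation_sums_0: "0 \<in> variation_sums f s t"
  unfolding variation_sums_def by (intro CollectI exI[of _ 0]) (auto simp: disjoint_family_on_def)

lemma variation_sums_mono: "s' \<le> s \<Longrightarrow> t \<le> t' \<Longrightarrow> variation_sums f s t \<subseteq> variation_sums f s' t'"
proof -
  assume "s' \<le> s" "t \<le> t'"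
  then have "{s..t} \<subseteq> {s'..t'}" by auto
  then show ?thesis unfolding variation_sums_def by (smt (verit, best) Collect_mono subset_trans)
qed

text \<open>Every interval is cut at \<open>t\<close> by \<open>min\<close> and \<open>max\<close>.
  A half that falls on the wrong side degenerates to a point and adds nothing to the sum.\<close>

lemma variation_sums_split:
  assumes "s \<le> t" "t \<le> u" "v \<in> variation_sums f s u"
  obtains v1 v2 where "v1 \<in> variation_sums f s t" "v2 \<in> variation_sums f t u" "v = v1 + v2"
proof -
  from assms(3) obtain n x y where v: "v = (\<Sum>i<n. f (y i) - f (x i))"
    and xy: "\<And>i. i < n \<Longrightarrow> x i \<le> y i \<and> {x i..y i} \<subseteq> {s..u}"
    and disj: "disjoint_family_on (\<lambda>i. {x i<..<y i}) {..<(n::nat)}"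
    unfolding variation_sums_def by blast
  have eq: "f (y i) - f (x i) =
     (f (min (y i) t) - f (min (x i) t)) + (f (max (y i) t) - f (max (x i) t))" for i
    by (auto simp: min_def max_def)
  have d: "{x i<..<y i} \<inter> {x j<..<y j} = {}" if "i < n" "j < n" "i \<noteq> j" for i j
    using disj that unfolding disjoint_family_on_def by blast
  have xy': "x i \<le> y i" "s \<le> x i" "y i \<le> u" if "i < n" for i
    using xy[OF that] by auto
  show ?thesis
  proof (rule that)
    have "disjoint_family_on (\<lambda>i. {min (x i) t<..<min (y i) t}) {..<n}"
      unfolding disjoint_family_on_def using d by (fastforce simp: min_less_iff_disj)
    then show "(\<Sum>i<n. f (min (y i) t) - f (min (x i) t)) \<in> variation_sums f s t"
      
    proof (intro psumsI)
      show "min (x i) t \<le> min (y i) t \<and> s \<le> min (x i) t \<and> min (y i) t \<le> t" if "i < n" for i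
        using xy'[OF that] assms(1,2) by (auto simp: min_def)
    qed
    have "disjoint_family_on (\<lambda>i. {max (x i) t<..<max (y i) t}) {..<n}"
      unfolding disjoint_family_on_def using d by (fastforce simp: less_max_iff_disj)
    then show "(\<Sum>i<n. f (max (y i) t) - f (max (x i) t)) \<in> variation_sums f t u"
      
    proof (intro psumsI)
      show "max (x i) t \<le> max (y i) t \<and> t \<le> max (x i) t \<and> max (y i) t \<le> u" if "i < n" for i
        using xy'[OF that] assms(1,2) by (auto simp: max_def)
    qed
    show "v = (\<Sum>i<n. f (min (y i) t) - f (min (x i) t)) + (\<Sum>i<n. f (max (y i) t) - f (max (x i) t))"
      unfolding v by (simp add: sum.distrib[symmetric] eq)
  qed
qed

text \<open>Adding the interval from \<open>s\<close> to \<open>t\<close> to a family shows that the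
  positive variation grows at least as fast as \<open>f\<close>, which makes the second function of
  the decomposition monotone.\<close>

lemma variation_sums_append:
  assumes "0 \<le> s" "s \<le> t" "v \<in> variation_sums f 0 s"
  shows "v + (f t - f s) \<in> variation_sums f 0 t"
proof -
  from assms(3) obtain n x y where v: "v = (\<Sum>i<n. f (y i) - f (x i))"
    and xy: "\<And>i. i < n \<Longrightarrow> x i \<le> y i \<and> {x i..y i} \<subseteq> {0..s}"
    and disj: "disjoint_family_on (\<lambda>i. {x i<..<y i}) {..<(n::nat)}"
    unfolding variation_sums_def by blast
  have d: "{x i<..<y i} \<inter> {x j<..<y j} = {}" if "i < n" "j < n" "i \<noteq> j" for i j
    using disj that unfolding disjoint_family_on_def by blast
  have xy': "x i \<le> y i" "0 \<le> x i" "y i \<le> s" if "i < n" for i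
    using xy[OF that] by auto
  let ?x = "x(n := s)" and ?y = "y(n := t)"
  have "{?x i<..<?y i} \<inter> {?x j<..<?y j} = {}" if "i < Suc n" "j < Suc n" "i \<noteq> j" for i j
    using that d[of i j] xy'(3)[of i] xy'(3)[of j] by (cases "i = n"; cases "j = n") auto
  then have "disjoint_family_on (\<lambda>i. {?x i<..<?y i}) {..<Suc n}"
    unfolding disjoint_family_on_def by blast
  moreover have "\<forall>i<Suc n. ?x i \<le> ?y i \<and> {?x i..?y i} \<subseteq> {0..t}"
    using xy' assms by (fastforce simp: less_Suc_eq)
  moreover have "v + (f t - f s) = (\<Sum>i<Suc n. f (?y i) - f (?x i))"
    unfolding v by simp
  ultimately show ?thesis unfolding variation_sums_def by blast
qed

text \<open>The unit interval is cut into \<open>N\<close> pieces shorter than the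
  \<open>\<delta>\<close> belonging to the tolerance 1. Each piece adds at most 1, so
  \<open>N\<close> is a bound.\<close>

lemma abs_continuous_variation_sums_bdd:
  fixes f :: "real \<Rightarrow> real"
  assumes "abs_continuous_on {0..1} f"
  shows "bdd_above (variation_sums f 0 1)"
proof -
  obtain \<delta> where \<delta>: "\<delta> > 0"
    "\<And>(I :: nat set) x y. finite I \<Longrightarrow> (\<And>i. i \<in> I \<Longrightarrow> x i \<le> y i \<and> {x i..y i} \<subseteq> {0..1}) \<Longrightarrow>
     disjoint_family_on (\<lambda>i. {x i<..<y i}) I \<Longrightarrow> (\<Sum>i\<in>I. y i - x i) < \<delta> \<Longrightarrow>
     (\<Sum>i\<in>I. norm (f (y i) - f (x i))) < 1"
    using abs_continuous_on_finite_family[OF assms zero_less_one] by blast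
  obtain N where N: "N > 0" "1 / real N < \<delta>"
    using real_arch_inverse[of \<delta>] \<delta>(1) by (auto simp: inverse_eq_divide)
  have small: "v \<le> 1" if v: "v \<in> variation_sums f s t" and st: "0 \<le> s" "s \<le> t" "t \<le> 1" "t - s < \<delta>" for v s t
  proof -
    from v obtain n x y where v: "v = (\<Sum>i<n. f (y i) - f (x i))"
      and xy: "\<And>i. i < n \<Longrightarrow> x i \<le> y i \<and> {x i..y i} \<subseteq> {s..t}"
      and disj: "disjoint_family_on (\<lambda>i. {x i<..<y i}) {..<(n::nat)}"
      unfolding variation_sums_def by blast
    have "(\<Sum>i<n. y i - x i) \<le> t - s"
      by (rule disjoint_open_intervals_sum_le) (use xy disj st in auto)
    moreover have "x i \<le> y i \<and> {x i..y i} \<subseteq> {0..1}" if "i < n" for i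
      using xy[OF that] st by auto
    ultimately have "(\<Sum>i<n. norm (f (y i) - f (x i))) < 1"
      using st disj by (intro \<delta>(2)) auto
    moreover have "v \<le> (\<Sum>i<n. norm (f (y i) - f (x i)))"
      unfolding v by (rule sum_mono) simp
    ultimately show ?thesis by simp
  qed
  have "\<forall>v\<in>variation_sums f 0 (real k / N). v \<le> real k" if "k \<le> N" for k
    using that
  proof (induction k)
    case 0
    show ?case
    proof
      fix v assume "v \<in> variation_sums f 0 (real 0 / real N)"
      then obtain n :: nat and x y where v: "v = (\<Sum>i<n. f (y i) - f (x i))"
        and xy: "\<And>i. i < n \<Longrightarrow> x i \<le> y i \<and> {x i..y i} \<subseteq> {0..real 0 / real N}"
        unfolding variation_sums_def by blast
      have "x i = y i" if "i < n" for i
        using xy[OF that] atLeastatMost_subset_iff[of "x i" "y i" 0 0] by simp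
      then show "v \<le> real 0" unfolding v by simp
    qed
  next
    case (Suc k)
    show ?case
    proof
      fix v assume v: "v \<in> variation_sums f 0 (real (Suc k) / N)"
      have k: "0 \<le> real k / N" "real k / N \<le> real (Suc k) / N" "real (Suc k) / N \<le> 1"
          "real (Suc k) / N - real k / N = 1 / N"
        using Suc.prems N(1) by (simp_all add: divide_simps)
      from variation_sums_split[OF k(1,2) v] obtain v1 v2 where
        "v1 \<in> variation_sums f 0 (real k / N)" "v2 \<in> variation_sums f (real k / N) (real (Suc k) / N)" "v = v1 + v2"
        by blast
      then show "v \<le> real (Suc k)"
        using Suc small[of v2 "real k / N" "real (Suc k) / N"] k N(2) by fastforce
    qed
  qed
  from this[of N] N show ?thesis by (auto simp: bdd_above_def)
qed

text \<open>\<open>P\<close> inherits absolute continuity: each increment of \<open>P\<close> is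
  nearly attained by a variation sum inside the same interval. All these subintervals together form
  a disjoint family of no greater total length, to which the absolute continuity of \<open>f\<close>
  applies.\<close>

lemma abs_continuous_jordan:
  fixes f :: "real \<Rightarrow> real"
  assumes ac: "abs_continuous_on {0..1} f"
  obtains P where "mono_on {0..1} P" "mono_on {0..1} (\<lambda>x. P x - f x)" "abs_continuous_on {0..1} P"
proof -
  define P where "P = (\<lambda>t. Sup (variation_sums f 0 t))"
  have bdd: "bdd_above (variation_sums f s t)" if "0 \<le> s" "t \<le> 1" for s t
    using bdd_above_mono[OF abs_continuous_variation_sums_bdd[OF ac] variation_sums_mono] that by simp
  have ne: "variation_sums f s t \<noteq> {}" for s t using variation_sums_0 by blast
  have mono: "P s \<le> P t" if "0 \<le> s" "s \<le> t" "t \<le> 1" for s t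
    unfolding P_def using that by (intro cSup_subset_mono variation_sums_mono ne bdd) auto
  have mono': "P s + (f t - f s) \<le> P t" if st: "0 \<le> s" "s \<le> t" "t \<le> 1" for s t
  proof -
    have "P s \<le> P t - (f t - f s)"
      unfolding P_def
    proof (rule cSup_least[OF ne])
      fix v assume "v \<in> variation_sums f 0 s"
      from cSup_upper[OF variation_sums_append[OF st(1,2) this] bdd[of 0 t]] st
      show "v \<le> Sup (variation_sums f 0 t) - (f t - f s)" by simp
    qed
    then show ?thesis by simp
  qed
  have approx: "\<exists>v\<in>variation_sums f s t. P t - P s < v + e" if st: "0 \<le> s" "s \<le> t" "t \<le> 1" and "e > 0" for s t e
  proof -
    have "P t - e < Sup (variation_sums f 0 t)" using \<open>e > 0\<close> by (simp add: P_def)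
    then obtain v where v: "v \<in> variation_sums f 0 t" "P t - e < v"
      using less_cSup_iff[OF ne bdd[of 0 t]] st by auto
    from variation_sums_split[OF st(1,2) v(1)] obtain v1 v2 where
      v12: "v1 \<in> variation_sums f 0 s" "v2 \<in> variation_sums f s t" "v = v1 + v2" by blast
    have "v1 \<le> P s" unfolding P_def using st by (intro cSup_upper v12 bdd) auto
    then show ?thesis using v v12 by (intro bexI[of _ v2]) auto
  qed
  have "abs_continuous_on {0..1} P"
    unfolding abs_continuous_on_def
  proof (intro allI impI)
    fix \<epsilon> :: real assume "\<epsilon> > 0"
    then have "\<epsilon> / 2 > 0" by simp
    from abs_continuous_on_finite_family[OF ac this, where 'i = "nat \<times> nat"]
    obtain \<delta> where \<delta>: "\<delta> > 0"
      "\<And>(I :: (nat \<times> nat) set) x y. finite I \<Longrightarrow> (\<And>i. i \<in> I \<Longrightarrow> x i \<le> y i \<and> {x i..y i} \<subseteq> {0..1}) \<Longrightarrow>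
         disjoint_family_on (\<lambda>i. {x i<..<y i}) I \<Longrightarrow> (\<Sum>i\<in>I. y i - x i) < \<delta> \<Longrightarrow>
         (\<Sum>i\<in>I. norm (f (y i) - f (x i))) < \<epsilon> / 2"
      by blast
    show "\<exists>\<delta>>0. \<forall>(n::nat) x y. (\<forall>i<n. x i \<le> y i \<and> {x i..y i} \<subseteq> {0..1}) \<and>
        disjoint_family_on (\<lambda>i. {x i<..<y i}) {..<n} \<and> (\<Sum>i<n. y i - x i) < \<delta>
        \<longrightarrow> (\<Sum>i<n. norm (P (y i) - P (x i))) < \<epsilon>"
    proof (intro exI[of _ \<delta>] conjI \<delta>(1) allI impI, elim conjE)
      fix n :: nat and x y :: "nat \<Rightarrow> real"
      assume xy: "\<forall>i<n. x i \<le> y i \<and> {x i..y i} \<subseteq> {0..1}"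
        and disj: "disjoint_family_on (\<lambda>i. {x i<..<y i}) {..<n}"
        and len: "(\<Sum>i<n. y i - x i) < \<delta>"
      have xy': "0 \<le> x i" "x i \<le> y i" "y i \<le> 1" if "i < n" for i
        using xy that by auto
      \<comment> \<open>The \<open>n\<close> approximation errors then add up to at most half of the
        tolerance; the added 1 keeps the denominator positive when \<open>n = 0\<close>.\<close>
      define e where "e = \<epsilon> / (2 * (real n + 1))"
      have "e > 0" using \<open>\<epsilon> > 0\<close> by (simp add: e_def)
      have "\<forall>i. \<exists>m X Y. i < n \<longrightarrow> P (y i) - P (x i) < (\<Sum>j<(m::nat). f (Y j) - f (X j)) + e \<and>
         (\<forall>j<m. X j \<le> Y j \<and> {X j..Y j} \<subseteq> {x i..y i}) \<and> disjoint_family_on (\<lambda>j. {X j<..<Y j}) {..<m}"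
        using approx[OF xy' \<open>e > 0\<close>] unfolding variation_sums_def by blast
      from choice[OF this] obtain m where "\<forall>i. \<exists>X Y. i < n \<longrightarrow>
          P (y i) - P (x i) < (\<Sum>j<(m i::nat). f (Y j) - f (X j)) + e \<and>
          (\<forall>j<m i. X j \<le> Y j \<and> {X j..Y j} \<subseteq> {x i..y i}) \<and> disjoint_family_on (\<lambda>j. {X j<..<Y j}) {..<m i}" ..
      from choice[OF this] obtain X where "\<forall>i. \<exists>Y. i < n \<longrightarrow>
          P (y i) - P (x i) < (\<Sum>j<m i. f (Y j) - f (X i j)) + e \<and>
          (\<forall>j<m i. X i j \<le> Y j \<and> {X i j..Y j} \<subseteq> {x i..y i}) \<and> disjoint_family_on (\<lambda>j. {X i j<..<Y j}) {..<m i}" ..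
      from choice[OF this] obtain Y where "\<forall>i. i < n \<longrightarrow>
          P (y i) - P (x i) < (\<Sum>j<m i. f (Y i j) - f (X i j)) + e \<and>
          (\<forall>j<m i. X i j \<le> Y i j \<and> {X i j..Y i j} \<subseteq> {x i..y i}) \<and> disjoint_family_on (\<lambda>j. {X i j<..<Y i j}) {..<m i}" ..
      then have XY: "\<And>i. i < n \<Longrightarrow> P (y i) - P (x i) < (\<Sum>j<m i. f (Y i j) - f (X i j)) + e"
          "\<And>i j. i < n \<Longrightarrow> j < m i \<Longrightarrow> X i j \<le> Y i j \<and> {X i j..Y i j} \<subseteq> {x i..y i}"
          "\<And>i. i < n \<Longrightarrow> disjoint_family_on (\<lambda>j. {X i j<..<Y i j}) {..<m i}"
        by blast+
      let ?I = "SIGMA i:{..<n}. {..<m i}"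
      let ?X = "\<lambda>(i, j). X i j" and ?Y = "\<lambda>(i, j). Y i j"
      have sub: "{X i j<..<Y i j} \<subseteq> {x i<..<y i}" if "i < n" "j < m i" for i j
        using XY(2)[OF that] by auto
      have "disjoint_family_on (\<lambda>p. {?X p<..<?Y p}) ?I"
        unfolding disjoint_family_on_def
      proof (intro ballI impI)
        fix p q assume "p \<in> ?I" "q \<in> ?I" "p \<noteq> q"
        then obtain i j k l where p: "p = (i, j)" "q = (k, l)" "i < n" "j < m i" "k < n" "l < m k"
            "(i, j) \<noteq> (k, l)" by blast
        have "{X i j<..<Y i j} \<inter> {X k l<..<Y k l} = {}"
        proof (cases "i = k")
          case True
          then show ?thesis using XY(3)[OF p(3)] p unfolding disjoint_family_on_def by auto
        next
          case False
          then have "{x i<..<y i} \<inter> {x k<..<y k} = {}"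
            using disj p unfolding disjoint_family_on_def by auto
          then show ?thesis using sub[OF p(3,4)] sub[OF p(5,6)] by blast
        qed
        then show "{?X p<..<?Y p} \<inter> {?X q<..<?Y q} = {}" by (simp add: p)
      qed
      moreover have "(\<Sum>p\<in>?I. ?Y p - ?X p) \<le> (\<Sum>i<n. y i - x i)"
      proof -
        have "(\<Sum>p\<in>?I. ?Y p - ?X p) = (\<Sum>i<n. \<Sum>j<m i. Y i j - X i j)"
          by (subst sum.Sigma) (auto simp: split_def)
        also have "\<dots> \<le> (\<Sum>i<n. y i - x i)"
          by (intro sum_mono disjoint_open_intervals_sum_le) (use XY xy' in auto)
        finally show ?thesis .
      qed
      moreover have "?X p \<le> ?Y p \<and> {?X p..?Y p} \<subseteq> {0..1}" if p: "p \<in> ?I" for p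
      proof -
        obtain i j where "p = (i, j)" "i < n" "j < m i" using p by blast
        then show ?thesis using XY(2)[of i j] xy'[of i] by fastforce
      qed
      ultimately have "(\<Sum>p\<in>?I. norm (f (?Y p) - f (?X p))) < \<epsilon> / 2"
        using len by (intro \<delta>(2)) auto
      then have *: "(\<Sum>i<n. \<Sum>j<m i. norm (f (Y i j) - f (X i j))) < \<epsilon> / 2"
        by (subst sum.Sigma) (auto simp: split_def)
      have "(\<Sum>i<n. norm (P (y i) - P (x i))) \<le> (\<Sum>i<n. (\<Sum>j<m i. norm (f (Y i j) - f (X i j))) + e)"
      proof (rule sum_mono)
        fix i assume i: "i \<in> {..<n}"
        have "norm (P (y i) - P (x i)) = P (y i) - P (x i)" using mono[OF xy'] i by simp
        also have "\<dots> \<le> (\<Sum>j<m i. f (Y i j) - f (X i j)) + e" using XY(1)[of i] i by simp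
        also have "\<dots> \<le> (\<Sum>j<m i. norm (f (Y i j) - f (X i j))) + e"
          by (intro add_right_mono sum_mono) simp
        finally show "norm (P (y i) - P (x i)) \<le> (\<Sum>j<m i. norm (f (Y i j) - f (X i j))) + e" .
      qed
      also have "\<dots> < \<epsilon> / 2 + n * e" using * by (simp add: sum.distrib)
      also have "\<dots> \<le> \<epsilon>" using \<open>\<epsilon> > 0\<close> by (simp add: e_def divide_simps) (simp add: algebra_simps)
      finally show "(\<Sum>i<n. norm (P (y i) - P (x i))) < \<epsilon>" .
    qed
  qed
  moreover have "mono_on {0..1} P" using mono by (auto simp: mono_on_def)
  moreover have "mono_on {0..1} (\<lambda>x. P x - f x)" using mono' by (fastforce simp: mono_on_def)
  ultimately show ?thesis using that by blast
qed

text \<open>Two dominating functions cover differences; a constant as the second one gives plain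
  domination, as for coordinates.\<close>

lemma abs_continuous_on_dominated:
  assumes "abs_continuous_on S f" "abs_continuous_on S g"
    and "\<And>x y. x \<in> S \<Longrightarrow> y \<in> S \<Longrightarrow> norm (h y - h x) \<le> norm (f y - f x) + norm (g y - g x)"
  shows "abs_continuous_on S h"
  unfolding abs_continuous_on_def
proof (intro allI impI)
  fix \<epsilon> :: real assume "\<epsilon> > 0"
  then have e2: "\<epsilon> / 2 > 0" by simp
  obtain \<delta>1 where d1: "\<delta>1 > 0" "\<And>(n::nat) x y. (\<forall>i<n. x i \<le> y i \<and> {x i..y i} \<subseteq> S) \<and>
        disjoint_family_on (\<lambda>i. {x i<..<y i}) {..<n} \<and> (\<Sum>i<n. y i - x i) < \<delta>1
        \<longrightarrow> (\<Sum>i<n. norm (f (y i) - f (x i))) < \<epsilon> / 2"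
    using assms(1) e2 unfolding abs_continuous_on_def by blast
  obtain \<delta>2 where d2: "\<delta>2 > 0" "\<And>(n::nat) x y. (\<forall>i<n. x i \<le> y i \<and> {x i..y i} \<subseteq> S) \<and>
        disjoint_family_on (\<lambda>i. {x i<..<y i}) {..<n} \<and> (\<Sum>i<n. y i - x i) < \<delta>2
        \<longrightarrow> (\<Sum>i<n. norm (g (y i) - g (x i))) < \<epsilon> / 2"
    using assms(2) e2 unfolding abs_continuous_on_def by blast
  show "\<exists>\<delta>>0. \<forall>(n::nat) x y. (\<forall>i<n. x i \<le> y i \<and> {x i..y i} \<subseteq> S) \<and>
        disjoint_family_on (\<lambda>i. {x i<..<y i}) {..<n} \<and> (\<Sum>i<n. y i - x i) < \<delta>
        \<longrightarrow> (\<Sum>i<n. norm (h (y i) - h (x i))) < \<epsilon>"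
  proof (intro exI[of _ "min \<delta>1 \<delta>2"] conjI allI impI)
    fix n :: nat and x y
    assume a: "(\<forall>i<n. x i \<le> y i \<and> {x i..y i} \<subseteq> S) \<and>
        disjoint_family_on (\<lambda>i. {x i<..<y i}) {..<n} \<and> (\<Sum>i<n. y i - x i) < min \<delta>1 \<delta>2"
    have "(\<Sum>i<n. norm (h (y i) - h (x i))) \<le>
        (\<Sum>i<n. norm (f (y i) - f (x i)) + norm (g (y i) - g (x i)))"
    proof (intro sum_mono assms(3))
      fix i assume "i \<in> {..<n}"
      then have "x i \<le> y i" "{x i..y i} \<subseteq> S" using a by auto
      moreover from this(1) have "x i \<in> {x i..y i}" "y i \<in> {x i..y i}" by auto
      ultimately show "x i \<in> S" "y i \<in> S" by blast+
    qed
    also have "\<dots> < \<epsilon>"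
      using d1(2)[of n x y] d2(2)[of n x y] a by (simp add: sum.distrib)
    finally show "(\<Sum>i<n. norm (h (y i) - h (x i))) < \<epsilon>" .
  qed (use d1 d2 in auto)
qed

lemma abs_continuous_on_const: "abs_continuous_on S (\<lambda>x. c)"
  unfolding abs_continuous_on_def by (auto intro!: exI[of _ 1])

lemma abs_continuous_on_lipschitz:
  assumes "\<And>x y. x \<in> S \<Longrightarrow> y \<in> S \<Longrightarrow> norm (f y - f x) \<le> L * \<bar>y - x\<bar>"
  shows "abs_continuous_on S f"
  unfolding abs_continuous_on_def
proof (intro allI impI)
  fix \<epsilon> :: real assume "\<epsilon> > 0"
  show "\<exists>\<delta>>0. \<forall>(n::nat) x y. (\<forall>i<n. x i \<le> y i \<and> {x i..y i} \<subseteq> S) \<and>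
        disjoint_family_on (\<lambda>i. {x i<..<y i}) {..<n} \<and> (\<Sum>i<n. y i - x i) < \<delta>
        \<longrightarrow> (\<Sum>i<n. norm (f (y i) - f (x i))) < \<epsilon>"
  proof (intro exI[of _ "\<epsilon> / (\<bar>L\<bar> + 1)"] conjI allI impI)
    fix n :: nat and x y
    assume a: "(\<forall>i<n. x i \<le> y i \<and> {x i..y i} \<subseteq> S) \<and>
        disjoint_family_on (\<lambda>i. {x i<..<y i}) {..<n} \<and> (\<Sum>i<n. y i - x i) < \<epsilon> / (\<bar>L\<bar> + 1)"
    have "(\<Sum>i<n. norm (f (y i) - f (x i))) \<le> (\<Sum>i<n. (\<bar>L\<bar> + 1) * (y i - x i))"
    proof (intro sum_mono)
      fix i assume "i \<in> {..<n}"
      then have xy: "x i \<le> y i" "{x i..y i} \<subseteq> S" using a by auto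
      moreover from this(1) have "x i \<in> {x i..y i}" "y i \<in> {x i..y i}" by auto
      ultimately have "x i \<in> S" "y i \<in> S" by blast+
      then have "norm (f (y i) - f (x i)) \<le> L * \<bar>y i - x i\<bar>" by (rule assms)
      also have "\<dots> \<le> (\<bar>L\<bar> + 1) * (y i - x i)" using xy(1) by (intro mult_mono) auto
      finally show "norm (f (y i) - f (x i)) \<le> (\<bar>L\<bar> + 1) * (y i - x i)" .
    qed
    also have "\<dots> = (\<bar>L\<bar> + 1) * (\<Sum>i<n. y i - x i)" by (simp add: sum_distrib_left)
    also have "\<dots> < \<epsilon>" using a by (simp add: pos_less_divide_eq mult.commute)
    finally show "(\<Sum>i<n. norm (f (y i) - f (x i))) < \<epsilon>" .
  qed (use \<open>\<epsilon> > 0\<close> in auto)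
qed

lemma abs_continuous_real_integral:
  fixes f :: "real \<Rightarrow> real"
  assumes "abs_continuous_on {0..1} f"
  obtains w where "w absolutely_integrable_on {0..1}"
    "\<And>t. t \<in> {0..1} \<Longrightarrow> (w has_integral (f t - f 0)) {0..t}"
proof -
  obtain P where P: "mono_on {0..1} P" "mono_on {0..1} (\<lambda>x. P x - f x)" "abs_continuous_on {0..1} P"
    using abs_continuous_jordan[OF assms] .
  have "abs_continuous_on {0..1} (\<lambda>x. P x - f x)"
    by (rule abs_continuous_on_dominated[OF P(3) assms]) (simp add: abs_if)
  from mono_abs_continuous_integral[OF P(2) this]
  obtain w2 where w2: "w2 absolutely_integrable_on {0..1}"
    "\<And>t. t \<in> {0..1} \<Longrightarrow> (w2 has_integral (P t - f t - (P 0 - f 0))) {0..t}" by blast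
  from mono_abs_continuous_integral[OF P(1,3)]
  obtain w1 where w1: "w1 absolutely_integrable_on {0..1}"
    "\<And>t. t \<in> {0..1} \<Longrightarrow> (w1 has_integral (P t - P 0)) {0..t}" by blast
  show ?thesis
  proof (rule that)
    show "(\<lambda>x. w1 x - w2 x) absolutely_integrable_on {0..1}"
      using w1(1) w2(1) by (rule set_integral_diff(1))
    show "((\<lambda>x. w1 x - w2 x) has_integral (f t - f 0)) {0..t}" if "t \<in> {0..1}" for t
      using has_integral_diff[OF w1(2)[OF that] w2(2)[OF that]] by (simp add: algebra_simps)
  qed
qed

theorem abs_continuous_integral:
  fixes f :: "real \<Rightarrow> 'a::euclidean_space"
  assumes ac: "abs_continuous_on {0..1} f"
  obtains w where "w absolutely_integrable_on {0..1}"
    "\<And>t. t \<in> {0..1} \<Longrightarrow> (w has_integral (f t - f 0)) {0..t}"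
proof -
  have "\<exists>w. w absolutely_integrable_on {0..1} \<and>
     (\<forall>t\<in>{0..1}. (w has_integral (f t \<bullet> b - f 0 \<bullet> b)) {0..t})" if "b \<in> Basis" for b
  proof -
    have "abs_continuous_on {0..1} (\<lambda>x. f x \<bullet> b)"
      by (rule abs_continuous_on_dominated[OF ac abs_continuous_on_const[of _ "0::real"]])
        (use that in \<open>auto simp: inner_diff_left[symmetric] intro: Basis_le_norm\<close>)
    then show ?thesis by (rule abs_continuous_real_integral) (intro exI conjI ballI)
  qed
  then have "\<forall>b\<in>Basis. \<exists>w. w absolutely_integrable_on {0..1} \<and>
     (\<forall>t\<in>{0..1}. (w has_integral (f t \<bullet> b - f 0 \<bullet> b)) {0..t})" by blast
  from bchoice[OF this] obtain w where w: "\<And>b. b \<in> Basis \<Longrightarrow> w b absolutely_integrable_on {0..1}"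
    "\<And>b t. b \<in> Basis \<Longrightarrow> t \<in> {0..1} \<Longrightarrow> (w b has_integral (f t \<bullet> b - f 0 \<bullet> b)) {0..t}"
    by blast
  show ?thesis
  proof (rule that)
    show "(\<lambda>x. \<Sum>b\<in>Basis. w b x *\<^sub>R b) absolutely_integrable_on {0..1}"
      by (intro absolutely_integrable_sum absolutely_integrable_scaleR_right w) auto
    show "((\<lambda>x. \<Sum>b\<in>Basis. w b x *\<^sub>R b) has_integral (f t - f 0)) {0..t}" if "t \<in> {0..1}" for t
    proof -
      have "((\<lambda>x. \<Sum>b\<in>Basis. w b x *\<^sub>R b) has_integral
          (\<Sum>b\<in>Basis. (f t \<bullet> b - f 0 \<bullet> b) *\<^sub>R b)) {0..t}"
        by (intro has_integral_sum has_integral_scaleR_left w(2) that) auto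
      then show ?thesis
        by (simp add: inner_diff_left[symmetric] euclidean_representation)
    qed
  qed
qed

text \<open>Lebesgue differentiation. The available statement concerns right-hand difference
  quotients, so the left-hand ones are obtained from the reflected integrand, with the reflected
  exceptional set.\<close>

lemma indefinite_integral_AE_derivative:
  fixes w :: "real \<Rightarrow> 'a::euclidean_space"
  assumes w: "w integrable_on {0..1}"
  obtains N where "negligible N"
    "\<And>x. x \<in> {0<..<1} - N \<Longrightarrow> ((\<lambda>t. integral {0..t} w) has_vector_derivative w x) (at x)"
proof -
  \<comment> \<open>Extension by zero makes the integrand integrable over every interval, as the
    differentiation theorem requires.\<close>
  define W where "W = (\<lambda>x. if x \<in> {0..1} then w x else 0)"
  have W: "W integrable_on {a..b}" for a b
  proof -
    have "W integrable_on UNIV"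
      using w integrable_restrict_UNIV[of "{0..1}" w] by (simp only: W_def)
    then show ?thesis by (rule integrable_on_subinterval) simp
  qed
  define F where "F = (\<lambda>t. integral {0..t} w)"
  have F: "F y - F x = integral {x..y} W" if "0 \<le> x" "x \<le> y" "y \<le> 1" for x y
  proof -
    have "integral {0..x} w + integral {x..y} w = integral {0..y} w"
      using that by (intro Henstock_Kurzweil_Integration.integral_combine
          integrable_on_subinterval[OF w]) auto
    moreover have "integral {x..y} w = integral {x..y} W"
      using that by (intro integral_cong) (auto simp: W_def)
    ultimately show ?thesis by (simp add: F_def algebra_simps)
  qed
  have "\<And>a b. W integrable_on cbox a b" using W by (simp add: cbox_interval)
  from integrable_ccontinuous_explicit[OF this] obtain N1 where N1: "negligible N1"
    "\<And>x e. \<lbrakk>x \<notin> N1; 0 < e\<rbrakk> \<Longrightarrow> \<exists>d>0. \<forall>h. 0 < h \<and> h < d \<longrightarrow>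
        norm (integral {x..x + h} W /\<^sub>R h - W x) < e"
    by (auto simp: cbox_interval)
  have refl: "(\<lambda>x. W (- x)) integrable_on {a..b}" for a b
    using W[of "-b" "-a"] Henstock_Kurzweil_Integration.integrable_reflect_real[where f = W and a = "-b" and b = "-a"] by simp
  then have "\<And>a b. (\<lambda>x. W (- x)) integrable_on cbox a b" by (simp add: cbox_interval)
  from integrable_ccontinuous_explicit[OF this] obtain N2 where N2: "negligible N2"
    "\<And>x e. \<lbrakk>x \<notin> N2; 0 < e\<rbrakk> \<Longrightarrow> \<exists>d>0. \<forall>h. 0 < h \<and> h < d \<longrightarrow>
        norm (integral {x..x + h} (\<lambda>x. W (- x)) /\<^sub>R h - W (- x)) < e"
    by (auto simp: cbox_interval)
  show ?thesis
  proof (rule that[of "N1 \<union> uminus ` N2"])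
    show "negligible (N1 \<union> uminus ` N2)"
      using N1(1) N2(1)
      by (intro negligible_Un negligible_differentiable_image_negligible derivative_intros) auto
    fix x assume x: "x \<in> {0<..<1} - (N1 \<union> uminus ` N2)"
    then have xN: "x \<notin> N1" "- x \<notin> N2" by (auto simp: image_iff)
    have "W x = w x" using x by (simp add: W_def)
    have "\<exists>d>0. \<forall>y. norm (y - x) < d \<longrightarrow> norm (F y - F x - (y - x) *\<^sub>R w x) \<le> e * norm (y - x)"
      if "e > 0" for e
    proof -
      obtain d1 where d1: "d1 > 0" "\<And>h. 0 < h \<and> h < d1 \<Longrightarrow> norm (integral {x..x + h} W /\<^sub>R h - w x) < e"
        using N1(2)[OF xN(1) \<open>e > 0\<close>] \<open>W x = w x\<close> by auto
      obtain d2 where d2: "d2 > 0" "\<And>h. 0 < h \<and> h < d2 \<Longrightarrow>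
          norm (integral {-x..-x + h} (\<lambda>x. W (- x)) /\<^sub>R h - w x) < e"
        using N2(2)[OF xN(2) \<open>e > 0\<close>] \<open>W x = w x\<close> by auto
      define d where "d = min (min d1 d2) (min x (1 - x))"
      have *: "norm (z - h *\<^sub>R w x) \<le> e * h" if "norm (z /\<^sub>R h - w x) < e" "h > 0" for z and h :: real
      proof -
        have "z - h *\<^sub>R w x = h *\<^sub>R (z /\<^sub>R h - w x)" using that by (simp add: scaleR_diff_right)
        then show ?thesis using that by (simp add: mult.commute)
      qed
      show ?thesis
      proof (intro exI[of _ d] conjI allI impI)
        show "d > 0" using d1 d2 x by (simp add: d_def)
        fix y assume y: "norm (y - x) < d"
        consider "y = x" | "y > x" | "y < x" by linarith
        then show "norm (F y - F x - (y - x) *\<^sub>R w x) \<le> e * norm (y - x)"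
        proof cases
          case 2
          then have "norm (integral {x..x + (y - x)} W /\<^sub>R (y - x) - w x) < e"
            using y by (intro d1(2)) (auto simp: d_def)
          from *[OF this] have "norm (integral {x..y} W - (y - x) *\<^sub>R w x) \<le> e * (y - x)"
            using 2 by simp
          then show ?thesis using F[of x y] 2 x y by (simp add: d_def)
        next
          case 3
          then have "norm (integral {-x..-x + (x - y)} (\<lambda>x. W (- x)) /\<^sub>R (x - y) - w x) < e"
            using y by (intro d2(2)) (auto simp: d_def)
          from *[OF this] have "norm (integral {-x..-y} (\<lambda>x. W (- x)) - (x - y) *\<^sub>R w x) \<le> e * (x - y)"
            using 3 by simp
          moreover have "F x - F y = integral {-x..-y} (\<lambda>x. W (- x))"
            using F[of y x] 3 x y by (simp add: d_def)
          ultimately have "norm (F x - F y - (x - y) *\<^sub>R w x) \<le> e * (x - y)" by simp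
          moreover have "F y - F x - (y - x) *\<^sub>R w x = - (F x - F y - (x - y) *\<^sub>R w x)"
            by (simp add: algebra_simps)
          ultimately show ?thesis using 3 by (simp only: norm_minus_cancel) simp
        qed simp
      qed
    qed
    then show "((\<lambda>t. integral {0..t} w) has_vector_derivative w x) (at x)"
      unfolding has_vector_derivative_def F_def[symmetric] has_derivative_at_alt
      by (auto intro: bounded_linear_scaleR_left)
  qed
qed

text \<open>The norm of \<open>w\<close> is split at height \<open>n\<close>. The integral of the
  excess \<open>g n\<close> is small by dominated convergence, uniformly over all families, and the
  bounded part contributes at most \<open>n\<close> times the total length.\<close>

lemma abs_continuous_indefinite_integral:
  fixes w :: "real \<Rightarrow> 'a::euclidean_space"
  assumes w: "w absolutely_integrable_on {0..1}"
  shows "abs_continuous_on {0..1} (\<lambda>t. integral {0..t} w)"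
  unfolding abs_continuous_on_def
proof (intro allI impI)
  fix \<epsilon> :: real assume "\<epsilon> > 0"
  define h where "h = (\<lambda>x. norm (w x))"
  have h: "h absolutely_integrable_on {0..1}" unfolding h_def using w by (rule absolutely_integrable_norm[unfolded comp_def])
  have hi: "h integrable_on {a..b}" if "{a..b} \<subseteq> {0..1}" for a b
    using h that integrable_on_subinterval set_lebesgue_integral_eq_integral(1) by blast
  define g where "g = (\<lambda>(n::nat) x. h x - min (h x) (real n))"
  have g: "g n absolutely_integrable_on {0..1}" for n
    unfolding g_def by (intro set_integral_diff(1) h absolutely_integrable_min_1) simp_all
  have g0: "g n x \<ge> 0" for n x by (simp add: g_def)
  have gi: "g n integrable_on {a..b}" if "{a..b} \<subseteq> {0..1}" for a b n
    using g[of n] that integrable_on_subinterval set_lebesgue_integral_eq_integral(1) by blast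
  have "(\<lambda>n. integral {0..1} (g n)) \<longlonglongrightarrow> integral {0..1} (\<lambda>x::real. 0::real)"
  proof (rule dominated_convergence(2)[where h = h and f = g and g = "\<lambda>x. 0"])
    show "(\<lambda>n. g n x) \<longlonglongrightarrow> 0" if "x \<in> {0..1}" for x
    proof (rule tendsto_eventually)
      show "\<forall>\<^sub>F n in sequentially. g n x = 0"
        using eventually_ge_at_top[of "nat \<lceil>h x\<rceil>"]
      proof eventually_elim
        case (elim n)
        then have "h x \<le> real n" by linarith
        then show ?case by (simp add: g_def)
      qed
    qed
  qed (use gi hi in \<open>auto simp: g_def h_def\<close>)
  then have "\<forall>\<^sub>F n in sequentially. integral {0..1} (g n) < \<epsilon> / 2"
    using \<open>\<epsilon> > 0\<close> by (intro order_tendstoD(2)) auto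
  then obtain n where n: "integral {0..1} (g n) < \<epsilon> / 2" by (auto simp: eventually_sequentially)
  define \<delta> where "\<delta> = \<epsilon> / (2 * (real n + 1))"
  show "\<exists>\<delta>>0. \<forall>(m::nat) x y. (\<forall>i<m. x i \<le> y i \<and> {x i..y i} \<subseteq> {0..1}) \<and>
        disjoint_family_on (\<lambda>i. {x i<..<y i}) {..<m} \<and> (\<Sum>i<m. y i - x i) < \<delta>
        \<longrightarrow> (\<Sum>i<m. norm (integral {0..y i} w - integral {0..x i} w)) < \<epsilon>"
  proof (intro exI[of _ \<delta>] conjI allI impI)
    show "\<delta> > 0" using \<open>\<epsilon> > 0\<close> by (simp add: \<delta>_def)
    fix m :: nat and x y
    assume a: "(\<forall>i<m. x i \<le> y i \<and> {x i..y i} \<subseteq> {0..1}) \<and>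
        disjoint_family_on (\<lambda>i. {x i<..<y i}) {..<m} \<and> (\<Sum>i<m. y i - x i) < \<delta>"
    have xy: "x i \<le> y i" "{x i..y i} \<subseteq> {0..1}" "0 \<le> x i" "y i \<le> 1" if "i < m" for i
      using a that by auto
    define U where "U = (\<Union>i<m. {x i<..<y i})"
    have UN: "(f has_integral (\<Sum>i<m. integral {x i..y i} f)) U"
      if "\<And>i. i < m \<Longrightarrow> f integrable_on {x i..y i}" for f :: "real \<Rightarrow> real"
      unfolding U_def
    proof (rule has_integral_UN)
      show "(f has_integral integral {x i..y i} f) {x i<..<y i}" if "i \<in> {..<m}" for i
        using integrable_integral[OF \<open>\<And>i. i < m \<Longrightarrow> f integrable_on {x i..y i}\<close>, of i] that
        by (simp add: has_integral_Icc_iff_Ioo)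
      show "pairwise (\<lambda>i i'. negligible ({x i<..<y i} \<inter> {x i'<..<y i'})) {..<m}"
        using a by (auto simp: pairwise_def disjoint_family_on_def simp del: Int_greaterThanLessThan)
    qed simp
    have U01: "U \<subseteq> {0..1}" using xy unfolding U_def by fastforce
    have gU: "(g n has_integral (\<Sum>i<m. integral {x i..y i} (g n))) U"
      using gi xy(2) by (intro UN) auto
    have "(\<Sum>i<m. norm (integral {0..y i} w - integral {0..x i} w)) \<le> (\<Sum>i<m. integral {x i..y i} h)"
    proof (rule sum_mono)
      fix i assume "i \<in> {..<m}"
      then have i: "i < m" by simp
      have wi: "w integrable_on {0..1}" using w set_lebesgue_integral_eq_integral(1) by blast
      have "integral {0..x i} w + integral {x i..y i} w = integral {0..y i} w"
        using xy[OF i] by (intro Henstock_Kurzweil_Integration.integral_combine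
            integrable_on_subinterval[OF wi]) auto
      then have "norm (integral {0..y i} w - integral {0..x i} w) = norm (integral {x i..y i} w)"
        by (metis add_diff_cancel_left')
      also have "\<dots> \<le> integral {x i..y i} h"
        using xy[OF i] by (intro integral_norm_bound_integral integrable_on_subinterval[OF wi] hi)
          (auto simp: h_def)
      finally show "norm (integral {0..y i} w - integral {0..x i} w) \<le> integral {x i..y i} h" .
    qed
    also have "(h has_integral (\<Sum>i<m. integral {x i..y i} h)) U"
      using hi xy(2) by (intro UN) auto
    then have "(\<Sum>i<m. integral {x i..y i} h) \<le>
        (\<Sum>i<m. integral {x i..y i} (g n)) + (\<Sum>i<m. integral {x i..y i} (\<lambda>_. real n))"
      by (rule has_integral_le[OF _ has_integral_add[OF gU UN]]) (auto simp: g_def)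
    also have "(\<Sum>i<m. integral {x i..y i} (g n)) \<le> integral {0..1} (g n)"
      using gU U01 gi[of 0 1 n] g0 by (intro has_integral_subset_le[OF U01 gU integrable_integral]) auto
    also have "(\<Sum>i<m. integral {x i..y i} (\<lambda>_. real n)) = real n * (\<Sum>i<m. y i - x i)"
      using xy by (simp add: sum_distrib_left mult.commute)
    also have "\<dots> \<le> real n * \<delta>" using a by (intro mult_left_mono) auto
    also have "\<dots> \<le> \<epsilon> / 2" using \<open>\<epsilon> > 0\<close> by (simp add: \<delta>_def divide_simps)
    finally show "(\<Sum>i<m. norm (integral {0..y i} w - integral {0..x i} w)) < \<epsilon>"
      using n by simp
  qed
qed

section \<open>The cone distance\<close>

text \<open>In the cone with angles scaled by \<open>l\<close>, scaled angles above \<open>pi\<close> are cut off since the shortest path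
  then runs through the apex. If \<open>p\<close> or \<open>q\<close> is \<open>0\<close> the junk angle \<open>pi / 2\<close> is multiplied by \<open>0\<close>.\<close>

definition cone_angle :: "'a::real_inner \<Rightarrow> 'a \<Rightarrow> real" where
  "cone_angle p q = arccos (sgn p \<bullet> sgn q)"

definition cone_dist :: "real \<Rightarrow> 'a::real_inner \<Rightarrow> 'a \<Rightarrow> real" where
  "cone_dist l p q = sqrt ((norm p)\<^sup>2 + (norm q)\<^sup>2 - 2 * norm p * norm q * cos (min (l * cone_angle p q) pi))"

text \<open>The value \<open>0\<close> at the apex matches \<open>elastic\<close>, where parameters with \<open>vel c u = 0\<close> contribute nothing.\<close>

definition cone_metric :: "real \<Rightarrow> 'a::real_inner \<Rightarrow> 'a \<Rightarrow> real" where
  "cone_metric l q v = (if q = 0 then 0 else l\<^sup>2 * ((norm v)\<^sup>2 - (v \<bullet> sgn q)\<^sup>2) + (v \<bullet> sgn q)\<^sup>2)"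

lemma norm_scaleR_sgn: "norm p *\<^sub>R sgn p = (p :: 'a::real_normed_vector)"
  by (cases "p = 0") (simp_all add: sgn_div_norm)

lemma inner_sgn_bounds: "- 1 \<le> sgn p \<bullet> sgn q" "sgn p \<bullet> sgn q \<le> 1" for p q :: "'a::real_inner"
proof -
  have "\<bar>sgn p \<bullet> sgn q\<bar> \<le> norm (sgn p) * norm (sgn q)" by (rule Cauchy_Schwarz_ineq2)
  also have "\<dots> \<le> 1" by (simp add: norm_sgn)
  finally show "- 1 \<le> sgn p \<bullet> sgn q" "sgn p \<bullet> sgn q \<le> 1" by auto
qed

lemma cone_angle_bounds [simp]: "0 \<le> cone_angle p q" "cone_angle p q \<le> pi"
  unfolding cone_angle_def using inner_sgn_bounds[of p q] by (auto intro: arccos_lbound arccos_ubound)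

lemma cos_cone_angle: "cos (cone_angle p q) = sgn p \<bullet> sgn q"
  unfolding cone_angle_def using inner_sgn_bounds[of p q] by simp

lemma cone_angle_commute: "cone_angle p q = cone_angle q p" by (simp add: cone_angle_def inner_commute)

lemma cone_dist_commute: "cone_dist l p q = cone_dist l q p"
  by (simp add: cone_dist_def cone_angle_commute[of q p] algebra_simps)

text \<open>Since the cosine lies between -1 and 1, the radicand lies between the squares of the
  difference and of the sum of the radii; all three claims follow.\<close>

lemma cone_dist_sq: "(cone_dist l p q)\<^sup>2 = (norm p)\<^sup>2 + (norm q)\<^sup>2 - 2 * norm p * norm q * cos (min (l * cone_angle p q) pi)"
  and cone_dist_ge: "\<bar>norm p - norm q\<bar> \<le> cone_dist l p q"
  and cone_dist_le_sum: "cone_dist l p q \<le> norm p + norm q"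
proof -
  let ?c = "cos (min (l * cone_angle p q) pi)"
  have "norm p * norm q * ?c \<le> norm p * norm q * 1" "norm p * norm q * (-1) \<le> norm p * norm q * ?c"
    by (intro mult_left_mono; simp)+
  then have *: "(norm p - norm q)\<^sup>2 \<le> (norm p)\<^sup>2 + (norm q)\<^sup>2 - 2 * norm p * norm q * ?c"
     "(norm p)\<^sup>2 + (norm q)\<^sup>2 - 2 * norm p * norm q * ?c \<le> (norm p + norm q)\<^sup>2"
    by (simp_all add: power2_eq_square algebra_simps)
  moreover have "0 \<le> (norm p - norm q)\<^sup>2" by simp
  ultimately have "0 \<le> (norm p)\<^sup>2 + (norm q)\<^sup>2 - 2 * norm p * norm q * ?c" by linarith
  then show "(cone_dist l p q)\<^sup>2 = (norm p)\<^sup>2 + (norm q)\<^sup>2 - 2 * norm p * norm q * ?c"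
    unfolding cone_dist_def by (rule real_sqrt_pow2)
  show "\<bar>norm p - norm q\<bar> \<le> cone_dist l p q"
    unfolding cone_dist_def by (rule real_le_rsqrt) (use *(1) in simp)
  show "cone_dist l p q \<le> norm p + norm q"
    unfolding cone_dist_def by (rule real_le_lsqrt) (use * in auto)
qed

lemma cone_dist_nonneg [simp]: "0 \<le> cone_dist l p q"
  using cone_dist_ge[of p q l] by linarith

lemma cone_dist_0 [simp]: "cone_dist l 0 q = norm q" "cone_dist l q 0 = norm q"
  by (simp_all add: cone_dist_def)

section \<open>Triangle inequality in the cone\<close>

lemma arccos_triangle:
  fixes x y z :: "'a::real_inner"
  assumes "norm x = 1" "norm y = 1" "norm z = 1"
  shows "arccos (x \<bullet> z) \<le> arccos (x \<bullet> y) + arccos (y \<bullet> z)"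
proof -
  have xx: "x \<bullet> x = 1" "y \<bullet> y = 1" "z \<bullet> z = 1"
    using assms by (simp_all add: dot_square_norm)
  have b: "\<bar>x \<bullet> y\<bar> \<le> 1" "\<bar>y \<bullet> z\<bar> \<le> 1" "\<bar>x \<bullet> z\<bar> \<le> 1"
    using Cauchy_Schwarz_ineq2[of x y] Cauchy_Schwarz_ineq2[of y z] Cauchy_Schwarz_ineq2[of x z] assms
    by simp_all
  let ?a = "x \<bullet> y" and ?b = "y \<bullet> z" and ?c = "x \<bullet> z"
  have "norm (x - ?a *\<^sub>R y) = sqrt (1 - ?a\<^sup>2)"
    by (simp add: norm_eq_sqrt_inner inner_diff_left inner_diff_right xx inner_commute[of y x] power2_eq_square)
  moreover have "norm (z - ?b *\<^sub>R y) = sqrt (1 - ?b\<^sup>2)"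
    by (simp add: norm_eq_sqrt_inner inner_diff_left inner_diff_right xx inner_commute[of z y] power2_eq_square)
  moreover have "(x - ?a *\<^sub>R y) \<bullet> (z - ?b *\<^sub>R y) = ?c - ?a * ?b"
    by (simp add: inner_diff_left inner_diff_right xx)
  \<comment> \<open>Cauchy-Schwarz for the parts of \<open>x\<close> and \<open>z\<close> orthogonal
    to \<open>y\<close>. By the addition theorem this bounds the cosine of the sum of the two arcs
    by \<open>?c\<close>. Monotonicity of \<open>arccos\<close> finishes the case of a sum up to
    \<open>pi\<close>; beyond that the claim is trivial.\<close>
  ultimately have "\<bar>?c - ?a * ?b\<bar> \<le> sqrt (1 - ?a\<^sup>2) * sqrt (1 - ?b\<^sup>2)"
    using Cauchy_Schwarz_ineq2[of "x - ?a *\<^sub>R y" "z - ?b *\<^sub>R y"] by simp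
  then have le: "cos (arccos ?a + arccos ?b) \<le> ?c"
    using b by (simp add: cos_add sin_arccos_abs cos_arccos_abs)
  show ?thesis
  proof (cases "arccos ?a + arccos ?b \<le> pi")
    case True
    have "arccos ?c \<le> arccos (cos (arccos ?a + arccos ?b))"
      using le b by (intro arccos_le_arccos) auto
    also have "\<dots> = arccos ?a + arccos ?b"
      using True b by (intro arccos_cos) (auto intro!: add_nonneg_nonneg arccos_lbound)
    finally show ?thesis .
  next
    case False
    moreover have "arccos ?c \<le> pi" using b by (intro arccos_ubound) auto
    ultimately show ?thesis by linarith
  qed
qed

lemma cone_angle_triangle:
  assumes "p \<noteq> 0" "q \<noteq> 0" "r \<noteq> 0"
  shows "cone_angle p r \<le> cone_angle p q + cone_angle q r"
  unfolding cone_angle_def using assms by (intro arccos_triangle) (auto simp: norm_sgn)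

text \<open>Law of cosines: the side opposite the angle \<open>x\<close> in a plane triangle whose
  other sides are \<open>r\<close> and \<open>s\<close>.\<close>

definition planar :: "real \<Rightarrow> real \<Rightarrow> real \<Rightarrow> real" where
  "planar r s x = sqrt (r\<^sup>2 + s\<^sup>2 - 2 * r * s * cos x)"

lemma planar_cmod: "planar r s x = cmod (of_real r - of_real s * cis x)"
proof -
  have "(r - s * cos x)\<^sup>2 + (s * sin x)\<^sup>2 = r\<^sup>2 + s\<^sup>2 * ((sin x)\<^sup>2 + (cos x)\<^sup>2) - 2 * r * s * cos x"
    by algebra
  then show ?thesis by (simp add: planar_def cmod_def)
qed

text \<open>Triangle inequality for the complex numbers with polar coordinates
  \<open>(r, 0)\<close>, \<open>(s, x)\<close> and \<open>(t, x + y)\<close>; rotation by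
  \<open>cis x\<close> places the second triangle next to the first.\<close>

lemma planar_triangle: "planar r t (x + y) \<le> planar r s x + planar s t y"
proof -
  have "planar s t y = cmod (cis x * (of_real s - of_real t * cis y))"
    by (simp add: planar_cmod norm_mult)
  also have "cis x * (of_real s - of_real t * cis y) = of_real s * cis x - of_real t * cis (x + y)"
    by (simp add: cis_mult[symmetric] algebra_simps)
  finally show ?thesis
    using norm_triangle_ineq[of "of_real r - of_real s * cis x" "of_real s * cis x - of_real t * cis (x + y)"]
    by (simp add: planar_cmod)
qed

lemma planar_mono: "0 \<le> r \<Longrightarrow> 0 \<le> s \<Longrightarrow> 0 \<le> x \<Longrightarrow> x \<le> y \<Longrightarrow> y \<le> pi \<Longrightarrow> planar r s x \<le> planar r s y"
  unfolding planar_def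
  by (intro real_sqrt_le_mono diff_left_mono mult_left_mono) (auto intro: cos_monotone_0_pi_le)

lemma planar_pi: "0 \<le> r \<Longrightarrow> 0 \<le> s \<Longrightarrow> planar r s pi = r + s"
proof -
  have "r\<^sup>2 + s\<^sup>2 - 2 * r * s * cos pi = (r + s)\<^sup>2" by (simp add: power2_eq_square algebra_simps)
  then show "0 \<le> r \<Longrightarrow> 0 \<le> s \<Longrightarrow> planar r s pi = r + s" unfolding planar_def by simp
qed

lemma cone_dist_planar: "cone_dist l p q = planar (norm p) (norm q) (min (l * cone_angle p q) pi)"
  by (simp add: cone_dist_def planar_def)

text \<open>The two cone triangles are developed side by side into the plane. If their angles add up
  to less than \<open>pi\<close>, the planar inequality applies with the larger enclosed angle
  \<open>\<alpha> + \<beta>\<close>.\<close>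

lemma cone_dist_triangle:
  assumes l: "l > 0"
  shows "cone_dist l p r \<le> cone_dist l p q + cone_dist l q r"
proof (cases "p = 0 \<or> q = 0 \<or> r = 0")
  case True
  then show ?thesis
    using cone_dist_le_sum[of l p r] cone_dist_ge[of q r l] cone_dist_ge[of p q l] by auto
next
  case False
  define \<alpha> \<beta> \<gamma> where "\<alpha> = min (l * cone_angle p q) pi" "\<beta> = min (l * cone_angle q r) pi" "\<gamma> = min (l * cone_angle p r) pi"
  have pos: "0 \<le> \<alpha>" "0 \<le> \<beta>" "0 \<le> \<gamma>" "\<alpha> \<le> pi" "\<beta> \<le> pi" "\<gamma> \<le> pi"
    using l by (auto simp: \<alpha>_\<beta>_\<gamma>_def)
  have ang: "l * cone_angle p r \<le> l * cone_angle p q + l * cone_angle q r"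
    using cone_angle_triangle[of p q r] False l by (simp add: distrib_left[symmetric])
  show ?thesis
  proof (cases "\<alpha> + \<beta> < pi")
    case True
    then have "\<alpha> = l * cone_angle p q" "\<beta> = l * cone_angle q r" using pos by (auto simp: \<alpha>_\<beta>_\<gamma>_def min_def split: if_splits)
    then have "\<gamma> \<le> \<alpha> + \<beta>" using ang by (auto simp: \<alpha>_\<beta>_\<gamma>_def)
    then have "cone_dist l p r \<le> planar (norm p) (norm r) (\<alpha> + \<beta>)"
      unfolding cone_dist_planar \<alpha>_\<beta>_\<gamma>_def(3)[symmetric] using pos True by (intro planar_mono) auto
    also have "\<dots> \<le> cone_dist l p q + cone_dist l q r"
      unfolding cone_dist_planar \<alpha>_\<beta>_\<gamma>_def[symmetric] by (rule planar_triangle)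
    finally show ?thesis .
  next
    case False
    \<comment> \<open>The second angle is reduced to \<open>pi - \<alpha>\<close>, which places the
      outer points on opposite sides of the origin: their planar distance is the sum of the radii,
      the largest possible cone distance.\<close>
    have "cone_dist l p r \<le> planar (norm p) (norm r) (\<alpha> + (pi - \<alpha>))"
      using cone_dist_le_sum[of l p r] by (simp add: planar_pi)
    also have "\<dots> \<le> planar (norm p) (norm q) \<alpha> + planar (norm q) (norm r) (pi - \<alpha>)"
      by (rule planar_triangle)
    also have "planar (norm q) (norm r) (pi - \<alpha>) \<le> planar (norm q) (norm r) \<beta>"
      using pos False by (intro planar_mono) auto
    finally show ?thesis unfolding cone_dist_planar \<alpha>_\<beta>_\<gamma>_def[symmetric] by simp
  qed
qed

section \<open>Comparison with the Euclidean distance\<close>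

lemma sin_ge_half:
  assumes "0 \<le> x" "x \<le> pi / 2" shows "x / 2 \<le> sin x"
\<comment> \<open>Up to \<open>pi / 3\<close> the derivative of the sine is at least 1/2. Beyond,
  the sine is at least half the root of 3, about 0.87, while \<open>x / 2\<close> is at most
  \<open>pi / 4\<close>, about 0.79.\<close>
proof (cases "x \<le> pi / 3")
  case True
  show ?thesis
  proof (cases "x = 0")
    case False
    with assms have "0 < x" by simp
    from MVT2[OF this, of sin cos] obtain z where z: "0 < z" "z < x" "sin x - sin 0 = (x - 0) * cos z"
      by (auto intro: DERIV_sin)
    have "cos (pi / 3) \<le> cos z" using z True assms by (intro cos_monotone_0_pi_le) auto
    then have "x * (1 / 2) \<le> x * cos z" using assms by (intro mult_left_mono) (auto simp: cos_60)
    then show ?thesis using z by simp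
  qed simp
next
  case False
  have "sin (pi / 3) \<le> sin x" using False assms by (intro sin_monotone_2pi_le) auto
  moreover have "sqrt 3 \<ge> 1.7" by (rule real_le_rsqrt) (simp add: power2_eq_square)
  moreover have "pi \<le> 3.2" using pi_approx by simp
  ultimately show ?thesis using assms by (simp add: sin_60)
qed

lemma one_minus_cos: "1 - cos x = 2 * (sin (x / 2))\<^sup>2" for x :: real
  using cos_double_sin[of "x / 2"] by simp

lemma one_minus_cos_bounds:
  assumes "0 \<le> x" "x \<le> pi"
  shows "x\<^sup>2 / 8 \<le> 1 - cos x" "1 - cos x \<le> x\<^sup>2 / 2"
proof -
  have s: "x / 4 \<le> sin (x / 2)" "sin (x / 2) \<le> x / 2"
    using sin_ge_half[of "x / 2"] assms sin_x_le_x[of "x / 2"] by auto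
  have "(x / 4)\<^sup>2 \<le> (sin (x / 2))\<^sup>2" "(sin (x / 2))\<^sup>2 \<le> (x / 2)\<^sup>2"
    using s assms by (intro power_mono; simp)+
  then show "x\<^sup>2 / 8 \<le> 1 - cos x" "1 - cos x \<le> x\<^sup>2 / 2"
    unfolding one_minus_cos by (simp_all add: power_divide)
qed

text \<open>The Euclidean distance has the same shape as \<open>cone_dist_sq'\<close>, with the
  unscaled angle. Comparing the two distances thus reduces to comparing two values of one minus
  cosine.\<close>

lemma norm_diff_sq_cone_angle:
  "(norm (p - q))\<^sup>2 = (norm p - norm q)\<^sup>2 + 2 * norm p * norm q * (1 - cos (cone_angle p q))"
proof -
  have "norm p * norm q * (sgn p \<bullet> sgn q) = p \<bullet> q"
    by (cases "p = 0"; cases "q = 0") (simp_all add: sgn_div_norm divide_simps)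
  moreover have "(norm (p - q))\<^sup>2 = (norm p)\<^sup>2 + (norm q)\<^sup>2 - 2 * (p \<bullet> q)"
    by (simp add: power2_norm_eq_inner inner_diff_left inner_diff_right inner_commute)
  ultimately show ?thesis by (simp add: cos_cone_angle power2_eq_square algebra_simps)
qed

lemma cone_dist_sq':
  "(cone_dist l p q)\<^sup>2 = (norm p - norm q)\<^sup>2 + 2 * norm p * norm q * (1 - cos (min (l * cone_angle p q) pi))"
  unfolding cone_dist_sq by (simp add: power2_eq_square algebra_simps)

text \<open>In the constant, 1 takes care of the radial part and \<open>2 * l\<close> of the angular
  part: the bounds \<open>x\<^sup>2 / 2\<close> above and \<open>x\<^sup>2 / 8\<close> below for one
  minus cosine lose a factor 4, whose root is 2.\<close>

lemma cone_dist_le_norm: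
  assumes l: "l > 0"
  shows "cone_dist l p q \<le> (1 + 2 * l) * norm (p - q)"
proof -
  let ?A = "cone_angle p q" and ?m = "min (l * cone_angle p q) pi"
  have "1 - cos ?m \<le> ?m\<^sup>2 / 2" using l by (intro one_minus_cos_bounds) auto
  also have "\<dots> \<le> (l * ?A)\<^sup>2 / 2" using l by (intro divide_right_mono power_mono) auto
  also have "\<dots> = 4 * l\<^sup>2 * (?A\<^sup>2 / 8)" by (simp add: power_mult_distrib)
  also have "\<dots> \<le> 4 * l\<^sup>2 * (1 - cos ?A)" by (intro mult_left_mono one_minus_cos_bounds) auto
  also have "\<dots> \<le> (1 + 2 * l)\<^sup>2 * (1 - cos ?A)"
    using l by (intro mult_right_mono) (auto simp: power2_eq_square algebra_simps)
  finally have *: "1 - cos ?m \<le> (1 + 2 * l)\<^sup>2 * (1 - cos ?A)" .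
  have "1 \<le> (1 + 2 * l)\<^sup>2" using l by simp
  then have "1 * (norm p - norm q)\<^sup>2 \<le> (1 + 2 * l)\<^sup>2 * (norm p - norm q)\<^sup>2"
    by (intro mult_right_mono) auto
  moreover have "2 * norm p * norm q * (1 - cos ?m) \<le> 2 * norm p * norm q * ((1 + 2 * l)\<^sup>2 * (1 - cos ?A))"
    by (intro mult_left_mono *) auto
  ultimately have "(cone_dist l p q)\<^sup>2 \<le> ((1 + 2 * l) * norm (p - q))\<^sup>2"
    unfolding cone_dist_sq' power_mult_distrib norm_diff_sq_cone_angle by (simp add: algebra_simps)
  then show ?thesis by (rule power2_le_imp_le) (use l in auto)
qed

text \<open>Because angles are at most \<open>pi\<close>, the cut-off scaled angle is at least
  \<open>min l 1\<close> times the angle. The factor 1/2 is the root of the ratio 1/4 between the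
  bounds for one minus cosine.\<close>

lemma norm_le_cone_dist:
  assumes l: "l > 0"
  shows "min l 1 / 2 * norm (p - q) \<le> cone_dist l p q"
proof -
  let ?A = "cone_angle p q" and ?m = "min (l * cone_angle p q) pi" and ?c = "min l 1"
  have "?c * ?A \<le> ?m"
  proof -
    have "?c * ?A \<le> l * ?A" "?c * ?A \<le> 1 * ?A" using l by (intro mult_right_mono; simp)+
    then show ?thesis using cone_angle_bounds(2)[of p q] by linarith
  qed
  then have "(?c * ?A)\<^sup>2 / 8 \<le> ?m\<^sup>2 / 8" using l by (intro divide_right_mono power_mono) auto
  also have "\<dots> \<le> 1 - cos ?m" using l by (intro one_minus_cos_bounds) auto
  finally have "?c\<^sup>2 / 4 * (?A\<^sup>2 / 2) \<le> 1 - cos ?m" by (simp add: power_mult_distrib)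
  moreover have "?c\<^sup>2 / 4 * (1 - cos ?A) \<le> ?c\<^sup>2 / 4 * (?A\<^sup>2 / 2)"
    by (intro mult_left_mono one_minus_cos_bounds) auto
  moreover have "(?c / 2)\<^sup>2 * (1 - cos ?A) = ?c\<^sup>2 / 4 * (1 - cos ?A)" by (simp add: power_divide)
  ultimately have *: "(?c / 2)\<^sup>2 * (1 - cos ?A) \<le> 1 - cos ?m" by linarith
  have "(?c / 2)\<^sup>2 \<le> 1" using l by (intro power_le_one) auto
  then have "(?c / 2)\<^sup>2 * (norm p - norm q)\<^sup>2 \<le> 1 * (norm p - norm q)\<^sup>2"
    by (intro mult_right_mono) auto
  moreover have "2 * norm p * norm q * ((?c / 2)\<^sup>2 * (1 - cos ?A)) \<le> 2 * norm p * norm q * (1 - cos ?m)"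
    by (intro mult_left_mono *) auto
  moreover have "2 * norm p * norm q * ((?c / 2)\<^sup>2 * (1 - cos ?A)) = (?c / 2)\<^sup>2 * (2 * norm p * norm q * (1 - cos ?A))"
    by (simp only: mult_ac)
  ultimately have "(?c / 2 * norm (p - q))\<^sup>2 \<le> (cone_dist l p q)\<^sup>2"
    unfolding cone_dist_sq' power_mult_distrib[of "?c / 2"] norm_diff_sq_cone_angle distrib_left by linarith
  then show ?thesis by (rule power2_le_imp_le) simp
qed

lemma cone_dist_eq_0:
  assumes "l > 0" shows "cone_dist l p q = 0 \<longleftrightarrow> p = q"
proof
  assume "cone_dist l p q = 0"
  then have "min l 1 / 2 * norm (p - q) \<le> 0" using norm_le_cone_dist[OF assms, of p q] by simp
  moreover have "min l 1 / 2 > 0" using assms by simp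
  ultimately have "norm (p - q) \<le> 0" by (simp add: mult_le_0_iff del: norm_le_zero_iff)
  then show "p = q" by simp
next
  assume "p = q"
  then show "cone_dist l p q = 0"
    using cone_dist_le_norm[OF assms, of p q] by (intro order.antisym) auto
qed

section \<open>The infinitesimal form of the cone distance\<close>

lemma cone_metric_nonneg: "0 \<le> cone_metric l q v"
proof -
  have "(v \<bullet> sgn q)\<^sup>2 \<le> (norm v * norm (sgn q))\<^sup>2"
    using Cauchy_Schwarz_ineq2[of v "sgn q"] by (intro power2_le_iff_abs_le[THEN iffD2]) auto
  also have "\<dots> \<le> (norm v)\<^sup>2" by (simp add: norm_sgn)
  finally show ?thesis by (auto simp: cone_metric_def)
qed

lemma cone_metric_le: "cone_metric l q v \<le> (l\<^sup>2 + 1) * (norm v)\<^sup>2"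
proof -
  have "(v \<bullet> sgn q)\<^sup>2 \<le> (norm v * norm (sgn q))\<^sup>2"
    using Cauchy_Schwarz_ineq2[of v "sgn q"] by (intro power2_le_iff_abs_le[THEN iffD2]) auto
  also have "\<dots> \<le> (norm v)\<^sup>2" by (simp add: norm_sgn)
  finally have *: "(v \<bullet> sgn q)\<^sup>2 \<le> (norm v)\<^sup>2" .
  have "l\<^sup>2 * ((norm v)\<^sup>2 - (v \<bullet> sgn q)\<^sup>2) \<le> l\<^sup>2 * (norm v)\<^sup>2" by (intro mult_left_mono) auto
  with * show ?thesis
    using cone_metric_def[of l q v] by (cases "q = 0") (auto simp: distrib_right intro: add_mono)
qed

text \<open>Directions have no limit at the apex, so continuity there needs \<open>v = 0\<close>;
  then the bound by \<open>norm v\<close> squared forces the limit 0.\<close>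

lemma tendsto_cone_metric:
  fixes f g :: "'b \<Rightarrow> 'a::real_inner"
  assumes "(f \<longlongrightarrow> q) F" "(g \<longlongrightarrow> v) F" "q = 0 \<longrightarrow> v = 0"
  shows "((\<lambda>x. cone_metric l (f x) (g x)) \<longlongrightarrow> cone_metric l q v) F"
proof (cases "q = 0")
  case True
  with assms have "v = 0" "(g \<longlongrightarrow> 0) F" by auto
  from tendsto_mult[OF tendsto_const[of "l\<^sup>2 + 1"] tendsto_power[OF tendsto_norm[OF this(2)], of 2]]
  have lim: "((\<lambda>x. (l\<^sup>2 + 1) * (norm (g x))\<^sup>2) \<longlongrightarrow> 0) F" by simp
  have "\<forall>\<^sub>F x in F. norm (cone_metric l (f x) (g x)) \<le> (l\<^sup>2 + 1) * (norm (g x))\<^sup>2"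
    by (rule always_eventually) (simp add: cone_metric_nonneg cone_metric_le)
  from Lim_null_comparison[OF this lim] have "((\<lambda>x. cone_metric l (f x) (g x)) \<longlongrightarrow> 0) F" .
  with True show ?thesis by (simp add: cone_metric_def)
next
  case False
  have "\<forall>\<^sub>F x in F. f x \<noteq> 0" using assms(1) False by (rule tendsto_imp_eventually_ne)
  then have "\<forall>\<^sub>F x in F. l\<^sup>2 * ((norm (g x))\<^sup>2 - (g x \<bullet> sgn (f x))\<^sup>2) + (g x \<bullet> sgn (f x))\<^sup>2 = cone_metric l (f x) (g x)"
    by eventually_elim (simp add: cone_metric_def)
  moreover have "((\<lambda>x. l\<^sup>2 * ((norm (g x))\<^sup>2 - (g x \<bullet> sgn (f x))\<^sup>2) + (g x \<bullet> sgn (f x))\<^sup>2) \<longlongrightarrow>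
     l\<^sup>2 * ((norm v)\<^sup>2 - (v \<bullet> sgn q)\<^sup>2) + (v \<bullet> sgn q)\<^sup>2) F"
    using assms False by (intro tendsto_intros)
  ultimately show ?thesis using False by (simp add: cone_metric_def Lim_transform_eventually)
qed

text \<open>Half-angle formulas turn the quotient into \<open>l\<^sup>2\<close> times a quotient of
  two squared factors of the form sine over argument. The value at 0 fills the removable
  singularity, so that the limit may be composed with an angle that vanishes along the way.\<close>

lemma one_minus_cos_ratio:
  fixes l :: real
  assumes l: "l > 0"
  defines "h \<equiv> \<lambda>x. if x = 0 then l\<^sup>2 else (1 - cos (min (l * x) pi)) / (1 - cos x)"
  shows "(h \<longlongrightarrow> l\<^sup>2) (nhds 0)"
proof -
  have sinc: "((\<lambda>y::real. sin y / y) \<longlongrightarrow> 1) (at 0)"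
    using DERIV_sin[of 0] by (simp add: DERIV_def)
  have fl: "filterlim (\<lambda>x::real. c * x) (at 0) (at 0)" if "c \<noteq> 0" for c :: real
    unfolding filterlim_at using that
    by (auto simp: eventually_at_filter intro!: tendsto_eq_intros)
  have "((\<lambda>x. l\<^sup>2 * ((sin (l / 2 * x) / (l / 2 * x))\<^sup>2 / (sin (1 / 2 * x) / (1 / 2 * x))\<^sup>2)) \<longlongrightarrow> l\<^sup>2 * (1\<^sup>2 / 1\<^sup>2)) (at 0)"
    using l by (intro tendsto_intros filterlim_compose[OF sinc fl]) auto
  moreover have "\<forall>\<^sub>F x in at 0. l\<^sup>2 * ((sin (l / 2 * x) / (l / 2 * x))\<^sup>2 / (sin (1 / 2 * x) / (1 / 2 * x))\<^sup>2) = h x"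
  proof -
    \<comment> \<open>Near 0 the cut-off is inactive.\<close>
    have "\<forall>\<^sub>F x in at 0. l * x < pi"
      by (rule order_tendstoD(2)[where y = 0]) (auto intro!: tendsto_eq_intros)
    moreover have "\<forall>\<^sub>F x::real in at 0. x \<noteq> 0" by (simp add: eventually_at_filter)
    ultimately show ?thesis
    proof eventually_elim
      case (elim x)
      then have "h x = (sin (l * x / 2))\<^sup>2 / (sin (x / 2))\<^sup>2"
        by (simp add: h_def one_minus_cos)
      then show ?case using elim l by (simp add: power_divide power_mult_distrib divide_simps)
    qed
  qed
  ultimately have "(h \<longlongrightarrow> l\<^sup>2) (at 0)" by (simp add: Lim_transform_eventually)
  moreover have "h 0 = l\<^sup>2" by (simp add: h_def)
  ultimately show ?thesis by (metis tendsto_at_iff_tendsto_nhds)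
qed

lemma has_vector_derivative_quotient_tendsto:
  assumes "(f has_vector_derivative v) (at t within S)"
  shows "((\<lambda>s. (f s - f t) /\<^sub>R (s - t)) \<longlongrightarrow> v) (at t within S)"
proof -
  have "((\<lambda>s. norm ((f s - f t) - (s - t) *\<^sub>R v) / norm (s - t)) \<longlongrightarrow> 0) (at t within S)"
    using assms unfolding has_vector_derivative_def has_derivative_iff_norm by simp
  moreover have "\<forall>\<^sub>F s in at t within S.
      norm ((f s - f t) - (s - t) *\<^sub>R v) / norm (s - t) = norm ((f s - f t) /\<^sub>R (s - t) - v)"
    unfolding eventually_at_filter
  proof (rule always_eventually, intro allI impI)
    fix s assume "s \<noteq> t"
    then have "(f s - f t) /\<^sub>R (s - t) - v = ((f s - f t) - (s - t) *\<^sub>R v) /\<^sub>R (s - t)"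
      by (simp add: scaleR_diff_right)
    then show "norm ((f s - f t) - (s - t) *\<^sub>R v) / norm (s - t) = norm ((f s - f t) /\<^sub>R (s - t) - v)"
      by (simp add: divide_inverse mult.commute)
  qed
  ultimately have "((\<lambda>s. norm ((f s - f t) /\<^sub>R (s - t) - v)) \<longlongrightarrow> 0) (at t within S)"
    by (rule Lim_transform_eventually)
  then show ?thesis by (simp add: tendsto_norm_zero_iff LIM_zero_iff)
qed

lemma norm_divR_sq: "(norm (x /\<^sub>R c))\<^sup>2 = (norm x)\<^sup>2 / c\<^sup>2"
  by (simp add: power_mult_distrib divide_inverse power_inverse mult.commute)

text \<open>The squared distance splits into a radial part, differentiated through
  \<open>norm\<close>, and an angular part, differentiated through \<open>sgn\<close>. At the apex
  neither works, but there the distance is the norm and the assumption gives velocity 0.\<close>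

lemma cone_dist_metric_derivative:
  fixes q :: "real \<Rightarrow> 'a::euclidean_space"
  assumes l: "l > 0" and q: "(q has_vector_derivative v) (at t within S)" and ne: "q t = 0 \<longrightarrow> v = 0"
  shows "((\<lambda>s. (cone_dist l (q t) (q s))\<^sup>2 / (s - t)\<^sup>2) \<longlongrightarrow> cone_metric l (q t) v) (at t within S)"
proof -
  note Q = has_vector_derivative_quotient_tendsto[OF q]
  show ?thesis
  proof (cases "q t = 0")
    case True
    have "((\<lambda>s. (norm ((q s - q t) /\<^sub>R (s - t)))\<^sup>2) \<longlongrightarrow> (norm v)\<^sup>2) (at t within S)"
      by (intro tendsto_intros Q)
    then show ?thesis using True ne by (simp add: cone_metric_def power_mult_distrib divide_simps power_divide)
  next
    case False
    have cont: "(q \<longlongrightarrow> q t) (at t within S)"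
      using has_vector_derivative_continuous[OF q] by (simp add: continuous_within)
    let ?n = "norm (q t)" and ?n' = "v \<bullet> sgn (q t)"
    have N: "((\<lambda>s. norm (q s)) has_vector_derivative ?n') (at t within S)"
      using has_derivative_compose[OF q[unfolded has_vector_derivative_def] has_derivative_norm[OF False]]
      by (simp add: has_vector_derivative_def)
    define \<sigma>' where "\<sigma>' = v /\<^sub>R ?n - (?n' / ?n\<^sup>2) *\<^sub>R q t"
    have "((\<lambda>s. inverse (norm (q s))) has_real_derivative - (?n' / ?n\<^sup>2)) (at t within S)"
      using DERIV_inverse_fun[OF N[folded has_real_derivative_iff_has_vector_derivative]] False
      by (simp add: power2_eq_square divide_inverse)
    from has_vector_derivative_scaleR[OF this q]
    have S: "((\<lambda>s. sgn (q s)) has_vector_derivative \<sigma>') (at t within S)"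
      by (simp add: sgn_div_norm \<sigma>'_def)
    \<comment> \<open>\<open>?n *\<^sub>R \<sigma>'\<close> is the part of \<open>v\<close>
      orthogonal to \<open>q t\<close>, so this is Pythagoras.\<close>
    have sig: "?n\<^sup>2 * (norm \<sigma>')\<^sup>2 = (norm v)\<^sup>2 - ?n'\<^sup>2"
    proof -
      have "?n *\<^sub>R \<sigma>' = v - ?n' *\<^sub>R sgn (q t)"
        using False by (simp add: \<sigma>'_def scaleR_diff_right sgn_div_norm power2_eq_square divide_inverse)
      moreover have "sgn (q t) \<bullet> sgn (q t) = 1" using False by (simp add: dot_square_norm norm_sgn)
      ultimately have "(norm (?n *\<^sub>R \<sigma>'))\<^sup>2 = (norm v)\<^sup>2 - ?n'\<^sup>2"
        by (simp add: power2_norm_eq_inner inner_diff_left inner_diff_right inner_commute)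
          (simp add: power2_eq_square)
      then show ?thesis by (simp add: power_mult_distrib)
    qed
    \<comment> \<open>The factor \<open>h\<close> trades the scaled angle for the plain one, whose
      one minus cosine is half the squared chord between the directions. It tends to
      \<open>l\<^sup>2\<close> as the angle shrinks.\<close>
    define h where "h = (\<lambda>x. if x = 0 then l\<^sup>2 else (1 - cos (min (l * x) pi)) / (1 - cos x))"
    define A where "A = (\<lambda>s. cone_angle (q t) (q s))"
    have "((\<lambda>s. A s) \<longlongrightarrow> arccos (sgn (q t) \<bullet> sgn (q t))) (at t within S)"
    proof -
      have "((\<lambda>s. sgn (q t) \<bullet> sgn (q s)) \<longlongrightarrow> sgn (q t) \<bullet> sgn (q t)) (at t within S)"
        using cont False by (intro tendsto_intros)
      then show ?thesis unfolding A_def cone_angle_def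
        by (rule continuous_on_tendsto_compose[OF continuous_on_arccos'])
          (use inner_sgn_bounds in \<open>auto intro!: always_eventually\<close>)
    qed
    then have "(A \<longlongrightarrow> 0) (at t within S)" using False by (simp add: dot_square_norm norm_sgn)
    then have hA: "((\<lambda>s. h (A s)) \<longlongrightarrow> l\<^sup>2) (at t within S)"
      unfolding h_def by (rule filterlim_compose[OF one_minus_cos_ratio[OF l]])
    have cosA: "1 - cos (A s) = (norm (sgn (q s) - sgn (q t)))\<^sup>2 / 2" if "q s \<noteq> 0" for s
    proof -
      have "sgn (q t) \<bullet> sgn (q t) = 1" "sgn (q s) \<bullet> sgn (q s) = 1"
        using that False by (simp_all add: dot_square_norm norm_sgn)
      then show ?thesis
        by (simp add: A_def cos_cone_angle power2_norm_eq_inner inner_diff_left inner_diff_right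
            inner_commute[of "sgn (q s)" "sgn (q t)"])
    qed
    have hcos: "1 - cos (min (l * A s) pi) = h (A s) * (1 - cos (A s))" for s
    proof -
      have "cos (A s) \<noteq> 1" if "A s \<noteq> 0"
        using that cos_inj_pi[of "A s" 0] cone_angle_bounds[of "q t" "q s"] by (auto simp: A_def)
      then show ?thesis by (auto simp: h_def)
    qed
    have "((\<lambda>s. (norm ((norm (q s) - norm (q t)) /\<^sub>R (s - t)))\<^sup>2 +
        norm (q t) * norm (q s) * h (A s) * (norm ((sgn (q s) - sgn (q t)) /\<^sub>R (s - t)))\<^sup>2) \<longlongrightarrow>
        (norm ?n')\<^sup>2 + ?n * ?n * l\<^sup>2 * (norm \<sigma>')\<^sup>2) (at t within S)"
      by (intro tendsto_intros has_vector_derivative_quotient_tendsto N S hA cont)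
    also have "(norm ?n')\<^sup>2 + ?n * ?n * l\<^sup>2 * (norm \<sigma>')\<^sup>2 = cone_metric l (q t) v"
      using sig False by (simp add: cone_metric_def power2_eq_square mult_ac)
    finally have lim: "((\<lambda>s. (norm ((norm (q s) - norm (q t)) /\<^sub>R (s - t)))\<^sup>2 +
        norm (q t) * norm (q s) * h (A s) * (norm ((sgn (q s) - sgn (q t)) /\<^sub>R (s - t)))\<^sup>2) \<longlongrightarrow>
        cone_metric l (q t) v) (at t within S)" .
    have "\<forall>\<^sub>F s in at t within S. q s \<noteq> 0" using cont False by (rule tendsto_imp_eventually_ne)
    then have "\<forall>\<^sub>F s in at t within S. (norm ((norm (q s) - norm (q t)) /\<^sub>R (s - t)))\<^sup>2 +
        norm (q t) * norm (q s) * h (A s) * (norm ((sgn (q s) - sgn (q t)) /\<^sub>R (s - t)))\<^sup>2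
        = (cone_dist l (q t) (q s))\<^sup>2 / (s - t)\<^sup>2"
    proof eventually_elim
      case (elim s)
      have "(cone_dist l (q t) (q s))\<^sup>2 = (norm (q s) - norm (q t))\<^sup>2 +
          norm (q t) * norm (q s) * h (A s) * (norm (sgn (q s) - sgn (q t)))\<^sup>2"
      proof -
        have "1 - cos (min (l * cone_angle (q t) (q s)) pi) = h (A s) * ((norm (sgn (q s) - sgn (q t)))\<^sup>2 / 2)"
          using hcos[of s] unfolding cosA[OF elim] by (simp add: A_def)
        then show ?thesis unfolding cone_dist_sq' by (simp add: power2_commute)
      qed
      then show ?case unfolding norm_divR_sq by (simp add: add_divide_distrib)
    qed
    with lim show ?thesis by (rule Lim_transform_eventually)
  qed
qed

text \<open>The cone over a sector of angle less than \<open>pi\<close> is isometric to a planar sector, so geodesics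
  are read off from straight segments in polar coordinates.\<close>

text \<open>A unit vector orthogonal to \<open>p\<close> in the plane of \<open>p\<close> and \<open>q\<close>; if these are collinear, an arbitrary but
  measurable choice with the help of two basis vectors.\<close>

definition cone_normal :: "'a::euclidean_space \<Rightarrow> 'a \<Rightarrow> 'a \<Rightarrow> 'a \<Rightarrow> 'a" where
  "cone_normal b1 b2 p q =
    (let e = sgn q - (sgn q \<bullet> sgn p) *\<^sub>R sgn p in
     if e \<noteq> 0 then sgn e else if p \<bullet> b1 = 0 \<and> p \<bullet> b2 = 0 then b1
     else sgn ((p \<bullet> b1) *\<^sub>R b2 - (p \<bullet> b2) *\<^sub>R b1))"

text \<open>\<open>sgn p\<close> and the normal form an orthonormal frame in which the direction of
  \<open>q\<close> has angle \<open>cone_angle p q\<close>. The rejection \<open>?e\<close> has the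
  sine of that angle as its norm.\<close>

lemma cone_normal:
  assumes b: "b1 \<in> Basis" "b2 \<in> Basis" "b1 \<noteq> b2" and "p \<noteq> 0" "q \<noteq> 0"
  shows "norm (cone_normal b1 b2 p q) = 1" "sgn p \<bullet> cone_normal b1 b2 p q = 0"
    "sgn q = cos (cone_angle p q) *\<^sub>R sgn p + sin (cone_angle p q) *\<^sub>R cone_normal b1 b2 p q"
proof -
  let ?e = "sgn q - (sgn q \<bullet> sgn p) *\<^sub>R sgn p" and ?f = "(p \<bullet> b1) *\<^sub>R b2 - (p \<bullet> b2) *\<^sub>R b1"
  have u: "sgn p \<bullet> sgn p = 1" "sgn q \<bullet> sgn q = 1" using assms by (simp_all add: dot_square_norm norm_sgn)
  have bb: "b1 \<bullet> b1 = 1" "b2 \<bullet> b2 = 1" "b1 \<bullet> b2 = 0" "b2 \<bullet> b1 = 0" using b by (auto simp: inner_Basis)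
  have f0: "?f \<noteq> 0" if "\<not> (p \<bullet> b1 = 0 \<and> p \<bullet> b2 = 0)"
  proof
    assume "?f = 0"
    then have "?f \<bullet> b1 = 0" "?f \<bullet> b2 = 0" by simp_all
    then show False using that by (simp add: inner_diff_left bb)
  qed
  show "norm (cone_normal b1 b2 p q) = 1"
    unfolding cone_normal_def Let_def using f0 b by (auto simp: norm_sgn)
  have pe: "sgn p \<bullet> ?e = 0" by (simp add: inner_diff_right u inner_commute)
  have pf: "p \<bullet> ?f = 0" by (simp add: inner_diff_right)
  show "sgn p \<bullet> cone_normal b1 b2 p q = 0"
  proof (cases "?e = 0")
    case True
    then have "cone_normal b1 b2 p q = (if p \<bullet> b1 = 0 \<and> p \<bullet> b2 = 0 then b1 else sgn ?f)"
      unfolding cone_normal_def Let_def by simp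
    then show ?thesis using pf by (simp add: sgn_div_norm)
  next
    case False
    then have "cone_normal b1 b2 p q = ?e /\<^sub>R norm ?e" by (simp add: cone_normal_def Let_def sgn_div_norm)
    then show ?thesis using pe by simp
  qed
  have "(norm ?e)\<^sup>2 = 1 - (sgn q \<bullet> sgn p)\<^sup>2"
    unfolding power2_norm_eq_inner
    by (simp add: inner_diff_left inner_diff_right u inner_commute[of "sgn p" "sgn q"] power2_eq_square)
  also have "\<dots> = (sin (cone_angle p q))\<^sup>2"
    using cos_cone_angle[of p q] by (simp add: sin_squared_eq inner_commute)
  finally have "norm ?e = sin (cone_angle p q)"
    using sin_ge_zero[of "cone_angle p q"] by (simp add: power2_eq_iff_nonneg)
  \<comment> \<open>For collinear directions the sine vanishes, so the arbitrary choice of normal is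
    multiplied by 0.\<close>
  then have "sin (cone_angle p q) *\<^sub>R cone_normal b1 b2 p q = ?e"
  proof (cases "?e = 0")
    case True
    then have "sin (cone_angle p q) = 0" using \<open>norm ?e = sin (cone_angle p q)\<close> by (simp only: norm_zero)
    then show ?thesis unfolding True by simp
  next
    case False
    then have "cone_normal b1 b2 p q = sgn ?e" unfolding cone_normal_def Let_def by simp
    then show ?thesis
      unfolding \<open>norm ?e = sin (cone_angle p q)\<close>[symmetric] by (simp only: norm_scaleR_sgn)
  qed
  then show "sgn q = cos (cone_angle p q) *\<^sub>R sgn p + sin (cone_angle p q) *\<^sub>R cone_normal b1 b2 p q"
    by (simp add: cos_cone_angle inner_commute)
qed

text \<open>In the first branch \<open>(x, y)\<close> runs along the segment between the developed
  points, \<open>p\<close> lying on the positive axis, and dividing the polar angle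
  \<open>\<phi>\<close> by \<open>l\<close> undoes the scaling. In the second branch the path runs
  through the apex: \<open>x\<close> falls from \<open>norm p\<close> to \<open>- norm q\<close>,
  and its sign selects the ray.\<close>

definition cone_geodesic :: "'a::euclidean_space \<Rightarrow> 'a \<Rightarrow> real \<Rightarrow> 'a \<Rightarrow> 'a \<Rightarrow> real \<Rightarrow> 'a" where
  "cone_geodesic b1 b2 l p q t =
    (if p \<noteq> 0 \<and> q \<noteq> 0 \<and> l * cone_angle p q < pi then
       let x = (1 - t) * norm p + t * norm q * cos (l * cone_angle p q);
           y = t * norm q * sin (l * cone_angle p q);
           r = sqrt (x\<^sup>2 + y\<^sup>2); \<phi> = arccos (x / r)
       in r *\<^sub>R (cos (\<phi> / l) *\<^sub>R sgn p + sin (\<phi> / l) *\<^sub>R cone_normal b1 b2 p q)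
     else
       let x = (1 - t) * norm p - t * norm q in max 0 x *\<^sub>R sgn p + max 0 (- x) *\<^sub>R sgn q)"

lemma arccos_cos_le_abs: "arccos (cos x) \<le> \<bar>x\<bar>" for x :: real
proof (cases "\<bar>x\<bar> \<le> pi")
  case True
  then show ?thesis by (simp add: arccos_cos_eq_abs)
next
  case False
  moreover have "arccos (cos x) \<le> pi" by (intro arccos_ubound) auto
  ultimately show ?thesis by linarith
qed

text \<open>With \<open>y\<close> nonnegative the polar angle lies in the range of
  \<open>arccos\<close>. For \<open>r = 0\<close> the quotient has the default value 0, which is
  harmless because \<open>x\<close> and \<open>y\<close> vanish as well.\<close>

lemma polar_coordinates:
  fixes x y :: real
  assumes "y \<ge> 0"
  defines "r \<equiv> sqrt (x\<^sup>2 + y\<^sup>2)"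
  shows "r * cos (arccos (x / r)) = x" "r * sin (arccos (x / r)) = y"
    "0 \<le> arccos (x / r)" "arccos (x / r) \<le> pi"
proof -
  have "\<bar>x\<bar> \<le> r" unfolding r_def by (rule real_sqrt_ge_abs1)
  then have b: "\<bar>x / r\<bar> \<le> 1" by (cases "r = 0") (auto simp: divide_simps)
  then show "0 \<le> arccos (x / r)" "arccos (x / r) \<le> pi"
    using abs_le_D1[OF b] abs_le_D2[OF b] by (auto intro!: arccos_lbound arccos_ubound)
  have r2: "r\<^sup>2 = x\<^sup>2 + y\<^sup>2" by (simp add: r_def)
  show "r * cos (arccos (x / r)) = x"
    using b r2 by (cases "r = 0") (auto simp: cos_arccos_abs)
  show "r * sin (arccos (x / r)) = y"
  proof (cases "r = 0")
    case True
    then show ?thesis using r2 by simp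
  next
    case False
    moreover have "r \<ge> 0" by (simp add: r_def)
    ultimately have r: "r > 0" by simp
    have "sin (arccos (x / r)) = sqrt (1 - (x / r)\<^sup>2)" using b by (rule sin_arccos_abs)
    also have "1 - (x / r)\<^sup>2 = (r\<^sup>2 - x\<^sup>2) / r\<^sup>2"
      using r by (simp add: diff_divide_distrib power_divide)
    also have "\<dots> = (y / r)\<^sup>2" using r2 by (simp add: power_divide)
    finally show ?thesis using r assms by simp
  qed
qed

text \<open>Only an inequality is claimed: the angle \<open>\<phi> / l\<close> in the ambient space
  may wrap around, which can only shorten the distance. So no bound on the single angles has to be
  checked.\<close>

lemma cone_dist_le_polar:
  fixes P n :: "'a::real_inner"
  assumes l: "l > 0" and u: "norm P = 1" "norm n = 1" "P \<bullet> n = 0" and r: "r1 \<ge> 0" "r2 \<ge> 0"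
    and \<phi>: "\<bar>\<phi>1 - \<phi>2\<bar> \<le> pi"
  shows "(cone_dist l (r1 *\<^sub>R (cos (\<phi>1 / l) *\<^sub>R P + sin (\<phi>1 / l) *\<^sub>R n)) (r2 *\<^sub>R (cos (\<phi>2 / l) *\<^sub>R P + sin (\<phi>2 / l) *\<^sub>R n)))\<^sup>2
    \<le> r1\<^sup>2 + r2\<^sup>2 - 2 * r1 * r2 * cos (\<phi>1 - \<phi>2)"
proof -
  define e where "e = (\<lambda>\<psi>. cos \<psi> *\<^sub>R P + sin \<psi> *\<^sub>R n)"
  have e: "e \<psi> = cos \<psi> *\<^sub>R P + sin \<psi> *\<^sub>R n" for \<psi> by (simp add: e_def)
  have uu: "P \<bullet> P = 1" "n \<bullet> n = 1" "n \<bullet> P = 0"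
    using u by (simp_all add: dot_square_norm inner_commute)
  have ee: "e \<psi> \<bullet> e \<omega> = cos (\<psi> - \<omega>)" for \<psi> \<omega>
    by (simp add: e_def inner_add_left inner_add_right uu u cos_diff)
  have ne: "norm (e \<psi>) = 1" for \<psi> by (simp add: norm_eq_sqrt_inner ee)
  have sgn: "sgn (r *\<^sub>R e \<psi>) = e \<psi>" if "r > 0" for r \<psi>
    using that by (simp add: sgn_div_norm ne)
  have cs: "r1 * r2 * cos (\<phi>1 - \<phi>2) \<le>
      r1 * r2 * cos (min (l * cone_angle (r1 *\<^sub>R e (\<phi>1 / l)) (r2 *\<^sub>R e (\<phi>2 / l))) pi)"
  proof (cases "r1 = 0 \<or> r2 = 0")
    case False
    then have "cone_angle (r1 *\<^sub>R e (\<phi>1 / l)) (r2 *\<^sub>R e (\<phi>2 / l)) = arccos (cos (\<phi>1 / l - \<phi>2 / l))"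
      using r by (simp add: cone_angle_def sgn ee)
    also have "\<dots> \<le> \<bar>\<phi>1 / l - \<phi>2 / l\<bar>" by (rule arccos_cos_le_abs)
    also have "\<dots> = \<bar>\<phi>1 - \<phi>2\<bar> / l" using l by (simp add: diff_divide_distrib[symmetric])
    finally have "l * cone_angle (r1 *\<^sub>R e (\<phi>1 / l)) (r2 *\<^sub>R e (\<phi>2 / l)) \<le> \<bar>\<phi>1 - \<phi>2\<bar>"
      using l by (simp add: pos_le_divide_eq mult.commute)
    then have "cos \<bar>\<phi>1 - \<phi>2\<bar> \<le> cos (min (l * cone_angle (r1 *\<^sub>R e (\<phi>1 / l)) (r2 *\<^sub>R e (\<phi>2 / l))) pi)"
      using l \<phi> by (intro cos_monotone_0_pi_le) auto
    then show ?thesis using r by (intro mult_left_mono) auto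
  qed auto
  then show ?thesis
    unfolding e[symmetric] cone_dist_sq using r by (simp add: ne)
qed

lemma cone_geodesic_0: "l > 0 \<Longrightarrow> cone_geodesic b1 b2 l p q 0 = p"
  by (auto simp: cone_geodesic_def Let_def norm_scaleR_sgn)

lemma cone_geodesic_1:
  assumes l: "l > 0" and b: "b1 \<in> Basis" "b2 \<in> Basis" "b1 \<noteq> b2"
  shows "cone_geodesic b1 b2 l p q 1 = q"
proof (cases "p \<noteq> 0 \<and> q \<noteq> 0 \<and> l * cone_angle p q < pi")
  case True
  let ?A = "cone_angle p q" and ?n = "norm q"
  have A: "0 \<le> l * ?A" "l * ?A \<le> pi" using l True by auto
  have "sqrt ((?n * cos (l * ?A))\<^sup>2 + (?n * sin (l * ?A))\<^sup>2) = ?n"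
    by (simp add: power_mult_distrib distrib_left[symmetric])
  moreover have "arccos (?n * cos (l * ?A) / ?n) = l * ?A" using True A by (simp add: arccos_cos)
  ultimately have "cone_geodesic b1 b2 l p q 1 = ?n *\<^sub>R (cos ?A *\<^sub>R sgn p + sin ?A *\<^sub>R cone_normal b1 b2 p q)"
    using True l by (simp add: cone_geodesic_def Let_def)
  also have "\<dots> = ?n *\<^sub>R sgn q" using cone_normal(3)[OF b, of p q] True by simp
  finally show ?thesis by (simp add: norm_scaleR_sgn)
next
  case False
  then show ?thesis by (auto simp: cone_geodesic_def Let_def norm_scaleR_sgn)
qed

text \<open>Constant speed. In the first case the development carries it over from a straight
  segment; in the second, the signed coordinate \<open>x\<close> measures length along the two
  rays.\<close>

lemma cone_dist_cone_geodesic: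
  assumes l: "l > 0" and b: "b1 \<in> Basis" "b2 \<in> Basis" "b1 \<noteq> b2" and st: "s \<in> {0..1}" "t \<in> {0..1}"
  shows "cone_dist l (cone_geodesic b1 b2 l p q s) (cone_geodesic b1 b2 l p q t) \<le> \<bar>s - t\<bar> * cone_dist l p q"
proof (cases "p \<noteq> 0 \<and> q \<noteq> 0 \<and> l * cone_angle p q < pi")
  case True
  let ?A = "l * cone_angle p q"
  define x where "x = (\<lambda>t. (1 - t) * norm p + t * norm q * cos ?A)"
  define y where "y = (\<lambda>t. t * norm q * sin ?A)"
  define r where "r = (\<lambda>t. sqrt ((x t)\<^sup>2 + (y t)\<^sup>2))"
  define \<phi> where "\<phi> = (\<lambda>t. arccos (x t / r t))"
  have A: "0 \<le> ?A" "?A \<le> pi" using l True by auto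
  have "y t \<ge> 0" if "t \<in> {0..1}" for t
    using that A unfolding y_def by (intro mult_nonneg_nonneg sin_ge_zero) (use l in auto)
  have P: "r t * cos (\<phi> t) = x t" "r t * sin (\<phi> t) = y t" "0 \<le> \<phi> t" "\<phi> t \<le> pi" if "t \<in> {0..1}" for t
    using polar_coordinates[of "y t" "x t"] \<open>\<And>t. t \<in> {0..1} \<Longrightarrow> y t \<ge> 0\<close>[OF that]
    unfolding r_def \<phi>_def by auto
  have eq: "cone_geodesic b1 b2 l p q t = r t *\<^sub>R (cos (\<phi> t / l) *\<^sub>R sgn p + sin (\<phi> t / l) *\<^sub>R cone_normal b1 b2 p q)" for t
    using True by (simp add: cone_geodesic_def Let_def x_def y_def r_def \<phi>_def)
  have "(cone_dist l (cone_geodesic b1 b2 l p q s) (cone_geodesic b1 b2 l p q t))\<^sup>2 \<le> (r s)\<^sup>2 + (r t)\<^sup>2 - 2 * r s * r t * cos (\<phi> s - \<phi> t)"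
    unfolding eq using True cone_normal(1,2)[OF b, of p q] P[OF st(1)] P[OF st(2)]
    by (intro cone_dist_le_polar l) (auto simp: norm_sgn r_def)
  also have "\<dots> = (x s - x t)\<^sup>2 + (y s - y t)\<^sup>2"
  proof -
    have "r s * r t * cos (\<phi> s - \<phi> t) = (r s * cos (\<phi> s)) * (r t * cos (\<phi> t)) + (r s * sin (\<phi> s)) * (r t * sin (\<phi> t))"
      by (simp add: cos_diff algebra_simps)
    also have "\<dots> = x s * x t + y s * y t" using P st by simp
    finally have *: "2 * r s * r t * cos (\<phi> s - \<phi> t) = 2 * (x s * x t + y s * y t)" by simp
    have "(r s)\<^sup>2 = (x s)\<^sup>2 + (y s)\<^sup>2" "(r t)\<^sup>2 = (x t)\<^sup>2 + (y t)\<^sup>2" by (simp_all add: r_def)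
    then show ?thesis unfolding * by (simp add: power2_eq_square algebra_simps)
  qed
  also have "\<dots> = (s - t)\<^sup>2 * ((norm p)\<^sup>2 + (norm q)\<^sup>2 * ((sin ?A)\<^sup>2 + (cos ?A)\<^sup>2) - 2 * norm p * norm q * cos ?A)"
    unfolding x_def y_def by (simp only: power2_eq_square) algebra
  also have "\<dots> = (\<bar>s - t\<bar> * cone_dist l p q)\<^sup>2"
    unfolding power_mult_distrib cone_dist_sq using True by simp
  finally show ?thesis by (rule power2_le_imp_le) simp
next
  case False
  define x where "x = (\<lambda>t. (1 - t) * norm p - t * norm q)"
  have eq: "cone_geodesic b1 b2 l p q t = max 0 (x t) *\<^sub>R sgn p + max 0 (- x t) *\<^sub>R sgn q" for t
    unfolding cone_geodesic_def if_not_P[OF False] Let_def x_def ..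
  \<comment> \<open>Outside the first branch either an end point is the apex or the cut-off is
    active; both make the distance the sum of the radii.\<close>
  have dpq: "cone_dist l p q = norm p + norm q"
  proof (cases "p = 0 \<or> q = 0")
    case False
    with \<open>\<not> (p \<noteq> 0 \<and> q \<noteq> 0 \<and> l * cone_angle p q < pi)\<close> have "min (l * cone_angle p q) pi = pi" by auto
    then show ?thesis unfolding cone_dist_planar by (simp add: planar_pi)
  qed auto
  have xd: "x s - x t = - (s - t) * (norm p + norm q)" for s t by (simp add: x_def algebra_simps)
  have same: "cone_dist l (c *\<^sub>R sgn p) (d *\<^sub>R sgn p) \<le> \<bar>c - d\<bar>" if "c \<ge> 0" "d \<ge> 0" for c d and p :: 'a
  proof -
    have "(cone_dist l (c *\<^sub>R sgn p) (d *\<^sub>R sgn p))\<^sup>2 \<le> (norm (c *\<^sub>R sgn p) - norm (d *\<^sub>R sgn p))\<^sup>2"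
    proof (cases "c = 0 \<or> d = 0 \<or> p = 0")
      case False
      then have "sgn (c *\<^sub>R sgn p) \<bullet> sgn (d *\<^sub>R sgn p) = 1"
        using that by (simp add: sgn_scaleR dot_square_norm norm_sgn sgn_zero_iff)
      then have "cone_angle (c *\<^sub>R sgn p) (d *\<^sub>R sgn p) = 0" by (simp add: cone_angle_def)
      then show ?thesis unfolding cone_dist_sq' by simp
    qed auto
    then have "cone_dist l (c *\<^sub>R sgn p) (d *\<^sub>R sgn p) \<le> \<bar>norm (c *\<^sub>R sgn p) - norm (d *\<^sub>R sgn p)\<bar>"
      unfolding power2_abs[of "norm (c *\<^sub>R sgn p) - _", symmetric] by (rule power2_le_imp_le) simp
    also have "\<dots> \<le> \<bar>c - d\<bar>" using that by (auto simp: norm_sgn)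
    finally show ?thesis .
  qed
  have opp: "cone_dist l (c *\<^sub>R sgn p) (d *\<^sub>R sgn q) \<le> c + d" if "c \<ge> 0" "d \<ge> 0" for c d and p q :: 'a
  proof -
    have "cone_dist l (c *\<^sub>R sgn p) (d *\<^sub>R sgn q) \<le> norm (c *\<^sub>R sgn p) + norm (d *\<^sub>R sgn q)" by (rule cone_dist_le_sum)
    also have "\<dots> \<le> c + d" using that by (auto simp: norm_sgn)
    finally show ?thesis .
  qed
  have "cone_dist l (cone_geodesic b1 b2 l p q s) (cone_geodesic b1 b2 l p q t) \<le> \<bar>x s - x t\<bar>"
    unfolding eq
    using same[of "x s" "x t" p] same[of "- x s" "- x t" q] opp[of "x s" "- x t" p q] opp[of "- x s" "x t" q p]
    by (cases "x s \<ge> 0"; cases "x t \<ge> 0") (auto simp: max_def)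
  also have "\<dots> = \<bar>s - t\<bar> * cone_dist l p q" unfolding xd dpq by (simp add: abs_mult abs_minus_commute)
  finally show ?thesis .
qed

text \<open>Continuous functions converging almost everywhere are first retracted radially to the
  ball of radius \<open>B\<close>, which does not move the limit. Weierstrass approximation up to
  the inverse of \<open>Suc n\<close> then raises the bound by at most 1.\<close>

lemma polynomial_approx_AE:
  fixes f :: "'a::euclidean_space \<Rightarrow> 'b::euclidean_space"
  assumes S: "compact S" and f: "f \<in> borel_measurable (lebesgue_on S)"
    and B: "B > 0" "\<And>x. x \<in> S \<Longrightarrow> norm (f x) \<le> B"
  obtains p N where "negligible N" "\<And>n::nat. polynomial_function (p n)"
    "\<And>n x. x \<in> S \<Longrightarrow> norm (p n x) \<le> B + 1" "\<And>x. x \<in> S - N \<Longrightarrow> (\<lambda>n. p n x) \<longlonglongrightarrow> f x"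
proof -
  have "f measurable_on S"
    using f lmeasurable_compact[OF S] by (subst measurable_on_iff_borel_measurable) (auto simp: fmeasurable_def)
  then obtain N g where N: "negligible N" and g: "\<And>n. continuous_on UNIV (g n)"
    "\<And>x. x \<notin> N \<Longrightarrow> (\<lambda>n. g n x) \<longlonglongrightarrow> (if x \<in> S then f x else 0)"
    unfolding measurable_on_def by blast
  define h where "h = (\<lambda>n x. (B / max B (norm (g n x))) *\<^sub>R g n x)"
  have hB: "norm (h n x) \<le> B" for n x
    using B(1) by (simp add: h_def max_def divide_simps mult_left_mono)
  have "\<exists>p. polynomial_function p \<and> (\<forall>x\<in>S. norm (h n x - p x) < inverse (real (Suc n)))" for n
  proof (rule Stone_Weierstrass_polynomial_function[OF S])
    have "max B (norm (g n x)) \<noteq> 0" for x using B(1) by (auto simp: max_def)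
    then show "continuous_on S (h n)"
      unfolding h_def by (intro continuous_intros continuous_on_subset[OF g(1)]) auto
  qed simp
  then obtain p where p: "\<And>n. polynomial_function (p n)"
    "\<And>n x. x \<in> S \<Longrightarrow> norm (h n x - p n x) < inverse (real (Suc n))" by metis
  show ?thesis
  proof (rule that[OF N p(1)])
    fix n x assume x: "x \<in> S"
    have "norm (p n x) \<le> norm (h n x) + norm (p n x - h n x)" by (rule norm_triangle_sub)
    also have "norm (p n x - h n x) \<le> 1"
      using p(2)[OF x, of n] inverse_le_1_iff[of "real (Suc n)"] by (simp add: norm_minus_commute)
    finally show "norm (p n x) \<le> B + 1" using hB[of n x] by linarith
  next
    fix x assume x: "x \<in> S - N"
    then have gx: "(\<lambda>n. g n x) \<longlonglongrightarrow> f x" using g(2)[of x] by simp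
    have "max B (norm (f x)) = B" using B(2)[of x] x by (auto simp: max_def)
    moreover have "(\<lambda>n. h n x) \<longlonglongrightarrow> (B / max B (norm (f x))) *\<^sub>R f x"
      unfolding h_def using B(1) by (intro tendsto_intros gx) (auto simp: max_def)
    ultimately have "(\<lambda>n. h n x) \<longlonglongrightarrow> f x" using B(1) by simp
    moreover have "(\<lambda>n. h n x - p n x) \<longlonglongrightarrow> 0"
      using p(2) x by (intro Lim_null_comparison[OF _ LIMSEQ_inverse_real_of_nat])
        (auto intro!: always_eventually less_imp_le)
    ultimately have "(\<lambda>n. h n x - (h n x - p n x)) \<longlonglongrightarrow> f x - 0" by (rule tendsto_diff)
    then show "(\<lambda>n. p n x) \<longlonglongrightarrow> f x" by simp
  qed
qed

section \<open>Lebesgue measure on the unit interval\<close>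

abbreviation U01 :: "real measure" where "U01 \<equiv> lebesgue_on {0..1}"

lemma finite_U01: "finite_measure U01"
proof
  show "emeasure U01 (space U01) \<noteq> \<infinity>" by (simp add: emeasure_restrict_space)
qed

interpretation U01: finite_measure U01 by (rule finite_U01)

lemma measure_U01 [simp]: "measure U01 {0..1} = 1"
  by (simp add: measure_restrict_space)

lemma measurable_U01_id [measurable]: "(\<lambda>x. x) \<in> measurable U01 borel"
  by (intro measurable_restrict_space1 measurable_completion) simp

lemma measurable_U01_borel: "f \<in> measurable borel N \<Longrightarrow> f \<in> measurable U01 N"
  using measurable_compose[OF measurable_U01_id] by simp

lemma LINT_U01: "(LINT u:{0..1}|lebesgue. f u) = (\<integral>u. f u \<partial>U01)"
  for f :: "real \<Rightarrow> 'a::{banach, second_countable_topology}"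
  by (simp add: set_lebesgue_integral_def integral_restrict_space)

lemma integrable_U01_iff: "integrable U01 f \<longleftrightarrow> f absolutely_integrable_on {0..1}"
  for f :: "real \<Rightarrow> 'a::{banach, second_countable_topology}"
  by (simp add: set_integrable_def integrable_restrict_space)

lemma integral_U01: "integrable U01 f \<Longrightarrow> (\<integral>u. f u \<partial>U01) = integral {0..1} f"
  for f :: "real \<Rightarrow> 'a::euclidean_space"
  by (simp add: lebesgue_integral_eq_integral)

lemma AE_U01_negligible:
  assumes "negligible N" "\<And>x. x \<in> {0..1} \<Longrightarrow> x \<notin> N \<Longrightarrow> P x"
  shows "AE x in U01. P x"
proof -
  have "AE x in lebesgue. x \<notin> N"
    using assms(1) by (intro AE_not_in) (simp add: negligible_iff_null_sets)
  then show ?thesis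
    using assms(2) by (subst AE_restrict_space_iff) (auto elim!: eventually_mono)
qed

lemma AE_U01_Ioo: "AE x in U01. x \<in> {0<..<1}"
  by (rule AE_U01_negligible[of "{0, 1}"]) auto

lemma borel_continuous_U01:
  fixes f :: "real \<Rightarrow> 'a::{topological_space, second_countable_topology}"
  assumes "continuous_on {0..1} f"
  shows "f \<in> borel_measurable U01"
proof -
  have "(\<lambda>x. f (clamp01 x)) \<in> borel_measurable U01"
    by (intro measurable_U01_borel borel_measurable_continuous_onI continuous_on_compose2[OF assms])
      (auto intro!: continuous_intros)
  then show ?thesis by (rule measurable_cong[THEN iffD1, rotated]) auto
qed

lemma integrable_U01_bounded:
  fixes f :: "real \<Rightarrow> 'a::{banach, second_countable_topology}"
  assumes "f \<in> borel_measurable U01" "\<And>x. x \<in> {0..1} \<Longrightarrow> norm (f x) \<le> B"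
  shows "integrable U01 f"
  using assms by (intro U01.integrable_const_bound[of f B]) (auto intro!: AE_I2)

lemma continuous_on_U01_bounded:
  fixes f :: "real \<Rightarrow> 'a::real_normed_vector"
  assumes "continuous_on {0..1} f"
  obtains B where "\<And>x. x \<in> {0..1} \<Longrightarrow> norm (f x) \<le> B"
  using compact_imp_bounded[OF compact_continuous_image[OF assms]] by (force simp: bounded_iff)

section \<open>Square integrable maps\<close>

text \<open>Functions instead of classes modulo null sets: curves arise by integration, so null sets
  disappear only when passing to curves.\<close>

definition square_integrable :: "(real \<Rightarrow> 'a::euclidean_space) \<Rightarrow> bool" where
  "square_integrable f \<longleftrightarrow> f \<in> borel_measurable U01 \<and> integrable U01 (\<lambda>u. (norm (f u))\<^sup>2)"

definition L2_norm :: "(real \<Rightarrow> 'a::euclidean_space) \<Rightarrow> real" where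
  "L2_norm f = sqrt (\<integral>u. (norm (f u))\<^sup>2 \<partial>U01)"

lemma square_integrable_measurable [dest]: "square_integrable f \<Longrightarrow> f \<in> borel_measurable U01"
  and square_integrable_integrable: "square_integrable f \<Longrightarrow> integrable U01 (\<lambda>u. (norm (f u))\<^sup>2)"
  by (auto simp: square_integrable_def)

lemma L2_norm_nonneg [simp]: "0 \<le> L2_norm f" by (simp add: L2_norm_def)

lemma L2_norm_sq: "(L2_norm f)\<^sup>2 = (\<integral>u. (norm (f u))\<^sup>2 \<partial>U01)" by (simp add: L2_norm_def)

lemma square_integrable_dominated:
  assumes "f \<in> borel_measurable U01" "square_integrable g"
    and "\<And>u. u \<in> {0..1} \<Longrightarrow> norm (f u) \<le> C * norm (g u)"
  shows "square_integrable f"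
proof -
  have "integrable U01 (\<lambda>u. (norm (f u))\<^sup>2)"
  proof (rule Bochner_Integration.integrable_bound)
    show "integrable U01 (\<lambda>u. C\<^sup>2 * (norm (g u))\<^sup>2)" using square_integrable_integrable[OF assms(2)] by simp
    show "(\<lambda>u. (norm (f u))\<^sup>2) \<in> borel_measurable U01" using assms(1) by measurable
    show "AE u in U01. norm ((norm (f u))\<^sup>2) \<le> norm (C\<^sup>2 * (norm (g u))\<^sup>2)"
      using assms(3) by (auto intro!: AE_I2 power_mono simp: power_mult_distrib[symmetric])
  qed
  with assms(1) show ?thesis by (simp add: square_integrable_def)
qed

lemma square_integrable_add:
  assumes f: "square_integrable f" and g: "square_integrable g" shows "square_integrable (\<lambda>u. f u + g u)"
proof -
  have [measurable]: "f \<in> borel_measurable U01" "g \<in> borel_measurable U01" using f g by auto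
  have "integrable U01 (\<lambda>u. (norm (f u + g u))\<^sup>2)"
  proof (rule Bochner_Integration.integrable_bound)
    show "integrable U01 (\<lambda>u. 2 * (norm (f u))\<^sup>2 + 2 * (norm (g u))\<^sup>2)"
      using square_integrable_integrable[OF f] square_integrable_integrable[OF g] by simp
    have "(norm (f u + g u))\<^sup>2 \<le> 2 * (norm (f u))\<^sup>2 + 2 * (norm (g u))\<^sup>2" for u
    proof -
      have "(norm (f u + g u))\<^sup>2 \<le> (norm (f u) + norm (g u))\<^sup>2" by (intro power_mono norm_triangle_ineq) auto
      also have "\<dots> \<le> 2 * (norm (f u))\<^sup>2 + 2 * (norm (g u))\<^sup>2"
        using zero_le_power2[of "norm (f u) - norm (g u)"] by (simp add: power2_eq_square algebra_simps)
      finally show ?thesis .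
    qed
    then show "AE u in U01. norm ((norm (f u + g u))\<^sup>2) \<le> norm (2 * (norm (f u))\<^sup>2 + 2 * (norm (g u))\<^sup>2)"
      by (auto intro!: AE_I2)
  qed measurable
  then show ?thesis by (simp add: square_integrable_def)
qed

lemma square_integrable_minus: "square_integrable f \<Longrightarrow> square_integrable (\<lambda>u. - f u)"
  by (rule square_integrable_dominated[of _ f 1]) (auto intro!: borel_measurable_uminus)

lemma square_integrable_diff: "square_integrable f \<Longrightarrow> square_integrable g \<Longrightarrow> square_integrable (\<lambda>u. f u - g u)"
  using square_integrable_add[OF _ square_integrable_minus, of f g] by simp

lemma square_integrable_norm: "square_integrable f \<Longrightarrow> square_integrable (\<lambda>u. norm (f u))"
  by (rule square_integrable_dominated[of _ f 1]) (auto intro!: borel_measurable_norm)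

lemma square_integrable_bounded:
  assumes "f \<in> borel_measurable U01" "\<And>u. u \<in> {0..1} \<Longrightarrow> norm (f u) \<le> B"
  shows "square_integrable f"
  unfolding square_integrable_def
proof
  show "integrable U01 (\<lambda>u. (norm (f u))\<^sup>2)"
    using assms by (intro integrable_U01_bounded[of _ "B\<^sup>2"]) (auto intro!: power_mono)
qed (rule assms)

lemma square_integrable_continuous:
  fixes f :: "real \<Rightarrow> 'a::euclidean_space"
  assumes "continuous_on {0..1} f" shows "square_integrable f"
  using continuous_on_U01_bounded[OF assms] square_integrable_bounded[OF borel_continuous_U01[OF assms]] by blast

lemma square_integrable_mult:
  fixes f g :: "real \<Rightarrow> real"
  assumes f: "square_integrable f" and g: "square_integrable g" shows "integrable U01 (\<lambda>u. f u * g u)"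
proof (rule Bochner_Integration.integrable_bound)
  have [measurable]: "f \<in> borel_measurable U01" "g \<in> borel_measurable U01" using f g by auto
  show "integrable U01 (\<lambda>u. (norm (f u))\<^sup>2 + (norm (g u))\<^sup>2)"
    using square_integrable_integrable[OF f] square_integrable_integrable[OF g] by simp
  show "(\<lambda>u. f u * g u) \<in> borel_measurable U01" by measurable
  have "norm (f u * g u) \<le> norm ((norm (f u))\<^sup>2 + (norm (g u))\<^sup>2)" for u
  proof -
    have "0 \<le> (\<bar>f u\<bar> - \<bar>g u\<bar>)\<^sup>2" by simp
    then have "2 * \<bar>f u * g u\<bar> \<le> (f u)\<^sup>2 + (g u)\<^sup>2"
      unfolding power2_diff by (simp add: abs_mult)
    then show ?thesis by simp
  qed
  then show "AE u in U01. norm (f u * g u) \<le> norm ((norm (f u))\<^sup>2 + (norm (g u))\<^sup>2)" by (rule AE_I2)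
qed

lemma square_integrable_integrable_norm: "square_integrable f \<Longrightarrow> integrable U01 (\<lambda>u. norm (f u))"
  using square_integrable_mult[OF square_integrable_norm square_integrable_bounded[of "\<lambda>u. 1" 1]] by simp

lemma L2_norm_cauchy_schwarz:
  fixes f g :: "real \<Rightarrow> real"
  assumes f: "square_integrable f" and g: "square_integrable g"
  shows "(\<integral>u. f u * g u \<partial>U01) \<le> L2_norm f * L2_norm g"
proof -
  define A B I where "A = (\<integral>u. (f u)\<^sup>2 \<partial>U01)" "B = (\<integral>u. (g u)\<^sup>2 \<partial>U01)" "I = (\<integral>u. f u * g u \<partial>U01)"
  have int: "integrable U01 (\<lambda>u. (f u)\<^sup>2)" "integrable U01 (\<lambda>u. (g u)\<^sup>2)" "integrable U01 (\<lambda>u. f u * g u)"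
    using square_integrable_integrable[OF f] square_integrable_integrable[OF g] square_integrable_mult[OF f g] by auto
  have pos: "0 \<le> A" "0 \<le> B" by (simp_all add: A_B_I_def)
  have quad: "2 * x * I \<le> x\<^sup>2 * A + B" for x
  proof -
    have "0 \<le> (\<integral>u. (x * f u - g u)\<^sup>2 \<partial>U01)" by simp
    also have "\<dots> = (\<integral>u. x\<^sup>2 * (f u)\<^sup>2 - 2 * x * (f u * g u) + (g u)\<^sup>2 \<partial>U01)"
      by (intro Bochner_Integration.integral_cong) (auto simp: power2_eq_square algebra_simps)
    also have "\<dots> = x\<^sup>2 * A - 2 * x * I + B" using int by (simp add: A_B_I_def)
    finally show ?thesis by simp
  qed
  have "I\<^sup>2 \<le> A * B"
  proof (cases "A = 0")
    case True
    \<comment> \<open>For \<open>A = 0\<close> the inequality \<open>quad\<close> is linear in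
      \<open>x\<close>; the chosen \<open>x\<close> would give \<open>B + 1 \<le> B\<close>.\<close>
    have "I = 0"
    proof (rule ccontr)
      assume "I \<noteq> 0"
      with quad[of "(B + 1) / (2 * I)"] True pos show False by simp
    qed
    with pos show ?thesis by simp
  next
    case False
    then have "A > 0" using pos by simp
    then show ?thesis using quad[of "I / A"]
      by (simp add: power2_eq_square divide_simps split: if_splits) (simp add: mult.commute)
  qed
  then have "\<bar>I\<bar> \<le> sqrt (A * B)" by (metis real_sqrt_abs real_sqrt_le_iff)
  then have "I \<le> sqrt A * sqrt B" by (simp add: real_sqrt_mult)
  then show ?thesis by (simp add: L2_norm_def A_B_I_def)
qed

lemma L2_norm_mono:
  assumes "f \<in> borel_measurable U01" "square_integrable g" "\<And>u. u \<in> {0..1} \<Longrightarrow> norm (f u) \<le> norm (g u)"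
  shows "L2_norm f \<le> L2_norm g"
  unfolding L2_norm_def
  by (intro real_sqrt_le_mono integral_mono square_integrable_integrable assms square_integrable_dominated[OF assms(1,2), of 1] power_mono)
    (use assms in auto)

text \<open>Keeping the pointwise norms inside gives a form that serves both sums of maps and
  pointwise triangle inequalities of another distance.\<close>

lemma L2_norm_triangle:
  assumes f: "square_integrable f" and g: "square_integrable g"
  shows "L2_norm (\<lambda>u. norm (f u) + norm (g u)) \<le> L2_norm f + L2_norm g"
proof -
  let ?f = "\<lambda>u. norm (f u)" and ?g = "\<lambda>u. norm (g u)"
  note int = square_integrable_integrable[OF f] square_integrable_integrable[OF g] square_integrable_mult[OF square_integrable_norm[OF f] square_integrable_norm[OF g]]
  have eq: "L2_norm ?f = L2_norm f" "L2_norm ?g = L2_norm g" by (simp_all add: L2_norm_def)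
  have "(L2_norm (\<lambda>u. ?f u + ?g u))\<^sup>2 = (\<integral>u. (?f u)\<^sup>2 + 2 * (?f u * ?g u) + (?g u)\<^sup>2 \<partial>U01)"
    unfolding L2_norm_sq by (intro Bochner_Integration.integral_cong) (auto simp: power2_eq_square algebra_simps)
  also have "\<dots> = (L2_norm f)\<^sup>2 + 2 * (\<integral>u. ?f u * ?g u \<partial>U01) + (L2_norm g)\<^sup>2"
    using int by (simp add: L2_norm_sq)
  also have "\<dots> \<le> (L2_norm f + L2_norm g)\<^sup>2"
    using L2_norm_cauchy_schwarz[OF square_integrable_norm[OF f] square_integrable_norm[OF g]] unfolding eq
    by (simp add: power2_eq_square algebra_simps)
  finally show ?thesis by (rule power2_le_imp_le) simp
qed

lemma L2_norm_add:
  assumes f: "square_integrable f" and g: "square_integrable g"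
  shows "L2_norm (\<lambda>u. f u + g u) \<le> L2_norm f + L2_norm g"
proof -
  have "L2_norm (\<lambda>u. f u + g u) \<le> L2_norm (\<lambda>u. norm (f u) + norm (g u))"
    using f g by (intro L2_norm_mono square_integrable_add square_integrable_norm borel_measurable_add)
      (auto simp: norm_triangle_ineq abs_of_nonneg)
  also have "\<dots> \<le> L2_norm f + L2_norm g" by (rule L2_norm_triangle[OF f g])
  finally show ?thesis .
qed

lemma L2_norm_scale: "C \<ge> 0 \<Longrightarrow> L2_norm (\<lambda>u. C *\<^sub>R f u) = C * L2_norm f"
  by (simp add: L2_norm_def power_mult_distrib real_sqrt_mult)

lemma L2_norm_bounded:
  assumes "f \<in> borel_measurable U01" "\<And>u. u \<in> {0..1} \<Longrightarrow> norm (f u) \<le> B"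
  shows "L2_norm f \<le> B"
proof -
  have B: "0 \<le> B" using order_trans[OF norm_ge_zero assms(2)[of 0]] by simp
  have "(\<integral>u. (norm (f u))\<^sup>2 \<partial>U01) \<le> (\<integral>u. B\<^sup>2 \<partial>U01)"
    using assms by (intro integral_mono square_integrable_integrable square_integrable_bounded[of f B]) (auto intro!: power_mono)
  also have "\<dots> = B\<^sup>2" by simp
  finally show ?thesis unfolding L2_norm_def using B by (intro real_le_lsqrt) auto
qed

lemma L2_norm_tendsto_0:
  assumes "\<And>n. f n \<in> borel_measurable U01" "square_integrable g"
    and "\<And>n. AE u in U01. norm (f n u) \<le> norm (g u)" "AE u in U01. (\<lambda>n. f n u) \<longlonglongrightarrow> 0"
  shows "(\<lambda>n. L2_norm (f n)) \<longlonglongrightarrow> 0"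
proof -
  have "(\<lambda>n. \<integral>u. (norm (f n u))\<^sup>2 \<partial>U01) \<longlonglongrightarrow> (\<integral>u. 0 \<partial>U01)"
  proof (rule integral_dominated_convergence[where w = "\<lambda>u. (norm (g u))\<^sup>2"])
    show "AE u in U01. (\<lambda>n. (norm (f n u))\<^sup>2) \<longlonglongrightarrow> 0"
      using assms(4)
    proof eventually_elim
      case (elim u)
      from tendsto_power[OF tendsto_norm[OF elim], of 2] show ?case by simp
    qed
    show "AE u in U01. norm ((norm (f n u))\<^sup>2) \<le> (norm (g u))\<^sup>2" for n
      using assms(3)[of n] by eventually_elim (simp add: power_mono)
    show "(\<lambda>u. (norm (f n u))\<^sup>2) \<in> borel_measurable U01" for n using assms(1)[of n] by measurable
  qed (use square_integrable_integrable[OF assms(2)] in auto)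
  from tendsto_real_sqrt[OF this] show ?thesis by (simp add: L2_norm_def)
qed

text \<open>Riesz-Fischer: a subsequence with geometric increments converges almost everywhere
  because its increments are summable in the mean, and Fatou's lemma turns the pointwise limit into
  a limit in norm.\<close>

lemma L2_norm_complete:
  fixes q :: "nat \<Rightarrow> real \<Rightarrow> 'a::euclidean_space"
  assumes q: "\<And>n. square_integrable (q n)"
    and cauchy: "\<And>e. e > 0 \<Longrightarrow> \<exists>N. \<forall>m\<ge>N. \<forall>n\<ge>N. L2_norm (\<lambda>u. q m u - q n u) < e"
  obtains r where "square_integrable r" "(\<lambda>n. L2_norm (\<lambda>u. q n u - r u)) \<longlonglongrightarrow> 0"
proof -
  have [measurable]: "q n \<in> borel_measurable U01" for n using q by blast
  have "\<exists>N. \<forall>m\<ge>N. \<forall>n\<ge>N. L2_norm (\<lambda>u. q m u - q n u) < (1 / 2) ^ k" for k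
    by (rule cauchy) simp
  then obtain N where N: "\<And>k m n. m \<ge> N k \<Longrightarrow> n \<ge> N k \<Longrightarrow> L2_norm (\<lambda>u. q m u - q n u) < (1 / 2) ^ k"
    by metis
  \<comment> \<open>The sum puts both \<open>s k\<close> and \<open>s (Suc k)\<close> beyond
    \<open>N k\<close>; the added \<open>k\<close> drives the indices to infinity.\<close>
  define s where "s = (\<lambda>k::nat. (\<Sum>j\<le>k. N j) + k)"
  have sN: "s k \<ge> N k" "s (Suc k) \<ge> N k" "s k \<ge> k" for k
    using member_le_sum[of k "{..k}" N] by (auto simp: s_def)
  define d where "d = (\<lambda>k u. norm (q (s (Suc k)) u - q (s k) u))"
  have [measurable]: "d k \<in> borel_measurable U01" for k unfolding d_def by measurable
  have d: "(\<integral>\<^sup>+u. ennreal (d k u) \<partial>U01) \<le> ennreal ((1 / 2) ^ k)" for k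
  proof -
    have sq: "square_integrable (\<lambda>u. q (s (Suc k)) u - q (s k) u)" by (intro square_integrable_diff q)
    have one: "square_integrable (\<lambda>u. 1::real)" by (rule square_integrable_bounded[of _ 1]) auto
    have "(\<integral>u. d k u * 1 \<partial>U01) \<le> L2_norm (d k) * L2_norm (\<lambda>u. 1::real)"
      unfolding d_def by (rule L2_norm_cauchy_schwarz[OF square_integrable_norm[OF sq] one])
    also have "L2_norm (\<lambda>u. 1::real) = 1" by (simp add: L2_norm_def)
    also have "L2_norm (d k) = L2_norm (\<lambda>u. q (s (Suc k)) u - q (s k) u)" by (simp add: d_def L2_norm_def)
    also have "\<dots> < (1 / 2) ^ k" by (rule N[OF sN(2,1)])
    finally have "(\<integral>u. d k u \<partial>U01) \<le> (1 / 2) ^ k" by simp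
    moreover have "(\<integral>\<^sup>+u. ennreal (d k u) \<partial>U01) = ennreal (\<integral>u. d k u \<partial>U01)"
      using square_integrable_integrable_norm[OF sq] unfolding d_def by (intro nn_integral_eq_integral) auto
    ultimately show ?thesis by (simp add: ennreal_leI)
  qed
  have "(\<integral>\<^sup>+u. (\<Sum>k. ennreal (d k u)) \<partial>U01) = (\<Sum>k. \<integral>\<^sup>+u. ennreal (d k u) \<partial>U01)"
    by (rule nn_integral_suminf) measurable
  also have "\<dots> \<le> (\<Sum>k. ennreal ((1 / 2) ^ k))" by (intro suminf_le d) auto
  also have "\<dots> = ennreal (\<Sum>k. (1 / 2) ^ k)" by (intro suminf_ennreal2) auto
  finally have "(\<integral>\<^sup>+u. (\<Sum>k. ennreal (d k u)) \<partial>U01) \<noteq> \<infinity>" by (auto simp: top_unique)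
  then have "AE u in U01. (\<Sum>k. ennreal (d k u)) \<noteq> \<infinity>" by (intro nn_integral_PInf_AE) measurable
  then have conv: "AE u in U01. convergent (\<lambda>k. q (s k) u)"
  proof eventually_elim
    case (elim u)
    then have "summable (\<lambda>k. d k u)" by (intro summable_suminf_not_top) (auto simp: d_def)
    then have "summable (\<lambda>k. q (s (Suc k)) u - q (s k) u)"
      unfolding d_def by (rule summable_norm_cancel)
    then have "convergent (\<lambda>n. \<Sum>k<n. q (s (Suc k)) u - q (s k) u)" by (simp add: summable_iff_convergent)
    then have "convergent (\<lambda>n. q (s n) u - q (s 0) u)" using sum_lessThan_telescope[of "\<lambda>k. q (s k) u"] by simp
    then show ?case using convergent_diff_const_right_iff by blast
  qed
  define r where "r = (\<lambda>u. lim (\<lambda>k. q (s k) u))"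
  have [measurable]: "r \<in> borel_measurable U01" unfolding r_def by measurable
  have lim: "AE u in U01. (\<lambda>k. q (s k) u) \<longlonglongrightarrow> r u"
    using conv by eventually_elim (simp add: r_def convergent_LIMSEQ_iff)
  \<comment> \<open>Fatou along the subsequence, with the index \<open>n\<close> of the full
    sequence fixed, so that the whole sequence converges.\<close>
  have bound: "square_integrable (\<lambda>u. r u - q n u) \<and> L2_norm (\<lambda>u. r u - q n u) \<le> e"
    if "e > 0" and M: "\<forall>m\<ge>M. \<forall>n\<ge>M. L2_norm (\<lambda>u. q m u - q n u) < e" and n: "n \<ge> M" for e M n
  proof -
    have "(\<integral>\<^sup>+u. ennreal ((norm (r u - q n u))\<^sup>2) \<partial>U01) =
        (\<integral>\<^sup>+u. liminf (\<lambda>k. ennreal ((norm (q (s k) u - q n u))\<^sup>2)) \<partial>U01)"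
      using lim
    proof (intro nn_integral_cong_AE, eventually_elim)
      case (elim u)
      have "(\<lambda>k. ennreal ((norm (q (s k) u - q n u))\<^sup>2)) \<longlonglongrightarrow> ennreal ((norm (r u - q n u))\<^sup>2)"
        by (intro tendsto_ennrealI tendsto_power tendsto_norm tendsto_diff elim tendsto_const)
      from lim_imp_Liminf[OF _ this] show ?case by simp
    qed
    also have "\<dots> \<le> liminf (\<lambda>k. \<integral>\<^sup>+u. ennreal ((norm (q (s k) u - q n u))\<^sup>2) \<partial>U01)"
      by (rule nn_integral_liminf) measurable
    also have "\<dots> \<le> liminf (\<lambda>k::nat. ennreal (e\<^sup>2))"
    proof (rule Liminf_mono)
      show "\<forall>\<^sub>F k in sequentially. (\<integral>\<^sup>+u. ennreal ((norm (q (s k) u - q n u))\<^sup>2) \<partial>U01) \<le> ennreal (e\<^sup>2)"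
        using eventually_ge_at_top[of M]
      proof eventually_elim
        case (elim k)
        then have "s k \<ge> M" using sN(3)[of k] by simp
        then have "L2_norm (\<lambda>u. q (s k) u - q n u) \<le> e" using M n by (simp add: less_imp_le)
        then have "(L2_norm (\<lambda>u. q (s k) u - q n u))\<^sup>2 \<le> e\<^sup>2" by (intro power_mono) auto
        then have "(\<integral>u. (norm (q (s k) u - q n u))\<^sup>2 \<partial>U01) \<le> e\<^sup>2" by (simp add: L2_norm_sq)
        moreover have "(\<integral>\<^sup>+u. ennreal ((norm (q (s k) u - q n u))\<^sup>2) \<partial>U01) =
            ennreal (\<integral>u. (norm (q (s k) u - q n u))\<^sup>2 \<partial>U01)"
          by (intro nn_integral_eq_integral square_integrable_integrable square_integrable_diff q) auto
        ultimately show ?case by (simp add: ennreal_leI)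
      qed
    qed
    also have "\<dots> = ennreal (e\<^sup>2)" by (simp add: Liminf_const)
    finally have le: "(\<integral>\<^sup>+u. ennreal ((norm (r u - q n u))\<^sup>2) \<partial>U01) \<le> ennreal (e\<^sup>2)" .
    then have int: "integrable U01 (\<lambda>u. (norm (r u - q n u))\<^sup>2)"
      by (intro integrableI_bounded) (auto intro: le_less_trans)
    then have "(\<integral>u. (norm (r u - q n u))\<^sup>2 \<partial>U01) \<le> e\<^sup>2"
      using le nn_integral_eq_integral[OF int] by (simp add: ennreal_le_iff)
    then have "L2_norm (\<lambda>u. r u - q n u) \<le> e"
      unfolding L2_norm_def using \<open>e > 0\<close> by (intro real_le_lsqrt) auto
    with int show ?thesis by (simp add: square_integrable_def)
  qed
  obtain M where M: "\<forall>m\<ge>M. \<forall>n\<ge>M. L2_norm (\<lambda>u. q m u - q n u) < 1"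
    using cauchy[of 1] by auto
  have "square_integrable (\<lambda>u. (r u - q M u) + q M u)"
    using bound[OF _ M] by (intro square_integrable_add q) auto
  then have r: "square_integrable r" by simp
  have sym: "L2_norm (\<lambda>u. q n u - r u) = L2_norm (\<lambda>u. r u - q n u)" for n
    by (simp add: L2_norm_def norm_minus_commute)
  have "(\<lambda>n. L2_norm (\<lambda>u. q n u - r u)) \<longlonglongrightarrow> 0"
    unfolding sym
  proof (rule LIMSEQ_I)
    fix e :: real assume "e > 0"
    then obtain M where M: "\<forall>m\<ge>M. \<forall>n\<ge>M. L2_norm (\<lambda>u. q m u - q n u) < e / 2" using cauchy[of "e / 2"] by auto
    show "\<exists>M. \<forall>n\<ge>M. norm (L2_norm (\<lambda>u. r u - q n u) - 0) < e"
    proof (intro exI[of _ M] allI impI)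
      fix n assume "n \<ge> M"
      with bound[OF _ M, of n] \<open>e > 0\<close> have "L2_norm (\<lambda>u. r u - q n u) \<le> e / 2" by simp
      then show "norm (L2_norm (\<lambda>u. r u - q n u) - 0) < e" using \<open>e > 0\<close> by simp
    qed
  qed
  with r show ?thesis by (rule that)
qed

lemma exists_small_notin_negligible:
  fixes N :: "'a::euclidean_space set"
  assumes "negligible N" "e > 0"
  obtains v where "norm v < e" "v \<notin> N"
proof -
  have "\<not> ball 0 e \<subseteq> N"
    using negligible_subset[OF assms(1)] open_not_negligible[of "ball 0 e"] assms(2) by auto
  then have "\<exists>v. norm v < e \<and> v \<notin> N" by (auto simp: subset_eq)
  then show ?thesis using that by blast
qed

lemma smooth_on_differentiable: "smooth_on S f \<Longrightarrow> f differentiable_on S"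
  unfolding differentiable_on_def differentiable_def by (rule smooth_on_SucE) auto

text \<open>The error is spread over three steps: truncation at height \<open>n\<close>, polynomial
  approximation of the bounded map, and a shift by a vector missed by the negative of the
  approximating curve, whose image is null from dimension 2 on.\<close>

lemma smooth_dense:
  fixes q :: "real \<Rightarrow> 'a::euclidean_space"
  assumes dim: "DIM('a) \<ge> 2" and q: "square_integrable q" and "e > 0"
  obtains p where "smooth_on {0..1} p" "\<And>u. u \<in> {0..1} \<Longrightarrow> p u \<noteq> 0" "L2_norm (\<lambda>u. q u - p u) < e"
proof -
  have [measurable]: "q \<in> borel_measurable U01" using q by blast
  define T where "T = (\<lambda>(n::nat) u. if norm (q u) \<le> n then q u else 0)"
  have T [measurable]: "T n \<in> borel_measurable U01" for n unfolding T_def by measurable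
  have Tsq: "square_integrable (T n)" for n
    by (rule square_integrable_dominated[OF T q, of _ 1]) (auto simp: T_def)
  have "(\<lambda>n. L2_norm (\<lambda>u. q u - T n u)) \<longlonglongrightarrow> 0"
  proof (rule L2_norm_tendsto_0[OF _ q])
    show "AE u in U01. norm (q u - T n u) \<le> norm (q u)" for n by (auto simp: T_def)
    show "AE u in U01. (\<lambda>n. q u - T n u) \<longlonglongrightarrow> 0"
    proof (rule AE_I2, rule tendsto_eventually)
      fix u
      show "\<forall>\<^sub>F n in sequentially. q u - T n u = 0"
        using eventually_ge_at_top[of "nat \<lceil>norm (q u)\<rceil>"]
      proof eventually_elim
        case (elim n)
        then have "norm (q u) \<le> real n" by linarith
        then show ?case by (simp add: T_def)
      qed
    qed
  qed measurable
  then have "\<forall>\<^sub>F n in sequentially. L2_norm (\<lambda>u. q u - T n u) < e / 3"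
    using \<open>e > 0\<close> by (intro order_tendstoD(2)) auto
  then obtain n where n: "L2_norm (\<lambda>u. q u - T n u) < e / 3" by (auto simp: eventually_sequentially)
  have B: "norm (T n x) \<le> real n + 1" for x by (simp add: T_def)
  obtain p N where p: "negligible N" "\<And>k::nat. polynomial_function (p k)"
    "\<And>k x. x \<in> {0..1} \<Longrightarrow> norm (p k x) \<le> real n + 1 + 1" "\<And>x. x \<in> {0..1} - N \<Longrightarrow> (\<lambda>k. p k x) \<longlonglongrightarrow> T n x"
    using polynomial_approx_AE[OF compact_Icc T[of n], of "real n + 1"] B by (metis add_nonneg_pos of_nat_0_le_iff zero_less_one)
  have psm: "smooth_on {0..1} (p k)" for k by (rule smooth_on_polynomial_function[OF p(2)])
  have pm [measurable]: "p k \<in> borel_measurable U01" for k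
    by (rule borel_continuous_U01[OF smooth_on_continuous[OF psm]])
  have "(\<lambda>k. L2_norm (\<lambda>u. T n u - p k u)) \<longlonglongrightarrow> 0"
  proof (rule L2_norm_tendsto_0)
    show "square_integrable (\<lambda>u. 2 * real n + 3)" by (rule square_integrable_bounded[of _ "2 * real n + 3"]) auto
    show "AE u in U01. norm (T n u - p k u) \<le> norm (2 * real n + 3)" for k
    proof (rule AE_I2)
      fix u assume "u \<in> space U01"
      then show "norm (T n u - p k u) \<le> norm (2 * real n + 3)"
        using norm_triangle_ineq4[of "T n u" "p k u"] B[of u] p(3)[of u k] by simp
    qed
    show "AE u in U01. (\<lambda>k. T n u - p k u) \<longlonglongrightarrow> 0"
    proof (rule AE_U01_negligible[OF p(1)])
      fix u assume "u \<in> {0..1::real}" "u \<notin> N"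
      from tendsto_diff[OF tendsto_const[of "T n u"] p(4), of u] this
      show "(\<lambda>k. T n u - p k u) \<longlonglongrightarrow> 0" by simp
    qed
  qed measurable
  then have "\<forall>\<^sub>F k in sequentially. L2_norm (\<lambda>u. T n u - p k u) < e / 3"
    using \<open>e > 0\<close> by (intro order_tendstoD(2)) auto
  then obtain k where k: "L2_norm (\<lambda>u. T n u - p k u) < e / 3" by (auto simp: eventually_sequentially)
  have neg: "negligible ((\<lambda>u. - p k u) ` {0..1})"
    using dim by (intro negligible_differentiable_image_lowdim smooth_on_differentiable smooth_on_minus psm) auto
  obtain v where v: "norm v < e / 3" "v \<notin> (\<lambda>u. - p k u) ` {0..1}"
    using exists_small_notin_negligible[OF neg, of "e / 3"] \<open>e > 0\<close> by auto
  show ?thesis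
  proof (rule that)
    show "smooth_on {0..1} (\<lambda>u. p k u + v)" by (intro smooth_on_add psm smooth_on_const)
    show "p k u + v \<noteq> 0" if "u \<in> {0..1}" for u
    proof
      assume "p k u + v = 0"
      then have "v = - p k u" by (simp add: eq_neg_iff_add_eq_0 add.commute)
      then show False using v(2) that by blast
    qed
    have pk: "square_integrable (p k)" by (rule square_integrable_continuous[OF smooth_on_continuous[OF psm]])
    have sv: "square_integrable (\<lambda>u::real. - v)" by (rule square_integrable_bounded[of _ "norm v"]) auto
    note tp = square_integrable_diff[OF Tsq[of n] pk]
    have "L2_norm (\<lambda>u. (q u - T n u) + ((T n u - p k u) + (- v))) \<le>
        L2_norm (\<lambda>u. q u - T n u) + L2_norm (\<lambda>u. (T n u - p k u) + (- v))"
      by (rule L2_norm_add[OF square_integrable_diff[OF q Tsq] square_integrable_add[OF tp sv]])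
    also have "L2_norm (\<lambda>u. (T n u - p k u) + (- v)) \<le> L2_norm (\<lambda>u. T n u - p k u) + L2_norm (\<lambda>u. - v)"
      by (rule L2_norm_add[OF tp sv])
    also have "L2_norm (\<lambda>u. - v) \<le> norm v" by (rule L2_norm_bounded) auto
    also have "L2_norm (\<lambda>u. q u - T n u) + (L2_norm (\<lambda>u. T n u - p k u) + norm v) < e" using n k v(1) by simp
    finally show "L2_norm (\<lambda>u. q u - (p k u + v)) < e" by (simp add: algebra_simps)
  qed
qed

section \<open>The integrated cone distance\<close>

definition cone_dist_L2 :: "real \<Rightarrow> (real \<Rightarrow> 'a::euclidean_space) \<Rightarrow> (real \<Rightarrow> 'a) \<Rightarrow> real" where
  "cone_dist_L2 l p q = L2_norm (\<lambda>u. cone_dist l (p u) (q u))"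

text \<open>Continuity is read off from the triangle inequality and the Lipschitz bound; the
  defining formula contains directions, which are discontinuous at the apex.\<close>

lemma continuous_on_cone_dist:
  assumes l: "l > 0"
  shows "continuous_on UNIV (\<lambda>x. cone_dist l (fst x) (snd x :: 'a::real_inner))"
  unfolding continuous_on_def
proof (intro ballI)
  fix x :: "'a \<times> 'a"
  have "\<bar>cone_dist l (fst y) (snd y) - cone_dist l (fst x) (snd x)\<bar> \<le>
      (1 + 2 * l) * norm (fst y - fst x) + (1 + 2 * l) * norm (snd y - snd x)" for y
    using cone_dist_triangle[OF l, of "fst y" "snd y" "fst x"] cone_dist_triangle[OF l, of "fst x" "snd y" "snd x"]
      cone_dist_triangle[OF l, of "fst x" "snd x" "fst y"] cone_dist_triangle[OF l, of "fst y" "snd x" "snd y"]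
      cone_dist_commute[of l "fst x" "fst y"] cone_dist_commute[of l "snd x" "snd y"]
      cone_dist_le_norm[OF l, of "fst y" "fst x"] cone_dist_le_norm[OF l, of "snd y" "snd x"]
    by linarith
  then have "\<forall>\<^sub>F y in at x within UNIV. norm (cone_dist l (fst y) (snd y) - cone_dist l (fst x) (snd x)) \<le>
      (1 + 2 * l) * norm (fst y - fst x) + (1 + 2 * l) * norm (snd y - snd x)"
    by (auto intro: always_eventually)
  moreover have "((\<lambda>y. (1 + 2 * l) * norm (fst y - fst x) + (1 + 2 * l) * norm (snd y - snd x)) \<longlongrightarrow> 0)
      (at x within UNIV)"
    by (auto intro!: tendsto_eq_intros)
  ultimately have "((\<lambda>y. cone_dist l (fst y) (snd y) - cone_dist l (fst x) (snd x)) \<longlongrightarrow> 0) (at x within UNIV)"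
    by (rule Lim_null_comparison)
  then show "((\<lambda>y. cone_dist l (fst y) (snd y)) \<longlongrightarrow> cone_dist l (fst x) (snd x)) (at x within UNIV)"
    by (simp add: LIM_zero_iff)
qed

lemma borel_measurable_cone_dist:
  fixes f g :: "'b \<Rightarrow> 'a::euclidean_space"
  assumes "l > 0" "f \<in> borel_measurable M" "g \<in> borel_measurable M"
  shows "(\<lambda>x. cone_dist l (f x) (g x)) \<in> borel_measurable M"
  by (rule borel_measurable_continuous_Pair[OF assms(2,3)]) (rule continuous_on_cone_dist[OF assms(1)])

lemma square_integrable_cone_dist:
  assumes l: "l > 0" and f: "square_integrable f" and g: "square_integrable g"
  shows "square_integrable (\<lambda>u. cone_dist l (f u) (g u))"
proof (rule square_integrable_dominated)
  show "(\<lambda>u. cone_dist l (f u) (g u)) \<in> borel_measurable U01"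
    using f g by (intro borel_measurable_cone_dist l) auto
  show "square_integrable (\<lambda>u. f u - g u)" by (intro square_integrable_diff f g)
  show "norm (cone_dist l (f u) (g u)) \<le> (1 + 2 * l) * norm (f u - g u)" for u
    using cone_dist_le_norm[OF l] by simp
qed

lemma cone_dist_L2_nonneg [simp]: "0 \<le> cone_dist_L2 l f g" by (simp add: cone_dist_L2_def)

lemma cone_dist_L2_commute: "cone_dist_L2 l f g = cone_dist_L2 l g f"
  unfolding cone_dist_L2_def by (subst cone_dist_commute) simp

lemma cone_dist_L2_triangle:
  assumes l: "l > 0" and f: "square_integrable f" and g: "square_integrable g" and h: "square_integrable h"
  shows "cone_dist_L2 l f h \<le> cone_dist_L2 l f g + cone_dist_L2 l g h"
proof -
  have "cone_dist_L2 l f h \<le> L2_norm (\<lambda>u. norm (cone_dist l (f u) (g u)) + norm (cone_dist l (g u) (h u)))"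
    unfolding cone_dist_L2_def
  proof (rule L2_norm_mono)
    show "(\<lambda>u. cone_dist l (f u) (h u)) \<in> borel_measurable U01"
      by (rule borel_measurable_cone_dist[OF l square_integrable_measurable[OF f] square_integrable_measurable[OF h]])
    show "square_integrable (\<lambda>u. norm (cone_dist l (f u) (g u)) + norm (cone_dist l (g u) (h u)))"
      by (rule square_integrable_add[OF square_integrable_norm[OF square_integrable_cone_dist[OF l f g]] square_integrable_norm[OF square_integrable_cone_dist[OF l g h]]])
    show "norm (cone_dist l (f u) (h u)) \<le> norm (norm (cone_dist l (f u) (g u)) + norm (cone_dist l (g u) (h u)))" for u
      using cone_dist_triangle[OF l, of "f u" "h u" "g u"] by simp
  qed
  also have "\<dots> \<le> cone_dist_L2 l f g + cone_dist_L2 l g h"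
    unfolding cone_dist_L2_def by (rule L2_norm_triangle[OF square_integrable_cone_dist[OF l f g] square_integrable_cone_dist[OF l g h]])
  finally show ?thesis .
qed

lemma cone_dist_L2_le_L2_norm:
  assumes l: "l > 0" and "square_integrable f" "square_integrable g"
  shows "cone_dist_L2 l f g \<le> (1 + 2 * l) * L2_norm (\<lambda>u. f u - g u)"
proof -
  have "cone_dist_L2 l f g \<le> L2_norm (\<lambda>u. (1 + 2 * l) *\<^sub>R (f u - g u))"
    unfolding cone_dist_L2_def
  proof (rule L2_norm_mono)
    show "square_integrable (\<lambda>u. (1 + 2 * l) *\<^sub>R (f u - g u))"
    proof (rule square_integrable_dominated)
      show "square_integrable (\<lambda>u. f u - g u)" by (rule square_integrable_diff[OF assms(2,3)])
      show "norm ((1 + 2 * l) *\<^sub>R (f u - g u)) \<le> (1 + 2 * l) * norm (f u - g u)" for u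
        using l by simp
      show "(\<lambda>u. (1 + 2 * l) *\<^sub>R (f u - g u)) \<in> borel_measurable U01"
        using square_integrable_measurable[OF assms(2)] square_integrable_measurable[OF assms(3)] by measurable
    qed
    show "(\<lambda>u. cone_dist l (f u) (g u)) \<in> borel_measurable U01" using square_integrable_cone_dist[OF assms] by blast
    show "norm (cone_dist l (f u) (g u)) \<le> norm ((1 + 2 * l) *\<^sub>R (f u - g u))" for u
      using cone_dist_le_norm[OF l, of "f u" "g u"] l by simp
  qed
  also have "\<dots> = (1 + 2 * l) * L2_norm (\<lambda>u. f u - g u)" using l by (intro L2_norm_scale) simp
  finally show ?thesis .
qed

lemma L2_norm_le_cone_dist_L2:
  assumes l: "l > 0" and "square_integrable f" "square_integrable g"
  shows "min l 1 / 2 * L2_norm (\<lambda>u. f u - g u) \<le> cone_dist_L2 l f g"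
proof -
  have "min l 1 / 2 * L2_norm (\<lambda>u. f u - g u) = L2_norm (\<lambda>u. (min l 1 / 2) *\<^sub>R (f u - g u))"
    using l by (intro L2_norm_scale[symmetric]) simp
  also have "\<dots> \<le> cone_dist_L2 l f g"
    unfolding cone_dist_L2_def
  proof (rule L2_norm_mono)
    show "(\<lambda>u. (min l 1 / 2) *\<^sub>R (f u - g u)) \<in> borel_measurable U01"
      using square_integrable_measurable[OF assms(2)] square_integrable_measurable[OF assms(3)] by measurable
    show "square_integrable (\<lambda>u. cone_dist l (f u) (g u))" by (rule square_integrable_cone_dist[OF assms])
    show "norm ((min l 1 / 2) *\<^sub>R (f u - g u)) \<le> norm (cone_dist l (f u) (g u))" for u
      using norm_le_cone_dist[OF l, of "f u" "g u"] l by simp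
  qed
  finally show ?thesis .
qed

lemma L2_norm_eq_0:
  assumes "square_integrable f" shows "L2_norm f = 0 \<longleftrightarrow> (AE u in U01. f u = 0)"
  using integral_nonneg_eq_0_iff_AE[OF square_integrable_integrable[OF assms]] by (simp add: L2_norm_def)

lemma cone_dist_L2_eq_0:
  assumes l: "l > 0" and "square_integrable f" "square_integrable g"
  shows "cone_dist_L2 l f g = 0 \<longleftrightarrow> (AE u in U01. f u = g u)"
  unfolding cone_dist_L2_def L2_norm_eq_0[OF square_integrable_cone_dist[OF assms]] by (simp add: cone_dist_eq_0[OF l])

section \<open>Curves and their square root velocity\<close>

lemma norm_srv_sq: "(norm (srv c u))\<^sup>2 = norm (vel c u)"
  by (simp add: srv_def power_mult_distrib power_divide divide_simps power2_eq_square)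

lemma vel_eq_srv: "vel c u = norm (srv c u) *\<^sub>R srv c u"
proof (cases "vel c u = 0")
  case False
  have "norm (srv c u) = sqrt (norm (vel c u))"
    using norm_srv_sq[of c u] by (metis norm_ge_zero real_sqrt_unique)
  then show ?thesis using False by (simp add: srv_def)
qed (simp add: srv_def)

lemma srv_eqI:
  assumes "vel c u = norm x *\<^sub>R x" shows "srv c u = x"
  using assms by (auto simp: srv_def)

lemma sgn_srv: "sgn (srv c u) = sgn (vel c u)"
  by (cases "vel c u = 0") (auto simp: srv_def sgn_scaleR)

lemma srv_eq_0 [simp]: "srv c u = 0 \<longleftrightarrow> vel c u = 0"
  by (simp add: srv_def)

lemma vel_eqI:
  assumes "(c has_vector_derivative v) (at u within {0..1})" "u \<in> {0..1}"
  shows "vel c u = v"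
  unfolding vel_def using vector_derivative_within_cbox[of 0 1 u c v] assms by (simp add: cbox_interval)

text \<open>By Lebesgue differentiation \<open>vel c\<close> agrees almost everywhere with the
  density of \<open>c\<close>, so it may replace the density; unspecified values fall into the null
  set.\<close>

lemma AC0_integral:
  assumes c: "c \<in> AC0"
  shows "integrable U01 (vel c)" "\<And>t. t \<in> {0..1} \<Longrightarrow> (vel c has_integral c t) {0..t}"
proof -
  have ac: "abs_continuous_on {0..1} c" and c0: "c 0 = 0" using c by (auto simp: AC0_def)
  obtain w where w: "w absolutely_integrable_on {0..1}"
    "\<And>t. t \<in> {0..1} \<Longrightarrow> (w has_integral (c t - c 0)) {0..t}"
    by (rule abs_continuous_integral[OF ac], rule that)
  have wi: "w integrable_on {0..1}" using w(1) set_lebesgue_integral_eq_integral(1) by blast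
  obtain N where N: "negligible N"
    "\<And>x. x \<in> {0<..<1} - N \<Longrightarrow> ((\<lambda>t. integral {0..t} w) has_vector_derivative w x) (at x)"
    by (rule indefinite_integral_AE_derivative[OF wi], rule that)
  have neg: "negligible (N \<union> {0, 1})" using N(1) by simp
  have eq: "vel c x = w x" if "x \<in> {0..1} - (N \<union> {0, 1})" for x
  proof -
    have x: "x \<in> {0<..<1} - N" using that by auto
    have "(c has_vector_derivative w x) (at x)"
    proof (rule has_vector_derivative_transform_within_open[OF N(2)[OF x], of "{0<..<1}"])
      show "integral {0..y} w = c y" if "y \<in> {0<..<1}" for y
        using integral_unique[OF w(2)[of y]] that c0 by simp
    qed (use x in auto)
    then show ?thesis using vel_eqI[of c "w x" x] x by (auto intro: has_vector_derivative_at_within)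
  qed
  show "integrable U01 (vel c)"
    unfolding integrable_U01_iff
    by (rule absolutely_integrable_spike[OF w(1) neg]) (simp add: eq)
  show "(vel c has_integral c t) {0..t}" if "t \<in> {0..1}" for t
    by (rule has_integral_spike[OF neg]) (use eq w(2)[OF that] that c0 in auto)
qed

text \<open>Injectivity of \<open>srv\<close> modulo null sets, needed for distance 0 to imply
  equality. Membership in \<open>extensional\<close> settles the arguments outside the unit
  interval.\<close>

lemma AC0_eqI:
  assumes "c1 \<in> AC0" "c2 \<in> AC0" "AE u in U01. srv c1 u = srv c2 u"
  shows "c1 = c2"
proof
  fix t
  show "c1 t = c2 t"
  proof (cases "t \<in> {0..1}")
    case True
    have "AE u in lebesgue. u \<in> {0..1} \<longrightarrow> vel c1 u = vel c2 u"
      using assms(3) by (subst (asm) AE_restrict_space_iff) (auto elim!: eventually_mono simp: vel_eq_srv)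
    then obtain N where N: "N \<in> null_sets lebesgue" "{u. \<not> (u \<in> {0..1} \<longrightarrow> vel c1 u = vel c2 u)} \<subseteq> N"
      by (auto simp: eventually_ae_filter)
    have "(vel c1 has_integral c2 t) {0..t}"
      by (rule has_integral_spike[OF _ _ AC0_integral(2)[OF assms(2) True], of N])
        (use N True in \<open>auto simp: negligible_iff_null_sets\<close>)
    then show ?thesis using AC0_integral(2)[OF assms(1) True] has_integral_unique by blast
  next
    case False
    then show ?thesis using assms(1,2) by (auto simp: AC0_def extensional_def)
  qed
qed

lemma square_integrable_srv:
  assumes c: "c \<in> AC0" shows "square_integrable (srv c)"
proof -
  have [measurable]: "vel c \<in> borel_measurable U01" using AC0_integral(1)[OF c] by simp
  have "srv c \<in> borel_measurable U01" unfolding srv_def by measurable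
  then show ?thesis
    using integrable_norm[OF AC0_integral(1)[OF c]] by (simp add: square_integrable_def norm_srv_sq)
qed

text \<open>The inverse of \<open>srv\<close>: the integrand is the velocity belonging to the square
  root velocity \<open>q\<close>.\<close>

definition curve_of :: "(real \<Rightarrow> real ^ 'd::finite) \<Rightarrow> 'd curve" where
  "curve_of q = restrict (\<lambda>t. integral {0..t} (\<lambda>u. norm (q u) *\<^sub>R q u)) {0..1}"

lemma integrable_scale_norm:
  assumes "square_integrable q" shows "integrable U01 (\<lambda>u. norm (q u) *\<^sub>R q u)"
  using square_integrable_integrable[OF assms] square_integrable_measurable[OF assms]
  by (intro Bochner_Integration.integrable_bound[OF square_integrable_integrable[OF assms]])
    (auto intro!: borel_measurable_scaleR simp: power2_eq_square)

lemma curve_of_AC0: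
  assumes "square_integrable q" shows "curve_of q \<in> AC0"
proof -
  have "abs_continuous_on {0..1} (\<lambda>t. integral {0..t} (\<lambda>u. norm (q u) *\<^sub>R q u))"
    using integrable_scale_norm[OF assms] by (intro abs_continuous_indefinite_integral) (simp add: integrable_U01_iff)
  then have "abs_continuous_on {0..1} (curve_of q)"
    by (rule abs_continuous_on_dominated[OF _ abs_continuous_on_const[of _ "0::real"]])
      (auto simp: curve_of_def)
  then show ?thesis by (auto simp: AC0_def curve_of_def)
qed

lemma srv_curve_of_AE:
  assumes "square_integrable q" shows "AE u in U01. srv (curve_of q) u = q u"
proof -
  let ?w = "\<lambda>u. norm (q u) *\<^sub>R q u"
  have wi: "?w integrable_on {0..1}"
    using integrable_scale_norm[OF assms] set_lebesgue_integral_eq_integral(1) by (auto simp: integrable_U01_iff)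
  obtain N where N: "negligible N"
    "\<And>x. x \<in> {0<..<1} - N \<Longrightarrow> ((\<lambda>t. integral {0..t} ?w) has_vector_derivative ?w x) (at x)"
    by (rule indefinite_integral_AE_derivative[OF wi], rule that)
  have neg: "negligible (N \<union> {0, 1})" using N(1) by simp
  show ?thesis
  proof (rule AE_U01_negligible[OF neg])
    fix x assume x: "x \<in> {0..1::real}" "x \<notin> N \<union> {0, 1}"
    then have "((\<lambda>t. integral {0..t} ?w) has_vector_derivative ?w x) (at x)" by (intro N(2)) auto
    then have "(curve_of q has_vector_derivative ?w x) (at x within {0..1})"
      by (rule has_vector_derivative_transform[OF x(1) _ has_vector_derivative_at_within, rotated])
        (simp add: curve_of_def)
    from vel_eqI[OF this x(1)] show "srv (curve_of q) x = q x" by (rule srv_eqI)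
  qed
qed

lemma has_vector_derivative_curve_of:
  assumes q: "continuous_on {0..1} q" and u: "u \<in> {0..1}"
  shows "(curve_of q has_vector_derivative norm (q u) *\<^sub>R q u) (at u within {0..1})"
proof -
  have "continuous_on {0..1} (\<lambda>u. norm (q u) *\<^sub>R q u)" by (intro continuous_intros q)
  from integral_has_vector_derivative[OF this u] show ?thesis
    by (rule has_vector_derivative_transform[OF u, rotated]) (simp add: curve_of_def)
qed

lemma srv_curve_of:
  assumes "continuous_on {0..1} q" "u \<in> {0..1}"
  shows "srv (curve_of q) u = q u"
  by (rule srv_eqI[OF vel_eqI[OF has_vector_derivative_curve_of[OF assms] assms(2)]])

lemma curve_of_srv:
  assumes "c \<in> AC0" shows "curve_of (srv c) = c"
  by (rule AC0_eqI[OF curve_of_AC0[OF square_integrable_srv[OF assms]] assms srv_curve_of_AE[OF square_integrable_srv[OF assms]]])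

lemma curve_of_cong: "(\<And>u. u \<in> {0..1} \<Longrightarrow> q u = q' u) \<Longrightarrow> curve_of q = curve_of q'"
  unfolding curve_of_def by (intro restrict_ext integral_cong) auto

lemma curve_of_GeoCompl:
  assumes "smooth_on {0..1} q" shows "curve_of q \<in> GeoCompl"
  using curve_of_AC0[OF square_integrable_continuous[OF smooth_on_continuous[OF assms]]]
    smooth_on_cong[of "{0..1}" "srv (curve_of q)" q] srv_curve_of[OF smooth_on_continuous[OF assms]] assms
  by (simp add: GeoCompl_def)

lemma smooth_on_norm_scale:
  fixes q :: "'a::real_normed_vector \<Rightarrow> 'b::euclidean_space"
  assumes "smooth_on S q" "\<And>x. x \<in> S \<Longrightarrow> q x \<noteq> 0"
  shows "smooth_on S (\<lambda>x. norm (q x) *\<^sub>R q x)"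
proof -
  have "smooth_on S (\<lambda>x. ((q x \<bullet> q x) powr (1 / 2)) *\<^sub>R q x)"
    using assms by (intro smooth_on_scaleR smooth_on_powr smooth_on_inner) auto
  then show ?thesis by (simp add: norm_eq_sqrt_inner powr_half_sqrt)
qed

lemma curve_of_Imm0:
  assumes q: "smooth_on {0..1} q" and ne: "\<And>u. u \<in> {0..1} \<Longrightarrow> q u \<noteq> 0"
  shows "curve_of q \<in> Imm0"
proof -
  have "smooth_on {0..1} (curve_of q)"
    by (rule smooth_on_vector_derivativeI[OF has_vector_derivative_curve_of[OF smooth_on_continuous[OF q]]
          smooth_on_norm_scale[OF q ne]])
  moreover have "vel (curve_of q) u \<noteq> 0" if "u \<in> {0..1}" for u
    using srv_curve_of[OF smooth_on_continuous[OF q] that] ne[OF that] srv_eq_0 by metis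
  ultimately show ?thesis by (auto simp: Imm0_def curve_of_def)
qed

text \<open>The power -1/4 of the squared norm is its norm to the power -1/2; in this form
  smoothness of \<open>srv\<close> away from zero velocity is a matter of products and
  powers.\<close>

lemma srv_powr:
  assumes "vel c u \<noteq> 0"
  shows "srv c u = ((vel c u \<bullet> vel c u) powr (- 1 / 4)) *\<^sub>R vel c u"
proof -
  have "(vel c u \<bullet> vel c u) powr (- 1 / 4) = ((norm (vel c u))\<^sup>2) powr (- 1 / 4)"
    by (simp add: power2_norm_eq_inner)
  also have "\<dots> = norm (vel c u) powr (- (1 / 2))"
    using assms by (simp add: powr_powr flip: powr_numeral)
  also have "\<dots> = inverse (sqrt (norm (vel c u)))"
    using assms by (simp only: powr_minus) (simp add: powr_half_sqrt)
  finally show ?thesis using assms by (simp add: srv_def)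
qed

lemma smooth_vel_srv:
  assumes "smooth_on S f" "\<And>x. x \<in> S \<Longrightarrow> f x = vel (c x) (u x)" "\<And>x. x \<in> S \<Longrightarrow> f x \<noteq> 0"
  shows "smooth_on S (\<lambda>x. srv (c x) (u x))"
proof -
  have "smooth_on S (\<lambda>x. ((f x \<bullet> f x) powr (- 1 / 4)) *\<^sub>R f x)"
    using assms by (intro smooth_on_scaleR smooth_on_powr smooth_on_inner) auto
  then show ?thesis
    by (rule smooth_on_cong[THEN iffD1, rotated]) (use assms srv_powr in \<open>metis (no_types, lifting)\<close>)
qed

text \<open>\<open>srv\<close> keeps directions and takes the root of the norm. The cut-off in
  \<open>theta\<close> is \<open>pi\<close> divided by the scaling factor, so scaling moves it to
  \<open>pi\<close>. If a velocity vanishes, both cosine terms carry the factor 0 and the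
  conventions for the angle do not matter.\<close>

lemma cone_dist_srv:
  fixes a b :: real
  assumes ab: "a > 0" "b > 0"
  shows "(cone_dist (a / (2 * b)) (srv c1 u) (srv c2 u))\<^sup>2 =
    norm (vel c1 u) + norm (vel c2 u)
      - 2 * (sqrt (norm (vel c1 u) * norm (vel c2 u)) * cos (a / (2 * b) * theta a b c1 c2 u))"
proof -
  have n: "norm (srv c u) = sqrt (norm (vel c u))" for c
    using norm_srv_sq[of c u] by (metis norm_ge_zero real_sqrt_unique)
  show ?thesis
  proof (cases "vel c1 u = 0 \<or> vel c2 u = 0")
    case True
    then show ?thesis unfolding cone_dist_sq norm_srv_sq by (auto simp: n)
  next
    case False
    have "cone_angle (srv c1 u) (srv c2 u) = arccos ((vel c1 u \<bullet> vel c2 u) / (norm (vel c1 u) * norm (vel c2 u)))"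
      unfolding cone_angle_def sgn_srv using False by (simp add: sgn_div_norm divide_simps mult.commute)
    moreover have "a / (2 * b) * min x (2 * b * pi / a) = min (a / (2 * b) * x) pi" for x
      using ab by (auto simp: min_def divide_simps mult.commute)
    ultimately have "a / (2 * b) * theta a b c1 c2 u = min (a / (2 * b) * cone_angle (srv c1 u) (srv c2 u)) pi"
      using False by (simp add: theta_def)
    then show ?thesis unfolding cone_dist_sq norm_srv_sq by (simp add: n real_sqrt_mult)
  qed
qed

lemma dist_formula:
  fixes a b :: real
  assumes ab: "a > 0" "b > 0" and c: "c1 \<in> AC0" "c2 \<in> AC0"
  shows "cone_dist_L2 (a / (2 * b)) (srv c1) (srv c2) = sqrt (curve_length c1 + curve_length c2
      - 2 * (LINT u:{0..1}|lebesgue. sqrt (norm (vel c1 u) * norm (vel c2 u)) * cos (a / (2 * b) * theta a b c1 c2 u)))"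
proof -
  let ?l = "a / (2 * b)"
  let ?t = "\<lambda>u. sqrt (norm (vel c1 u) * norm (vel c2 u)) * cos (?l * theta a b c1 c2 u)"
  have l: "?l > 0" using ab by simp
  have int: "integrable U01 (\<lambda>u. norm (vel c1 u))" "integrable U01 (\<lambda>u. norm (vel c2 u))"
    using AC0_integral(1) c by auto
  have icd: "integrable U01 (\<lambda>u. (cone_dist ?l (srv c1 u) (srv c2 u))\<^sup>2)"
    using square_integrable_integrable[OF square_integrable_cone_dist[OF l square_integrable_srv[OF c(1)] square_integrable_srv[OF c(2)]]] by simp
  \<comment> \<open>Solving the pointwise identity for the cosine term yields its integrability
    without a separate look at the measurability of \<open>theta\<close>.\<close>
  have "?t = (\<lambda>u. (norm (vel c1 u) + norm (vel c2 u) - (cone_dist ?l (srv c1 u) (srv c2 u))\<^sup>2) / 2)"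
    by (auto simp: cone_dist_srv[OF ab])
  then have it: "integrable U01 ?t" using int icd by simp
  have "(\<integral>u. (cone_dist ?l (srv c1 u) (srv c2 u))\<^sup>2 \<partial>U01) =
     (\<integral>u. norm (vel c1 u) + norm (vel c2 u) - 2 * ?t u \<partial>U01)"
    by (simp add: cone_dist_srv[OF ab])
  also have "\<dots> = curve_length c1 + curve_length c2 - 2 * (\<integral>u. ?t u \<partial>U01)"
    using int it by (simp add: curve_length_def LINT_U01)
  finally show ?thesis by (simp add: cone_dist_L2_def L2_norm_def LINT_U01)
qed

section \<open>Lower bound for the length of paths\<close>

text \<open>An isolating interval with rational end points determines its point, which injects the
  set into pairs of rationals.\<close>

lemma countable_isolated_real:
  fixes S :: "real set"
  assumes "\<And>t. t \<in> S \<Longrightarrow> \<exists>e>0. \<forall>s\<in>S. \<bar>s - t\<bar> < e \<longrightarrow> s = t"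
  shows "countable S"
proof -
  have "\<forall>t\<in>S. \<exists>r. fst r < t \<and> t < snd r \<and> r \<in> \<rat> \<times> \<rat> \<and>
      (\<forall>s\<in>S. fst r < s \<and> s < snd r \<longrightarrow> s = t)"
  proof
    fix t assume "t \<in> S"
    from assms[OF this] obtain e where e: "e > 0" "\<forall>s\<in>S. \<bar>s - t\<bar> < e \<longrightarrow> s = t" by auto
    obtain x where x: "x \<in> \<rat>" "t - e < x" "x < t" using Rats_dense_in_real[of "t - e" t] e by auto
    obtain y where y: "y \<in> \<rat>" "t < y" "y < t + e" using Rats_dense_in_real[of t "t + e"] e by auto
    have "\<forall>s\<in>S. x < s \<and> s < y \<longrightarrow> s = t" using e(2) x y by (auto simp: abs_if)
    then show "\<exists>r. fst r < t \<and> t < snd r \<and> r \<in> \<rat> \<times> \<rat> \<and>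
      (\<forall>s\<in>S. fst r < s \<and> s < snd r \<longrightarrow> s = t)" using x y by (intro exI[of _ "(x, y)"]) auto
  qed
  from bchoice[OF this]
obtain r where r: "\<And>t. t \<in> S \<Longrightarrow> fst (r t) < t \<and> t < snd (r t) \<and> r t \<in> \<rat> \<times> \<rat> \<and>
      (\<forall>s\<in>S. fst (r t) < s \<and> s < snd (r t) \<longrightarrow> s = t)"
    by blast
  have "inj_on r S"
  proof (rule inj_onI)
    fix s t assume "s \<in> S" "t \<in> S" "r s = r t"
    then show "s = t" using r[of s] r[of t] by auto
  qed
  moreover have "countable (r ` S)"
  proof (rule countable_subset)
    show "r ` S \<subseteq> \<rat> \<times> \<rat>" using r by blast
    show "countable (\<rat> \<times> \<rat> :: (real \<times> real) set)" by (intro countable_SIGMA countable_rat)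
  qed
  ultimately show ?thesis by (rule countable_image_inj_on[rotated])
qed

text \<open>Near such a zero the difference quotient is close to a nonzero vector, so
  \<open>f\<close> has no other zero nearby.\<close>

lemma countable_zeros_with_derivative:
  fixes f :: "real \<Rightarrow> 'a::real_normed_vector"
  shows "countable {t \<in> A. f t = 0 \<and> (\<exists>v. v \<noteq> 0 \<and> (f has_vector_derivative v) (at t within A))}"
proof (rule countable_isolated_real)
  fix t assume "t \<in> {t \<in> A. f t = 0 \<and> (\<exists>v. v \<noteq> 0 \<and> (f has_vector_derivative v) (at t within A))}"
  then obtain v where v: "f t = 0" "v \<noteq> 0" "(f has_vector_derivative v) (at t within A)" by blast
  have "\<forall>\<^sub>F s in at t within A. (f s - f t) /\<^sub>R (s - t) \<noteq> 0"
    by (rule tendsto_imp_eventually_ne[OF has_vector_derivative_quotient_tendsto[OF v(3)] v(2)])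
  then obtain e where "e > 0" "\<forall>s\<in>A. s \<noteq> t \<and> dist s t < e \<longrightarrow> (f s - f t) /\<^sub>R (s - t) \<noteq> 0"
    by (auto simp: eventually_at)
  then show "\<exists>e>0. \<forall>s\<in>{t \<in> A. f t = 0 \<and> (\<exists>v. v \<noteq> 0 \<and> (f has_vector_derivative v) (at t within A))}.
      \<bar>s - t\<bar> < e \<longrightarrow> s = t"
    using v(1) by (intro exI[of _ e]) (auto simp: dist_real_def)
qed

lemma AE_U01_countable: "countable S \<Longrightarrow> AE t in U01. t \<notin> S"
  by (rule AE_U01_negligible[of S]) (auto simp: negligible_iff_null_sets intro: countable_imp_null_set_lborel null_sets_completionI)

section \<open>Exchanging time and parameter\<close>

interpretation U01_pair: pair_sigma_finite U01 U01
  by unfold_locales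

lemma measurable_U01_pair [measurable]: "(\<lambda>x. (fst x, snd x)) \<in> measurable (U01 \<Otimes>\<^sub>M U01) borel"
proof -
  have "(\<lambda>x. (fst x, snd x)) \<in> measurable (U01 \<Otimes>\<^sub>M U01) (borel \<Otimes>\<^sub>M borel)"
    by (intro measurable_Pair measurable_compose[OF _ measurable_U01_id] measurable_fst measurable_snd)
  then show ?thesis by (simp add: borel_prod)
qed

lemma borel_measurable_U01_pair:
  "f \<in> measurable borel N \<Longrightarrow> (\<lambda>x. f (fst x, snd x)) \<in> measurable (U01 \<Otimes>\<^sub>M U01) N"
  by (rule measurable_compose[OF measurable_U01_pair])

lemma measurable_U01_slice:
  fixes f :: "real \<times> real \<Rightarrow> 'a"
  assumes "f \<in> measurable borel N" shows "(\<lambda>u. f (t, u)) \<in> measurable U01 N" "(\<lambda>t. f (t, u)) \<in> measurable U01 N"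
proof -
  have "(\<lambda>u. (t, u)) \<in> measurable U01 (borel \<Otimes>\<^sub>M borel)" "(\<lambda>t. (t, u)) \<in> measurable U01 (borel \<Otimes>\<^sub>M borel)"
    by (auto intro!: measurable_Pair measurable_U01_id)
  then show "(\<lambda>u. f (t, u)) \<in> measurable U01 N" "(\<lambda>t. f (t, u)) \<in> measurable U01 N"
    unfolding borel_prod using assms by (auto intro: measurable_compose)
qed

text \<open>Fubini for null sets, restricted to Borel sets of the plane. This is why maps on the
  unit square are extended to Borel maps of the plane below.\<close>

lemma AE_U01_commute:
  assumes "{x. P x} \<in> sets (borel :: (real \<times> real) measure)"
  shows "(AE t in U01. AE u in U01. P (t, u)) \<longleftrightarrow> (AE u in U01. AE t in U01. P (t, u))"
proof (rule U01_pair.AE_commute)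
  have "(\<lambda>x. (fst x, snd x)) -` {x. P x} \<inter> space (U01 \<Otimes>\<^sub>M U01) \<in> sets (U01 \<Otimes>\<^sub>M U01)"
    by (rule measurable_sets[OF measurable_U01_pair assms])
  also have "(\<lambda>x. (fst x, snd x)) -` {x. P x} \<inter> space (U01 \<Otimes>\<^sub>M U01) =
      {x \<in> space (U01 \<Otimes>\<^sub>M U01). P (fst x, snd x)}" by auto
  finally show "{x \<in> space (U01 \<Otimes>\<^sub>M U01). P (fst x, snd x)} \<in> sets (U01 \<Otimes>\<^sub>M U01)" .
qed

lemma borel_measurable_integral_U01:
  fixes f :: "real \<times> real \<Rightarrow> 'b::{banach, second_countable_topology}"
  assumes "f \<in> borel_measurable borel"
  shows "(\<lambda>t. \<integral>u. f (t, u) \<partial>U01) \<in> borel_measurable U01"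
  by (rule U01.borel_measurable_lebesgue_integral)
    (use borel_measurable_U01_pair[OF assms] in \<open>simp add: split_def\<close>)

lemma borel_measurable_cone_metric [measurable (raw)]:
  fixes f g :: "'b \<Rightarrow> 'a::euclidean_space"
  assumes [measurable]: "f \<in> borel_measurable M" "g \<in> borel_measurable M"
  shows "(\<lambda>x. cone_metric l (f x) (g x)) \<in> borel_measurable M"
  unfolding cone_metric_def sgn_div_norm by measurable

lemma vector_derivative_lipschitz:
  fixes f :: "real \<Rightarrow> 'a::real_normed_vector"
  assumes "\<And>t. t \<in> {a..b} \<Longrightarrow> (f has_vector_derivative f' t) (at t within {a..b})"
    "\<And>t. t \<in> {a..b} \<Longrightarrow> norm (f' t) \<le> B" "s \<in> {a..b}" "t \<in> {a..b}"
  shows "norm (f s - f t) \<le> B * \<bar>s - t\<bar>"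
proof -
  have "norm (f s - f t) \<le> B * norm (s - t)"
  proof (rule differentiable_bound[of "{a..b}" f "\<lambda>t h. h *\<^sub>R f' t"])
    show "onorm (\<lambda>h. h *\<^sub>R f' x) \<le> B" if "x \<in> {a..b}" for x
      using mult_right_mono[OF assms(2)[OF that] abs_ge_zero]
      by (intro onorm_le) (simp add: mult.commute)
  qed (use assms in \<open>auto simp: has_vector_derivative_def\<close>)
  then show ?thesis by simp
qed

text \<open>At almost every time the growth of the distance \<open>F\<close> to the start is bounded
  by difference quotients of the distance between neighbouring times, whose squares converge, by
  dominated convergence in the parameter, to the squared speed \<open>E\<close>.\<close>

theorem cone_dist_L2_le_length:
  fixes q p :: "real \<times> real \<Rightarrow> 'a::euclidean_space"
  assumes l: "l > 0" and cq: "continuous_on UNIV q" and cp: "continuous_on UNIV p"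
    and der: "\<And>t u. t \<in> {0..1} \<Longrightarrow> u \<in> {0..1} \<Longrightarrow>
      ((\<lambda>t. q (t, u)) has_vector_derivative p (t, u)) (at t within {0..1})"
  shows "cone_dist_L2 l (\<lambda>u. q (0, u)) (\<lambda>u. q (1, u)) \<le>
    (\<integral>t. sqrt (\<integral>u. cone_metric l (q (t, u)) (p (t, u)) \<partial>U01) \<partial>U01)"
proof -
  have mq [measurable]: "q \<in> borel_measurable borel" and mp [measurable]: "p \<in> borel_measurable borel"
    using cq cp by (auto intro: borel_measurable_continuous_onI)
  have "compact (p ` ({0..1} \<times> {0..1}))"
    by (intro compact_continuous_image continuous_on_subset[OF cp] compact_Times compact_Icc) auto
  then obtain B where B: "\<And>t u. t \<in> {0..1} \<Longrightarrow> u \<in> {0..1} \<Longrightarrow> norm (p (t, u)) \<le> B"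
    by (force dest!: compact_imp_bounded simp: bounded_iff)
  have B0: "0 \<le> B" using order_trans[OF norm_ge_zero B[of 0 0]] by simp
  have lip: "norm (q (s, u) - q (t, u)) \<le> B * \<bar>s - t\<bar>"
    if "s \<in> {0..1}" "t \<in> {0..1}" "u \<in> {0..1}" for s t u
    by (rule vector_derivative_lipschitz[OF der B]) (use that in auto)
  have sq: "square_integrable (\<lambda>u. q (t, u))" for t
    by (intro square_integrable_continuous continuous_on_compose2[OF cq]) (auto intro!: continuous_intros)
  \<comment> \<open>Lipschitz constant in time of the cone distance: the Euclidean speed bound
    \<open>B\<close> times the comparison constant. It also dominates the difference quotients
    below.\<close>
  let ?C = "(1 + 2 * l) * B"
  have cdl: "cone_dist l (q (s, u)) (q (t, u)) \<le> ?C * \<bar>s - t\<bar>"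
    if "s \<in> {0..1}" "t \<in> {0..1}" "u \<in> {0..1}" for s t u
  proof -
    have "cone_dist l (q (s, u)) (q (t, u)) \<le> (1 + 2 * l) * norm (q (s, u) - q (t, u))" by (rule cone_dist_le_norm[OF l])
    also have "\<dots> \<le> (1 + 2 * l) * (B * \<bar>s - t\<bar>)" using l by (intro mult_left_mono lip that) auto
    finally show ?thesis by simp
  qed
  have mcd: "(\<lambda>u. cone_dist l (q (s, u)) (q (t, u))) \<in> borel_measurable U01" for s t
    by (rule square_integrable_measurable[OF square_integrable_cone_dist[OF l sq sq]])
  have cdistl: "cone_dist_L2 l (\<lambda>u. q (s, u)) (\<lambda>u. q (t, u)) \<le> ?C * \<bar>s - t\<bar>" if "s \<in> {0..1}" "t \<in> {0..1}" for s t
    unfolding cone_dist_L2_def by (rule L2_norm_bounded[OF mcd]) (use cdl that in auto)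
  define F where "F = (\<lambda>t. cone_dist_L2 l (\<lambda>u. q (0, u)) (\<lambda>u. q (t, u)))"
  have F: "F s - F t \<le> cone_dist_L2 l (\<lambda>u. q (t, u)) (\<lambda>u. q (s, u))" for s t
    using cone_dist_L2_triangle[OF l sq[of 0] sq[of t] sq[of s]] by (simp add: F_def)
  have "abs_continuous_on {0..1} F"
  proof (rule abs_continuous_on_lipschitz)
    fix x y :: real assume xy: "x \<in> {0..1}" "y \<in> {0..1}"
    then show "norm (F y - F x) \<le> ?C * \<bar>y - x\<bar>"
      using F[of x y] F[of y x] cdistl[OF xy] cdistl[OF xy(2,1)] by (simp add: abs_le_iff abs_minus_commute)
  qed
  note ac = this
  obtain w where w: "w absolutely_integrable_on {0..1}"
    "\<And>t. t \<in> {0..1} \<Longrightarrow> (w has_integral (F t - F 0)) {0..t}"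
    by (rule abs_continuous_integral[OF ac], rule that)
  have wi: "w integrable_on {0..1}" using w(1) set_lebesgue_integral_eq_integral(1) by blast
  obtain N where N: "negligible N"
    "\<And>x. x \<in> {0<..<1} - N \<Longrightarrow> ((\<lambda>t. integral {0..t} w) has_vector_derivative w x) (at x)"
    by (rule indefinite_integral_AE_derivative[OF wi], rule that)
  have F0: "F 0 = 0" unfolding F_def by (subst cone_dist_L2_eq_0[OF l sq sq]) simp
  define E where "E = (\<lambda>t. \<integral>u. cone_metric l (q (t, u)) (p (t, u)) \<partial>U01)"
  have gB: "cone_metric l (q (t, u)) (p (t, u)) \<le> (l\<^sup>2 + 1) * B\<^sup>2" if "t \<in> {0..1}" "u \<in> {0..1}" for t u
    using B[OF that] by (intro order_trans[OF cone_metric_le] mult_left_mono power_mono) auto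
  have mg: "(\<lambda>x. cone_metric l (q x) (p x)) \<in> borel_measurable borel" by measurable
  have gi: "integrable U01 (\<lambda>u. cone_metric l (q (t, u)) (p (t, u)))" if "t \<in> {0..1}" for t
    by (rule integrable_U01_bounded[OF measurable_U01_slice(1)[OF mg], of _ "(l\<^sup>2 + 1) * B\<^sup>2"])
      (simp add: gB that[unfolded atLeastAtMost_iff] cone_metric_nonneg)
  have E: "0 \<le> E t" "t \<in> {0..1} \<Longrightarrow> E t \<le> (l\<^sup>2 + 1) * B\<^sup>2" for t
  proof -
    show "0 \<le> E t" unfolding E_def by (intro integral_nonneg_AE) (simp add: cone_metric_nonneg)
    assume t: "t \<in> {0..1}"
    have "E t \<le> (\<integral>u. (l\<^sup>2 + 1) * B\<^sup>2 \<partial>U01)" unfolding E_def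
      by (intro integral_mono gi t) (use gB t in auto)
    then show "E t \<le> (l\<^sup>2 + 1) * B\<^sup>2" by simp
  qed
  have mE: "E \<in> borel_measurable U01" unfolding E_def by (rule borel_measurable_integral_U01[OF mg])
  \<comment> \<open>For each parameter the exceptional times are countable; exchanging the order
    makes the exceptional parameters null for almost every time.\<close>
  have "AE t in U01. AE u in U01. q (t, u) = 0 \<longrightarrow> p (t, u) = 0"
  proof (subst AE_U01_commute)
    show "{x. q x = 0 \<longrightarrow> p x = 0} \<in> sets borel" by measurable
    show "AE u in U01. AE t in U01. q (t, u) = 0 \<longrightarrow> p (t, u) = 0"
    proof (rule AE_I2)
      fix u assume "u \<in> space U01"
      then have u: "u \<in> {0..1}" by simp
      have "AE t in U01. t \<notin> {t \<in> {0..1}. q (t, u) = 0 \<and>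
          (\<exists>v. v \<noteq> 0 \<and> ((\<lambda>t. q (t, u)) has_vector_derivative v) (at t within {0..1}))}"
        by (rule AE_U01_countable[OF countable_zeros_with_derivative])
      moreover have "AE t in U01. t \<in> {0..1}" by (rule AE_I2) simp
      ultimately show "AE t in U01. q (t, u) = 0 \<longrightarrow> p (t, u) = 0"
      proof eventually_elim
        case (elim t)
        then show ?case using der[of t u] u by blast
      qed
    qed
  qed
  moreover have "AE t in U01. t \<notin> N" by (rule AE_U01_negligible[OF N(1)])
  ultimately have "AE t in U01. w t \<le> sqrt (E t)"
    using AE_U01_Ioo
  proof eventually_elim
    case (elim t)
    then have t: "t \<in> {0<..<1}" "t \<in> {0..1}" by auto
    \<comment> \<open>A sequence of later times decreasing to \<open>t\<close>, as dominated
      convergence needs sequences; the factor \<open>1 - t\<close> keeps it inside the unit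
      interval.\<close>
    define s where "s = (\<lambda>n. t + (1 - t) * inverse (real (Suc (Suc n))))"
    have s: "s n \<in> {0..1}" "s n > t" "s n - t > 0" for n
    proof -
      have "(1 - t) * inverse (real (Suc (Suc n))) \<le> (1 - t) * 1"
        using t by (intro mult_left_mono) (auto simp: inverse_le_1_iff)
      moreover have "(1 - t) * inverse (real (Suc (Suc n))) > 0" using t by simp
      ultimately show "s n \<in> {0..1}" "s n > t" "s n - t > 0" using t by (auto simp: s_def)
    qed
    from tendsto_add[OF tendsto_const tendsto_mult[OF tendsto_const LIMSEQ_Suc[OF LIMSEQ_inverse_real_of_nat]],
        of t "1 - t"]
    have st: "s \<longlonglongrightarrow> t" by (simp add: s_def)
    have fs: "filterlim s (at t within {0..1}) sequentially"
      unfolding filterlim_at using st s by (auto intro!: always_eventually simp: less_imp_neq)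
    have "(F has_vector_derivative w t) (at t)"
    proof (rule has_vector_derivative_transform_within_open[OF N(2), of _ "{0<..<1}"])
      show "integral {0..y} w = F y" if "y \<in> {0<..<1}" for y
        using integral_unique[OF w(2)[of y]] that F0 by simp
    qed (use t elim in auto)
    then have "(F has_vector_derivative w t) (at t within {0..1})" by (rule has_vector_derivative_at_within)
    from filterlim_compose[OF has_vector_derivative_quotient_tendsto[OF this] fs]
    have lim1: "(\<lambda>n. (F (s n) - F t) /\<^sub>R (s n - t)) \<longlonglongrightarrow> w t" .
    have lim2: "(\<lambda>n. \<integral>u. (cone_dist l (q (t, u)) (q (s n, u)))\<^sup>2 / (s n - t)\<^sup>2 \<partial>U01) \<longlonglongrightarrow> E t"
      unfolding E_def
    proof (rule integral_dominated_convergence[where w = "\<lambda>u. ?C\<^sup>2"])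
      show "(\<lambda>u. cone_metric l (q (t, u)) (p (t, u))) \<in> borel_measurable U01" by (rule measurable_U01_slice(1)[OF mg])
      show "(\<lambda>u. (cone_dist l (q (t, u)) (q (s n, u)))\<^sup>2 / (s n - t)\<^sup>2) \<in> borel_measurable U01" for n
        using mcd[of t "s n"] by measurable
      have "AE u in U01. u \<in> {0..1}" by (rule AE_I2) simp
      with elim(1) show "AE u in U01. (\<lambda>n. (cone_dist l (q (t, u)) (q (s n, u)))\<^sup>2 / (s n - t)\<^sup>2) \<longlonglongrightarrow> cone_metric l (q (t, u)) (p (t, u))"
      proof eventually_elim
        case (elim u)
        from filterlim_compose[OF cone_dist_metric_derivative[OF l der[OF t(2) elim(2)] elim(1)] fs]
        show ?case .
      qed
      show "AE u in U01. norm ((cone_dist l (q (t, u)) (q (s n, u)))\<^sup>2 / (s n - t)\<^sup>2) \<le> ?C\<^sup>2" for n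
      proof (rule AE_I2)
        fix u assume "u \<in> space U01"
        then have u: "u \<in> {0..1}" by simp
        have "(cone_dist l (q (t, u)) (q (s n, u)))\<^sup>2 \<le> (?C * \<bar>t - s n\<bar>)\<^sup>2"
          using cdl[OF t(2) s(1) u] by (intro power_mono) auto
        also have "\<dots> = ?C\<^sup>2 * (s n - t)\<^sup>2" by (simp add: power_mult_distrib power2_commute)
        finally show "norm ((cone_dist l (q (t, u)) (q (s n, u)))\<^sup>2 / (s n - t)\<^sup>2) \<le> ?C\<^sup>2"
          using s(3)[of n] by (simp add: divide_simps)
      qed
    qed simp
    have "(F (s n) - F t) /\<^sub>R (s n - t) \<le> sqrt (\<integral>u. (cone_dist l (q (t, u)) (q (s n, u)))\<^sup>2 / (s n - t)\<^sup>2 \<partial>U01)" for n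
    proof -
      have "(F (s n) - F t) /\<^sub>R (s n - t) \<le> cone_dist_L2 l (\<lambda>u. q (t, u)) (\<lambda>u. q (s n, u)) /\<^sub>R (s n - t)"
        using F[of "s n" t] s(3)[of n] by (intro scaleR_left_mono) auto
      also have "\<dots> = sqrt (\<integral>u. (cone_dist l (q (t, u)) (q (s n, u)))\<^sup>2 / (s n - t)\<^sup>2 \<partial>U01)"
        using s(3)[of n] by (simp add: cone_dist_L2_def L2_norm_def real_sqrt_divide) (simp add: divide_inverse mult.commute)
      finally show ?thesis .
    qed
    then show ?case
      by (intro LIMSEQ_le[OF lim1 tendsto_real_sqrt[OF lim2]]) auto
  qed
  moreover have "integrable U01 w" using w(1) by (simp add: integrable_U01_iff)
  moreover have "integrable U01 (\<lambda>t. sqrt (E t))"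
    using E mE by (intro integrable_U01_bounded[of _ "sqrt ((l\<^sup>2 + 1) * B\<^sup>2)"])
      (auto intro!: borel_measurable_sqrt[THEN measurable_compose[rotated]] simp del: real_sqrt_mult)
  ultimately have "(\<integral>t. w t \<partial>U01) \<le> (\<integral>t. sqrt (E t) \<partial>U01)" by (intro integral_mono_AE)
  moreover have "(\<integral>t. w t \<partial>U01) = F 1"
    using integral_unique[OF w(2)[of 1]] F0 \<open>integrable U01 w\<close> by (simp add: integral_U01)
  ultimately show ?thesis by (simp add: F_def E_def)
qed

section \<open>Construction of short paths\<close>

text \<open>Clamping the argument makes \<open>arccos\<close> continuous on the whole line without
  changing it where it is used.\<close>

lemma borel_measurable_arccos:
  assumes [measurable]: "f \<in> borel_measurable M" and "\<And>x. - 1 \<le> f x \<and> f x \<le> 1"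
  shows "(\<lambda>x. arccos (f x)) \<in> borel_measurable M"
proof -
  have "continuous_on UNIV (\<lambda>y. arccos (max (- 1) (min 1 y)))"
    by (rule continuous_on_compose2[OF continuous_on_arccos']) (auto intro!: continuous_intros)
  then have [measurable]: "(\<lambda>y. arccos (max (- 1) (min 1 y))) \<in> borel_measurable borel"
    by (rule borel_measurable_continuous_onI)
  have "(\<lambda>x. arccos (max (- 1) (min 1 (f x)))) \<in> borel_measurable M" by measurable
  moreover have "max (- 1) (min 1 (f x)) = f x" for x using assms(2)[of x] by auto
  ultimately show ?thesis by simp
qed

lemma divide_bounds_abs: "\<bar>x\<bar> \<le> r \<Longrightarrow> - 1 \<le> x / r \<and> x / r \<le> 1" for x r :: real
  by (cases "r = 0") (auto simp: divide_simps)

lemma borel_measurable_cone_geodesic: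
  fixes f g :: "'b \<Rightarrow> 'a::euclidean_space"
  assumes [measurable]: "f \<in> borel_measurable M" "g \<in> borel_measurable M" "h \<in> borel_measurable M"
  shows "(\<lambda>x. cone_geodesic b1 b2 l (f x) (g x) (h x)) \<in> borel_measurable M"
proof -
  have [measurable]: "(\<lambda>x. cone_angle (f x) (g x)) \<in> borel_measurable M"
    unfolding cone_angle_def
  proof (rule borel_measurable_arccos)
    show "(\<lambda>x. sgn (f x) \<bullet> sgn (g x)) \<in> borel_measurable M" unfolding sgn_div_norm by measurable
  qed (simp add: inner_sgn_bounds)
  have [measurable]: "(\<lambda>x. cone_normal b1 b2 (f x) (g x)) \<in> borel_measurable M"
    unfolding cone_normal_def Let_def sgn_div_norm by measurable
  define X where "X = (\<lambda>x. (1 - h x) * norm (f x) + h x * norm (g x) * cos (l * cone_angle (f x) (g x)))"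
  define Y where "Y = (\<lambda>x. h x * norm (g x) * sin (l * cone_angle (f x) (g x)))"
  have [measurable]: "X \<in> borel_measurable M" "Y \<in> borel_measurable M"
    unfolding X_def Y_def by measurable
  have [measurable]: "(\<lambda>x. arccos (X x / sqrt ((X x)\<^sup>2 + (Y x)\<^sup>2))) \<in> borel_measurable M"
  proof (rule borel_measurable_arccos)
    fix x
    have "\<bar>X x\<bar> \<le> sqrt ((X x)\<^sup>2 + (Y x)\<^sup>2)" by (rule real_sqrt_ge_abs1)
    then show "- 1 \<le> X x / sqrt ((X x)\<^sup>2 + (Y x)\<^sup>2) \<and> X x / sqrt ((X x)\<^sup>2 + (Y x)\<^sup>2) \<le> 1"
      by (rule divide_bounds_abs)
  qed measurable
  show ?thesis
    unfolding cone_geodesic_def Let_def X_def[symmetric] Y_def[symmetric] sgn_div_norm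
    unfolding fun_cong[OF X_def, symmetric] fun_cong[OF Y_def, symmetric]
    by measurable
qed

lemma lipschitz_vector_derivative_bound:
  assumes "(f has_vector_derivative v) (at t within S)" "at t within S \<noteq> bot"
    "\<And>s. s \<in> S \<Longrightarrow> norm (f s - f t) \<le> K * \<bar>s - t\<bar>"
  shows "norm v \<le> K"
proof (rule tendsto_upperbound[OF tendsto_norm[OF has_vector_derivative_quotient_tendsto[OF assms(1)]] _ assms(2)])
  show "\<forall>\<^sub>F s in at t within S. norm ((f s - f t) /\<^sub>R (s - t)) \<le> K"
    unfolding eventually_at_filter
  proof (rule always_eventually, intro allI impI)
    fix s assume "s \<noteq> t" "s \<in> S"
    then show "norm ((f s - f t) /\<^sub>R (s - t)) \<le> K"
      using assms(3)[of s] by (simp add: divide_simps divide_inverse_commute[symmetric] mult.commute)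
  qed
qed

text \<open>\<open>Q\<close> consists of the pointwise geodesics and \<open>G\<close> of their
  velocities. Each geodesic is Lipschitz in time, hence the integral of its almost everywhere
  derivative; the work lies in choosing these derivatives jointly Borel and bounded.\<close>

lemma geodesic_field:
  fixes q0 q1 :: "real \<Rightarrow> 'a::euclidean_space"
  assumes l: "l > 0" and dim: "DIM('a) \<ge> 2" and c0: "continuous_on UNIV q0" and c1: "continuous_on UNIV q1"
  obtains Q G :: "real \<times> real \<Rightarrow> 'a" and K where
    "Q \<in> borel_measurable borel" "G \<in> borel_measurable borel" "K > 0" "\<And>x. norm (G x) \<le> K"
    "AE u in U01. AE t in U01. (Q (t, u) = 0 \<longrightarrow> G (t, u) = 0) \<and>
       cone_metric l (Q (t, u)) (G (t, u)) \<le> (cone_dist l (q0 u) (q1 u))\<^sup>2"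
    "\<And>t u. t \<in> {0..1} \<Longrightarrow> u \<in> {0..1} \<Longrightarrow> ((\<lambda>s. G (s, u)) has_integral (Q (t, u) - q0 u)) {0..t}"
    "\<And>u. Q (1, u) = q1 u"
proof -
  have "\<not> DIM('a) \<le> Suc 0" using dim by simp
  then obtain b1 b2 :: 'a where b: "b1 \<in> Basis" "b2 \<in> Basis" "b1 \<noteq> b2"
    using card_le_Suc0_iff_eq[OF finite_Basis, where 'a1='a] by blast
  define Q where "Q = (\<lambda>x. cone_geodesic b1 b2 l (q0 (snd x)) (q1 (snd x)) (clamp01 (fst x)))"
  have [measurable]: "q0 \<in> borel_measurable borel" "q1 \<in> borel_measurable borel"
    using c0 c1 by (auto intro: borel_measurable_continuous_onI)
  have [measurable]: "clamp01 \<in> borel_measurable borel"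
    unfolding clamp01_def by measurable
  have fs [measurable]: "fst \<in> borel_measurable (borel :: (real \<times> real) measure)"
      "snd \<in> borel_measurable (borel :: (real \<times> real) measure)"
    by (auto intro!: borel_measurable_continuous_onI continuous_intros)
  have Qm [measurable]: "Q \<in> borel_measurable borel"
    unfolding Q_def by (intro borel_measurable_cone_geodesic) measurable
  have Q01: "Q (0, u) = q0 u" "Q (1, u) = q1 u" for u
    by (simp_all add: Q_def cone_geodesic_0[OF l] cone_geodesic_1[OF l b])
  let ?L = "\<lambda>u. cone_dist l (q0 u) (q1 u)"
  have cdQ: "cone_dist l (Q (s, u)) (Q (t, u)) \<le> \<bar>s - t\<bar> * ?L u" if "s \<in> {0..1}" "t \<in> {0..1}" for s t u
    using cone_dist_cone_geodesic[OF l b that] that by (simp add: Q_def)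
  obtain M where M: "\<And>u. u \<in> {0..1} \<Longrightarrow> ?L u \<le> M"
  proof -
    have "continuous_on {0..1} (\<lambda>u. ?L u)"
      using continuous_on_compose2[OF continuous_on_cone_dist[OF l], of "{0..1}" "\<lambda>u. (q0 u, q1 u)"]
      by (auto intro!: continuous_intros continuous_on_subset[OF c0] continuous_on_subset[OF c1])
    then obtain B where "\<And>u. u \<in> {0..1} \<Longrightarrow> norm (?L u) \<le> B" using continuous_on_U01_bounded by blast
    then show ?thesis by (intro that[of B]) force
  qed
  define c where "c = min l 1 / 2"
  have c: "c > 0" using l by (simp add: c_def)
  \<comment> \<open>Euclidean speed bound, from the maximal cone distance \<open>M\<close> and the
    lower comparison constant \<open>c\<close>; the added 1 makes it positive.\<close>
  define K where "K = \<bar>M\<bar> / c + 1"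
  have K: "K > 0" using c by (simp add: K_def add_nonneg_pos)
  have lip: "norm (Q (s, u) - Q (t, u)) \<le> K * \<bar>s - t\<bar>" if "s \<in> {0..1}" "t \<in> {0..1}" "u \<in> {0..1}" for s t u
  proof -
    have "c * norm (Q (s, u) - Q (t, u)) \<le> cone_dist l (Q (s, u)) (Q (t, u))"
      unfolding c_def by (rule norm_le_cone_dist[OF l])
    also have "\<dots> \<le> \<bar>s - t\<bar> * ?L u" by (rule cdQ[OF that(1,2)])
    also have "\<dots> \<le> \<bar>s - t\<bar> * \<bar>M\<bar>" using M[OF that(3)] by (intro mult_left_mono) auto
    finally have "norm (Q (s, u) - Q (t, u)) \<le> \<bar>M\<bar> / c * \<bar>s - t\<bar>"
      using c by (simp add: pos_le_divide_eq mult.commute)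
    also have "\<dots> \<le> K * \<bar>s - t\<bar>" by (intro mult_right_mono) (simp_all add: K_def)
    finally show ?thesis .
  qed
  define h where "h = (\<lambda>n::nat. inverse (real (Suc n)))"
  \<comment> \<open>A limit along a fixed sequence of step sizes is Borel in both variables. Where
    it does not exist the value is arbitrary, and the truncation at \<open>K\<close> in
    \<open>G\<close> keeps the field bounded everywhere.\<close>
  define G' where "G' = (\<lambda>x. lim (\<lambda>n. (Q (fst x + h n, snd x) - Q x) /\<^sub>R h n))"
  define G where "G = (\<lambda>x. if norm (G' x) \<le> K then G' x else 0)"
  have [measurable]: "(\<lambda>x. Q (fst x + h n, snd x)) \<in> borel_measurable borel" for n
    by (rule measurable_compose[OF _ Qm]) (intro borel_measurable_continuous_onI continuous_intros)
  have [measurable]: "G' \<in> borel_measurable borel" unfolding G'_def by measurable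
  have Gm [measurable]: "G \<in> borel_measurable borel" unfolding G_def by measurable
  have GK: "norm (G x) \<le> K" for x using K by (simp add: G_def)
  have slice: "\<exists>w N. w absolutely_integrable_on {0..1} \<and> negligible N \<and>
      (\<forall>t\<in>{0..1}. (w has_integral (Q (t, u) - q0 u)) {0..t}) \<and>
      (\<forall>t\<in>{0..1} - N. G (t, u) = w t \<and> (Q (t, u) = 0 \<longrightarrow> G (t, u) = 0) \<and> cone_metric l (Q (t, u)) (G (t, u)) \<le> (?L u)\<^sup>2)"
    if u: "u \<in> {0..1}" for u
  proof -
    have ac: "abs_continuous_on {0..1} (\<lambda>t. Q (t, u))"
      by (rule abs_continuous_on_lipschitz[of _ _ K]) (use lip u in auto)
    obtain w where w: "w absolutely_integrable_on {0..1}"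
      "\<And>t. t \<in> {0..1} \<Longrightarrow> (w has_integral (Q (t, u) - Q (0, u))) {0..t}"
      by (rule abs_continuous_integral[OF ac], rule that)
    have wi: "w integrable_on {0..1}" using w(1) set_lebesgue_integral_eq_integral(1) by blast
    obtain N where N: "negligible N"
      "\<And>x. x \<in> {0<..<1} - N \<Longrightarrow> ((\<lambda>t. integral {0..t} w) has_vector_derivative w x) (at x)"
      by (rule indefinite_integral_AE_derivative[OF wi], rule that)
    define Z where "Z = {t \<in> {0..1}. Q (t, u) = 0 \<and>
        (\<exists>v. v \<noteq> 0 \<and> ((\<lambda>t. Q (t, u)) has_vector_derivative v) (at t within {0..1}))}"
    have "countable Z" unfolding Z_def by (rule countable_zeros_with_derivative)
    then have "negligible Z" by (auto simp: negligible_iff_null_sets intro: countable_imp_null_set_lborel null_sets_completionI)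
    have neg: "negligible (N \<union> Z \<union> {0, 1})" using N(1) \<open>negligible Z\<close> by simp
    have main: "G (t, u) = w t \<and> (Q (t, u) = 0 \<longrightarrow> G (t, u) = 0) \<and> cone_metric l (Q (t, u)) (G (t, u)) \<le> (?L u)\<^sup>2"
      if t: "t \<in> {0..1} - (N \<union> Z \<union> {0, 1})" for t
    proof -
      have t': "t \<in> {0<..<1} - N" "t \<in> {0..1}" "t \<notin> Z" using t by auto
      have nb: "at t within {0..1} \<noteq> bot" using t'(2) by (simp add: at_within_Icc_at trivial_limit_within islimpt_Icc)
      have "((\<lambda>s. integral {0..s} w + q0 u) has_vector_derivative w t) (at t)"
        using has_vector_derivative_add_const[THEN iffD2, OF N(2)[OF t'(1)]] .
      then have "((\<lambda>t. Q (t, u)) has_vector_derivative w t) (at t)"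
      proof (rule has_vector_derivative_transform_within_open[of _ _ _ "{0<..<1}"])
        show "integral {0..s} w + q0 u = Q (s, u)" if "s \<in> {0<..<1}" for s
          using integral_unique[OF w(2)[of s]] that by (simp add: Q01)
      qed (use t' in auto)
      then have der: "((\<lambda>t. Q (t, u)) has_vector_derivative w t) (at t within {0..1})"
        by (rule has_vector_derivative_at_within)
      have wK: "norm (w t) \<le> K"
        by (rule lipschitz_vector_derivative_bound[OF der nb]) (use lip t' u in auto)
      have "h \<longlonglongrightarrow> 0" unfolding h_def by (rule LIMSEQ_inverse_real_of_nat)
      then have th: "(\<lambda>n. t + h n) \<longlonglongrightarrow> t" using tendsto_add[OF tendsto_const, of h 0 _ t] by simp
      have "\<forall>\<^sub>F n in sequentially. t + h n < 1" using t' by (intro order_tendstoD(2)[OF th]) auto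
      then have "\<forall>\<^sub>F n in sequentially. t + h n \<in> {0..1} \<and> t + h n \<noteq> t"
      proof eventually_elim
        case (elim n)
        moreover have "h n > 0" by (simp add: h_def)
        ultimately show ?case using t' by auto
      qed
      with th have fl: "filterlim (\<lambda>n. t + h n) (at t within {0..1}) sequentially"
        unfolding filterlim_at by (simp add: eventually_conj_iff)
      from filterlim_compose[OF has_vector_derivative_quotient_tendsto[OF der] fl]
      have "(\<lambda>n. (Q (t + h n, u) - Q (t, u)) /\<^sub>R h n) \<longlonglongrightarrow> w t" by simp
      then have "G' (t, u) = w t" unfolding G'_def by (simp add: limI)
      then have G: "G (t, u) = w t" using wK by (simp add: G_def)
      have zero: "Q (t, u) = 0 \<longrightarrow> w t = 0" using t'(2,3) der unfolding Z_def by blast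
      have "cone_metric l (Q (t, u)) (w t) \<le> (?L u)\<^sup>2"
      \<comment> \<open>Constant speed of the geodesic bounds every squared difference quotient by
        the squared distance of the end points, hence also the limit.\<close>
      proof (rule tendsto_upperbound[OF cone_dist_metric_derivative[OF l der zero] _ nb])
        show "\<forall>\<^sub>F s in at t within {0..1}. (cone_dist l (Q (t, u)) (Q (s, u)))\<^sup>2 / (s - t)\<^sup>2 \<le> (?L u)\<^sup>2"
          unfolding eventually_at_filter
        proof (rule always_eventually, intro allI impI)
          fix s assume s: "s \<noteq> t" "s \<in> {0..1}"
          have "(cone_dist l (Q (t, u)) (Q (s, u)))\<^sup>2 \<le> (\<bar>t - s\<bar> * ?L u)\<^sup>2"
            using cdQ[OF t'(2) s(2)] by (intro power_mono) auto
          also have "\<dots> = (?L u)\<^sup>2 * (s - t)\<^sup>2" by (simp add: power_mult_distrib power2_commute)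
          finally show "(cone_dist l (Q (t, u)) (Q (s, u)))\<^sup>2 / (s - t)\<^sup>2 \<le> (?L u)\<^sup>2"
            using s by (simp add: divide_simps)
        qed
      qed
      with G zero show ?thesis by simp
    qed
    show ?thesis using w neg main unfolding Q01 by blast
  qed
  show ?thesis
  proof (rule that[OF Qm Gm K GK])
    show "AE u in U01. AE t in U01. (Q (t, u) = 0 \<longrightarrow> G (t, u) = 0) \<and> cone_metric l (Q (t, u)) (G (t, u)) \<le> (?L u)\<^sup>2"
    proof (rule AE_I2)
      fix u assume "u \<in> space U01"
      then have "u \<in> {0..1}" by simp
      from slice[OF this] obtain w N where N: "negligible N"
        "\<forall>t\<in>{0..1} - N. G (t, u) = w t \<and> (Q (t, u) = 0 \<longrightarrow> G (t, u) = 0) \<and> cone_metric l (Q (t, u)) (G (t, u)) \<le> (?L u)\<^sup>2"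
        by blast
      show "AE t in U01. (Q (t, u) = 0 \<longrightarrow> G (t, u) = 0) \<and> cone_metric l (Q (t, u)) (G (t, u)) \<le> (?L u)\<^sup>2"
        by (rule AE_U01_negligible[OF N(1)]) (use N(2) in blast)
    qed
    fix t u :: real assume t: "t \<in> {0..1}" and u: "u \<in> {0..1}"
    from slice[OF u] obtain w N where N: "negligible N" "\<forall>t\<in>{0..1}. (w has_integral (Q (t, u) - q0 u)) {0..t}"
        "\<forall>t\<in>{0..1} - N. G (t, u) = w t" by blast
    show "((\<lambda>s. G (s, u)) has_integral (Q (t, u) - q0 u)) {0..t}"
      by (rule has_integral_spike[OF N(1), of _ _ w]) (use N t in auto)
  qed (rule Q01(2))
qed

lemma bounded_linear_swap: "bounded_linear (\<lambda>x. (snd x, fst x))"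
  by (intro bounded_linear_Pair bounded_linear_fst bounded_linear_snd)

lemma swap_unit_square: "(\<lambda>x. (snd x, fst x) + 0) ` unit_square \<subseteq> unit_square"
  by auto

text \<open>Swapping the coordinates reduces time integrals to the parameter integrals treated
  before; the full integral is the value at the end time 1.\<close>

lemma smooth_on_integral_fst:
  fixes P :: "real \<times> real \<Rightarrow> 'b::euclidean_space"
  assumes "smooth_on unit_square P"
  shows "smooth_on unit_square (\<lambda>x. integral {0..fst x} (\<lambda>s. P (s, snd x)))"
    and "smooth_on unit_square (\<lambda>x. integral {0..1} (\<lambda>s. P (s, snd x)))"
proof -
  have "smooth_on unit_square (\<lambda>x. P (snd x, fst x))"
    using smooth_on_compose_affine[OF bounded_linear_swap swap_unit_square assms] by simp
  then have J: "smooth_on unit_square (\<lambda>x. integral {0..snd x} (\<lambda>s. P (s, fst x)))"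
    using smooth_on_integral_upto[of "\<lambda>x. P (snd x, fst x)"] by simp
  show "smooth_on unit_square (\<lambda>x. integral {0..fst x} (\<lambda>s. P (s, snd x)))"
    using smooth_on_compose_affine[OF bounded_linear_swap swap_unit_square J] by simp
  have "bounded_linear (\<lambda>x :: real \<times> real. (snd x, 0 :: real))"
    by (intro bounded_linear_Pair bounded_linear_snd bounded_linear_zero)
  moreover have "(\<lambda>x. (snd x, 0) + (0, 1)) ` unit_square \<subseteq> unit_square" by auto
  ultimately show "smooth_on unit_square (\<lambda>x. integral {0..1} (\<lambda>s. P (s, snd x)))"
    using smooth_on_compose_affine[OF _ _ J, of "\<lambda>x. (snd x, 0)" "(0, 1)" unit_square] by simp
qed

lemma AE_lborel_U01: "(AE x in lborel. P x) \<Longrightarrow> AE x in U01. P x"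
  by (subst AE_restrict_space_iff) (auto dest!: AE_completion elim!: eventually_mono)

text \<open>A Lebesgue null set of the plane is first enlarged to a Borel null set, to which Fubini
  and the exchange of the variables apply.\<close>

lemma AE_U01_negligible_pair:
  fixes N :: "(real \<times> real) set"
  assumes "negligible N"
  shows "AE u in U01. AE t in U01. (t, u) \<notin> N"
proof -
  have "N \<in> null_sets (completion lborel)" using assms by (simp add: negligible_iff_null_sets)
  then obtain N' where N': "N' \<in> null_sets lborel" "N \<subseteq> N'" by (auto simp: null_sets_completion_iff2)
  have "AE x in lborel \<Otimes>\<^sub>M lborel. x \<notin> N'"
    unfolding lborel_prod by (rule AE_not_in[OF N'(1)])
  from pair_sigma_finite.AE_pair[OF pair_sigma_finite.intro[OF sigma_finite_lborel sigma_finite_lborel] this] have "AE t in lborel. AE u in lborel. (t, u) \<notin> N'" by simp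
  then have "AE t in U01. AE u in U01. (t, u) \<notin> N'"
    by (intro AE_lborel_U01) (auto elim!: eventually_mono intro: AE_lborel_U01)
  moreover have "{x. x \<notin> N'} \<in> sets borel"
    using N'(1) by (metis Compl_eq borel_comp null_setsD2 sets_lborel)
  ultimately have "AE u in U01. AE t in U01. (t, u) \<notin> N'" by (subst (asm) AE_U01_commute)
  then show ?thesis using N'(2) by (auto elim!: eventually_mono)
qed

lemma integral_upto_U01:
  fixes f :: "real \<Rightarrow> 'a::euclidean_space"
  assumes "integrable U01 f" "t \<in> {0..1}"
  shows "integral {0..t} f = (\<integral>s. indicator {0..t} s *\<^sub>R f s \<partial>U01)"
proof -
  have "{0..t} \<in> sets U01" using assms(2) by (subst sets_restrict_space_iff) auto
  then have "integrable U01 (\<lambda>s. indicator {0..t} s *\<^sub>R f s)"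
    by (rule integrable_mult_indicator[OF _ assms(1)])
  then have "(\<integral>s. indicator {0..t} s *\<^sub>R f s \<partial>U01) = integral {0..1} (\<lambda>s. indicator {0..t} s *\<^sub>R f s)"
    by (rule integral_U01)
  also have "\<dots> = integral {0..1} (\<lambda>s. if s \<in> {0..t} then f s else 0)"
    by (intro integral_cong) auto
  also have "\<dots> = integral {0..t} f"
    using assms(2) integral_restrict_Int[of "{0..1}" "{0..t}" f] by (simp add: Int_absorb2 Int_absorb1)
  finally show ?thesis by simp
qed

text \<open>Dividing by the bump \<open>t * (1 - t)\<close>, the shifted map vanishes exactly when
  \<open>v\<close> is a value of a map that is smooth for interior times. Its domain has dimension
  2, so from dimension 3 on its image is null.\<close>

lemma generic_shift:
  fixes B :: "real \<times> real \<Rightarrow> 'a::euclidean_space"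
  assumes B: "smooth_on unit_square B" and dim: "DIM('a) \<ge> 3" and "e > 0"
  obtains v where "norm v < e" "\<And>t u. t \<in> {0<..<1} \<Longrightarrow> u \<in> {0..1} \<Longrightarrow> B (t, u) + (t * (1 - t)) *\<^sub>R v \<noteq> 0"
proof -
  let ?S = "{0<..<1} \<times> {0..1} :: (real \<times> real) set"
  have pos: "fst x * (1 - fst x) > 0" if "x \<in> ?S" for x using that by auto
  have f: "smooth_on ?S (\<lambda>x. fst x)" by (rule smooth_on_linear[OF bounded_linear_fst])
  have "smooth_on ?S (\<lambda>x. fst x * (1 - fst x))"
    by (rule smooth_on_mult[OF f smooth_on_diff[OF smooth_on_const f]])
  from smooth_on_powr[OF pos this, of "-1"]
  have "smooth_on ?S (\<lambda>x. - ((fst x * (1 - fst x)) powr (- 1)) *\<^sub>R B x)"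
    by (intro smooth_on_scaleR smooth_on_minus smooth_on_subset[OF B]) auto
  then have "(\<lambda>x. - ((fst x * (1 - fst x)) powr (- 1)) *\<^sub>R B x) differentiable_on ?S"
    by (rule smooth_on_differentiable)
  then have neg: "negligible ((\<lambda>x. - ((fst x * (1 - fst x)) powr (- 1)) *\<^sub>R B x) ` ?S)"
    using dim by (intro negligible_differentiable_image_lowdim) auto
  obtain v where v: "norm v < e" "v \<notin> (\<lambda>x. - ((fst x * (1 - fst x)) powr (- 1)) *\<^sub>R B x) ` ?S"
    by (rule exists_small_notin_negligible[OF neg \<open>e > 0\<close>], rule that)
  show ?thesis
  proof (rule that[OF v(1)])
    fix t u :: real assume t: "t \<in> {0<..<1}" and u: "u \<in> {0..1}"
    show "B (t, u) + (t * (1 - t)) *\<^sub>R v \<noteq> 0"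
    proof
      assume "B (t, u) + (t * (1 - t)) *\<^sub>R v = 0"
      then have "B (t, u) = - ((t * (1 - t)) *\<^sub>R v)" by (simp add: eq_neg_iff_add_eq_0)
      moreover have "(t * (1 - t)) powr (- 1) * (t * (1 - t)) = 1"
        using t by (simp add: powr_minus_divide)
      ultimately have "v = - ((t * (1 - t)) powr (- 1)) *\<^sub>R B (t, u)" by simp
      then show False using v(2) t u by (force simp: image_iff)
    qed
  qed
qed

text \<open>The pointwise geodesics are only measurable in the curve parameter. Replacing their velocity
  field by bounded polynomials and correcting the end points linearly gives smooth paths whose
  lengths converge.\<close>

lemma approximating_path:
  fixes q0 q1 :: "real \<Rightarrow> 'a::euclidean_space" and P :: "real \<times> real \<Rightarrow> 'a"
  assumes s0: "smooth_on {0..1} q0" and s1: "smooth_on {0..1} q1" and P: "smooth_on unit_square P"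
    and "e > 0"
  defines "C \<equiv> \<lambda>u. q1 u - q0 u - integral {0..1} (\<lambda>s. P (s, u))"
  obtains v where "norm v < e"
    "smooth_on unit_square (\<lambda>(t, u). q0 u + integral {0..t} (\<lambda>s. P (s, u)) + t *\<^sub>R C u + (t * (1 - t)) *\<^sub>R v)"
    "continuous_on unit_square (\<lambda>(t, u). P (t, u) + C u + (1 - 2 * t) *\<^sub>R v)"
    "\<And>t u. t \<in> {0..1} \<Longrightarrow> u \<in> {0..1} \<Longrightarrow>
      ((\<lambda>t. q0 u + integral {0..t} (\<lambda>s. P (s, u)) + t *\<^sub>R C u + (t * (1 - t)) *\<^sub>R v)
        has_vector_derivative P (t, u) + C u + (1 - 2 * t) *\<^sub>R v) (at t within {0..1})"
    "\<And>t u. DIM('a) \<ge> 3 \<Longrightarrow> (\<And>u. u \<in> {0..1} \<Longrightarrow> q0 u \<noteq> 0 \<and> q1 u \<noteq> 0) \<Longrightarrow> t \<in> {0..1} \<Longrightarrow> u \<in> {0..1} \<Longrightarrow>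
      q0 u + integral {0..t} (\<lambda>s. P (s, u)) + t *\<^sub>R C u + (t * (1 - t)) *\<^sub>R v \<noteq> 0"
proof -
  have sub: "snd ` unit_square \<subseteq> {0..1}" by auto
  have q0s: "smooth_on unit_square (\<lambda>x. q0 (snd x))" and q1s: "smooth_on unit_square (\<lambda>x. q1 (snd x))"
    by (rule smooth_on_compose_linear[OF bounded_linear_snd sub s0],
        rule smooth_on_compose_linear[OF bounded_linear_snd sub s1])
  have Cs: "smooth_on unit_square (\<lambda>x. C (snd x))"
    unfolding C_def by (rule smooth_on_diff[OF smooth_on_diff[OF q1s q0s] smooth_on_integral_fst(2)[OF P]])
  have fs: "smooth_on unit_square (\<lambda>x. fst x)" by (rule smooth_on_linear[OF bounded_linear_fst])
  define B where "B = (\<lambda>x. q0 (snd x) + integral {0..fst x} (\<lambda>s. P (s, snd x)) + fst x *\<^sub>R C (snd x))"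
  have Bs: "smooth_on unit_square B"
    unfolding B_def
    by (rule smooth_on_add[OF smooth_on_add[OF q0s smooth_on_integral_fst(1)[OF P]] smooth_on_scaleR[OF fs Cs]])
  have "\<exists>v. norm v < e \<and> (DIM('a) \<ge> 3 \<longrightarrow> (\<forall>t\<in>{0<..<1}. \<forall>u\<in>{0..1}. B (t, u) + (t * (1 - t)) *\<^sub>R v \<noteq> 0))"
  proof (cases "DIM('a) \<ge> 3")
    case True
    then show ?thesis using generic_shift[OF Bs True \<open>e > 0\<close>] by metis
  next
    \<comment> \<open>Below dimension 3 nothing is claimed about avoiding the origin, so no shift is
      made.\<close>
    case False
    then show ?thesis using \<open>e > 0\<close> by (intro exI[of _ 0]) auto
  qed
  then obtain v where v: "norm v < e"
    "\<And>t u. DIM('a) \<ge> 3 \<Longrightarrow> t \<in> {0<..<1} \<Longrightarrow> u \<in> {0..1} \<Longrightarrow> B (t, u) + (t * (1 - t)) *\<^sub>R v \<noteq> 0" by blast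
  have cP: "continuous_on unit_square P" by (rule smooth_on_continuous[OF P])
  have Pint: "continuous_on {0..1} (\<lambda>s. P (s, u))" if "u \<in> {0..1}" for u
    by (rule continuous_on_compose2[OF cP]) (use that in \<open>auto intro!: continuous_intros\<close>)
  show ?thesis
  proof (rule that[OF v(1)])
    have "smooth_on unit_square (\<lambda>x. B x + (fst x * (1 - fst x)) *\<^sub>R v)"
      by (rule smooth_on_add[OF Bs smooth_on_scaleR[OF smooth_on_mult[OF fs smooth_on_diff[OF smooth_on_const fs]] smooth_on_const]])
    then show "smooth_on unit_square (\<lambda>(t, u). q0 u + integral {0..t} (\<lambda>s. P (s, u)) + t *\<^sub>R C u + (t * (1 - t)) *\<^sub>R v)"
      by (simp add: B_def split_def)
    have "continuous_on unit_square (\<lambda>x. P x + C (snd x) + (1 - 2 * fst x) *\<^sub>R v)"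
      by (intro continuous_intros cP smooth_on_continuous[OF Cs])
    then show "continuous_on unit_square (\<lambda>(t, u). P (t, u) + C u + (1 - 2 * t) *\<^sub>R v)"
      by (simp add: split_def)
  next
    fix t u :: real assume t: "t \<in> {0..1}" and u: "u \<in> {0..1}"
    show "((\<lambda>t. q0 u + integral {0..t} (\<lambda>s. P (s, u)) + t *\<^sub>R C u + (t * (1 - t)) *\<^sub>R v)
        has_vector_derivative P (t, u) + C u + (1 - 2 * t) *\<^sub>R v) (at t within {0..1})"
      by (rule has_vector_derivative_eq_rhs,
          (rule derivative_intros integral_has_vector_derivative[OF Pint[OF u] t])+)
        (auto simp: algebra_simps)
  next
    fix t u :: real
    assume d: "DIM('a) \<ge> 3" and ne: "\<And>u. u \<in> {0..1} \<Longrightarrow> q0 u \<noteq> 0 \<and> q1 u \<noteq> 0"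
      and t: "t \<in> {0..1}" and u: "u \<in> {0..1}"
    \<comment> \<open>At the end times the bump is 0 and the correction by \<open>C\<close> gives
      exactly \<open>q0\<close> and \<open>q1\<close>; only interior times depend on the choice of
      \<open>v\<close>.\<close>
    consider "t = 0" | "t = 1" | "t \<in> {0<..<1}" using t by fastforce
    then show "q0 u + integral {0..t} (\<lambda>s. P (s, u)) + t *\<^sub>R C u + (t * (1 - t)) *\<^sub>R v \<noteq> 0"
    proof cases
      case 3
      then show ?thesis using v(2)[OF d 3 u] by (simp add: B_def)
    qed (use ne[OF u] in \<open>simp_all add: C_def\<close>)
  qed
qed

text \<open>Bounded almost everywhere convergence of the velocities gives convergence of the paths
  for almost every parameter. Two further dominated limits, in the parameter and then in time, carry
  this over to the lengths, whose limit is at most the distance because the geodesics have constant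
  speed.\<close>

theorem exists_short_path:
  fixes q0 q1 :: "real \<Rightarrow> 'a::euclidean_space"
  assumes l: "l > 0" and dim: "DIM('a) \<ge> 2"
    and s0: "smooth_on {0..1} q0" and s1: "smooth_on {0..1} q1" and "e > 0"
  obtains q p where "smooth_on unit_square q" "continuous_on unit_square p"
    "\<And>t u. t \<in> {0..1} \<Longrightarrow> u \<in> {0..1} \<Longrightarrow>
       ((\<lambda>t. q (t, u)) has_vector_derivative p (t, u)) (at t within {0..1})"
    "\<And>u. u \<in> {0..1} \<Longrightarrow> q (0, u) = q0 u" "\<And>u. u \<in> {0..1} \<Longrightarrow> q (1, u) = q1 u"
    "\<And>x. DIM('a) \<ge> 3 \<Longrightarrow> \<forall>u\<in>{0..1}. q0 u \<noteq> 0 \<and> q1 u \<noteq> 0 \<Longrightarrow> x \<in> unit_square \<Longrightarrow> q x \<noteq> 0"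
    "(\<integral>t. sqrt (\<integral>u. cone_metric l (q (t, u)) (p (t, u)) \<partial>U01) \<partial>U01) \<le> cone_dist_L2 l q0 q1 + e"
proof -
  define q0' q1' where "q0' = (\<lambda>u. q0 (clamp01 u))" "q1' = (\<lambda>u. q1 (clamp01 u))"
  have c: "continuous_on UNIV q0'" "continuous_on UNIV q1'"
    unfolding q0'_q1'_def
    by (auto intro!: continuous_on_compose2[OF smooth_on_continuous[OF s0]]
        continuous_on_compose2[OF smooth_on_continuous[OF s1]] continuous_intros)
  have q': "q0' u = q0 u" "q1' u = q1 u" if "u \<in> {0..1}" for u using that by (simp_all add: q0'_q1'_def)
  obtain Q G K where QG: "Q \<in> borel_measurable borel" "G \<in> borel_measurable borel" "K > 0" "\<And>x. norm (G x) \<le> K"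
    and AEQ: "AE u in U01. AE t in U01. (Q (t, u) = 0 \<longrightarrow> G (t, u) = 0) \<and>
       cone_metric l (Q (t, u)) (G (t, u)) \<le> (cone_dist l (q0' u) (q1' u))\<^sup>2"
    and GQ: "\<And>t u. t \<in> {0..1} \<Longrightarrow> u \<in> {0..1} \<Longrightarrow> ((\<lambda>s. G (s, u)) has_integral (Q (t, u) - q0' u)) {0..t}"
    and Q1: "\<And>u. Q (1, u) = q1' u"
    by (rule geodesic_field[OF l dim c], rule that)
  note [measurable] = QG(1,2)
  have "compact unit_square" by (intro compact_Times compact_Icc)
  moreover have "G \<in> borel_measurable (lebesgue_on unit_square)"
    by (intro measurable_restrict_space1 measurable_completion) simp
  ultimately obtain P N where P: "negligible N" "\<And>n::nat. polynomial_function (P n)"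
    "\<And>n x. x \<in> unit_square \<Longrightarrow> norm (P n x) \<le> K + 1" "\<And>x. x \<in> unit_square - N \<Longrightarrow> (\<lambda>n. P n x) \<longlonglongrightarrow> G x"
    using polynomial_approx_AE[of unit_square G K] QG(3,4) by metis
  have Ps: "smooth_on unit_square (P n)" for n by (rule smooth_on_polynomial_function[OF P(2)])
  define C where "C = (\<lambda>n u. q1 u - q0 u - integral {0..1} (\<lambda>s. P n (s, u)))"
  have "\<forall>n. \<exists>v. norm v < inverse (real (Suc n)) \<and>
    smooth_on unit_square (\<lambda>(t, u). q0 u + integral {0..t} (\<lambda>s. P n (s, u)) + t *\<^sub>R C n u + (t * (1 - t)) *\<^sub>R v) \<and>
    continuous_on unit_square (\<lambda>(t, u). P n (t, u) + C n u + (1 - 2 * t) *\<^sub>R v) \<and>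
    (\<forall>t\<in>{0..1}. \<forall>u\<in>{0..1}.
      ((\<lambda>t. q0 u + integral {0..t} (\<lambda>s. P n (s, u)) + t *\<^sub>R C n u + (t * (1 - t)) *\<^sub>R v)
        has_vector_derivative P n (t, u) + C n u + (1 - 2 * t) *\<^sub>R v) (at t within {0..1})) \<and>
    (DIM('a) \<ge> 3 \<longrightarrow> (\<forall>u\<in>{0..1}. q0 u \<noteq> 0 \<and> q1 u \<noteq> 0) \<longrightarrow> (\<forall>t\<in>{0..1}. \<forall>u\<in>{0..1}.
      q0 u + integral {0..t} (\<lambda>s. P n (s, u)) + t *\<^sub>R C n u + (t * (1 - t)) *\<^sub>R v \<noteq> 0))" (is "\<forall>n. ?P n")
  proof
    fix n
    have pos: "inverse (real (Suc n)) > 0" by simp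
    show "?P n"
      unfolding C_def
      by (rule approximating_path[OF s0 s1 Ps pos, of n], rule exI) (intro conjI ballI impI; blast)
  qed
  from choice[OF this] obtain v where v: "\<And>n. norm (v n) < inverse (real (Suc n))"
    and sm: "\<And>n. smooth_on unit_square (\<lambda>(t, u). q0 u + integral {0..t} (\<lambda>s. P n (s, u)) + t *\<^sub>R C n u + (t * (1 - t)) *\<^sub>R v n)"
    and cp: "\<And>n. continuous_on unit_square (\<lambda>(t, u). P n (t, u) + C n u + (1 - 2 * t) *\<^sub>R v n)"
    and der: "\<And>n t u. t \<in> {0..1} \<Longrightarrow> u \<in> {0..1} \<Longrightarrow>
      ((\<lambda>t. q0 u + integral {0..t} (\<lambda>s. P n (s, u)) + t *\<^sub>R C n u + (t * (1 - t)) *\<^sub>R v n)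
        has_vector_derivative P n (t, u) + C n u + (1 - 2 * t) *\<^sub>R v n) (at t within {0..1})"
    and ne: "\<And>n t u. DIM('a) \<ge> 3 \<Longrightarrow> (\<forall>u\<in>{0..1}. q0 u \<noteq> 0 \<and> q1 u \<noteq> 0) \<Longrightarrow> t \<in> {0..1} \<Longrightarrow> u \<in> {0..1} \<Longrightarrow>
      q0 u + integral {0..t} (\<lambda>s. P n (s, u)) + t *\<^sub>R C n u + (t * (1 - t)) *\<^sub>R v n \<noteq> 0"
    by blast
  define q where "q = (\<lambda>n (t, u). q0 u + integral {0..t} (\<lambda>s. P n (s, u)) + t *\<^sub>R C n u + (t * (1 - t)) *\<^sub>R v n)"
  define p where "p = (\<lambda>n (t, u). P n (t, u) + C n u + (1 - 2 * t) *\<^sub>R v n)"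
  have qs: "smooth_on unit_square (q n)" and pc: "continuous_on unit_square (p n)" for n
    using sm[of n] cp[of n] by (simp_all add: q_def p_def)
  \<comment> \<open>The approximating maps are only known on the unit square; clamping both
    coordinates gives Borel maps of the plane.\<close>
  define cl where "cl = (\<lambda>x. (clamp01 (fst x), clamp01 (snd x)))"
  have cl: "cl x = x" if "x \<in> unit_square" for x using that by (auto simp: cl_def)
  have clc: "continuous_on UNIV cl" "cl ` UNIV \<subseteq> unit_square"
    unfolding cl_def by (auto intro!: continuous_intros)
  define g where "g = (\<lambda>n x. cone_metric l (q n (cl x)) (p n (cl x)))"
  have [measurable]: "(\<lambda>x. q n (cl x)) \<in> borel_measurable borel" for n
    by (rule borel_measurable_continuous_onI[OF continuous_on_compose2[OF smooth_on_continuous[OF qs] clc]])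
  have [measurable]: "(\<lambda>x. p n (cl x)) \<in> borel_measurable borel" for n
    by (rule borel_measurable_continuous_onI[OF continuous_on_compose2[OF pc clc]])
  have gm: "g n \<in> borel_measurable borel" for n unfolding g_def by measurable
  have g: "g n (t, u) = cone_metric l (q n (t, u)) (p n (t, u))" if "t \<in> {0..1}" "u \<in> {0..1}" for n t u
    using that cl[of "(t, u)"] by (simp add: g_def)
  \<comment> \<open>The uniform velocity bound supplies the dominating constants for both limits of
    the lengths.\<close>
  obtain R where R: "R \<ge> 0" "\<And>n x. x \<in> unit_square \<Longrightarrow> norm (p n x) \<le> R"
  proof -
    obtain B0 where B0: "\<And>u. u \<in> {0..1} \<Longrightarrow> norm (q0 u) \<le> B0"
      using continuous_on_U01_bounded[OF smooth_on_continuous[OF s0]] by blast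
    obtain B1 where B1: "\<And>u. u \<in> {0..1} \<Longrightarrow> norm (q1 u) \<le> B1"
      using continuous_on_U01_bounded[OF smooth_on_continuous[OF s1]] by blast
    have b: "norm (p n (t, u)) \<le> (K + 1) + (B1 + B0 + (K + 1)) + 1" if t: "t \<in> {0..1}" and u: "u \<in> {0..1}" for n t u
    proof -
      have "continuous_on {0..1} (\<lambda>s. P n (s, u))"
        by (rule continuous_on_compose2[OF smooth_on_continuous[OF Ps]]) (use u in \<open>auto intro!: continuous_intros\<close>)
      then have I: "norm (integral {0..1} (\<lambda>s. P n (s, u))) \<le> K + 1"
        using integral_bound[of 0 1 "\<lambda>s. P n (s, u)" "K + 1"] P(3) u by auto
      have "norm (v n) \<le> 1" using v[of n] inverse_le_1_iff[of "real (Suc n)"] by simp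
      moreover have "\<bar>1 - 2 * t\<bar> \<le> 1" using t by (auto simp: abs_le_iff)
      ultimately have V: "norm ((1 - 2 * t) *\<^sub>R v n) \<le> 1" by (simp add: mult_le_one)
      have C: "norm (C n u) \<le> B1 + B0 + (K + 1)"
        unfolding C_def using norm_triangle_ineq4[of "q1 u - q0 u" "integral {0..1} (\<lambda>s. P n (s, u))"]
          norm_triangle_ineq4[of "q1 u" "q0 u"] B0[OF u] B1[OF u] I by linarith
      have "norm (P n (t, u)) \<le> K + 1" using P(3)[of "(t, u)"] t u by simp
      then show ?thesis
        unfolding p_def using V C norm_triangle_ineq[of "P n (t, u) + C n u" "(1 - 2 * t) *\<^sub>R v n"]
          norm_triangle_ineq[of "P n (t, u)" "C n u"] by simp
    qed
    have "0 \<le> (K + 1) + (B1 + B0 + (K + 1)) + 1" using order_trans[OF norm_ge_zero b[of 0 0]] by simp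
    then show thesis by (rule that) (use b in auto)
  qed
  have gB: "0 \<le> g n (t, u) \<and> g n (t, u) \<le> (l\<^sup>2 + 1) * R\<^sup>2" for n t u
  proof -
    have "cl (t, u) \<in> unit_square" using clc(2) by blast
    from power_mono[OF R(2)[OF this] norm_ge_zero, of n 2]
    have "(l\<^sup>2 + 1) * (norm (p n (cl (t, u))))\<^sup>2 \<le> (l\<^sup>2 + 1) * R\<^sup>2" by (intro mult_left_mono) auto
    then show ?thesis
      using cone_metric_le[of l "q n (cl (t, u))" "p n (cl (t, u))"] by (simp add: g_def cone_metric_nonneg)
  qed
  have "AE u in U01. AE t in U01. (\<lambda>n. g n (t, u)) \<longlonglongrightarrow> cone_metric l (Q (t, u)) (G (t, u)) \<and>
       cone_metric l (Q (t, u)) (G (t, u)) \<le> (cone_dist l (q0' u) (q1' u))\<^sup>2"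
  proof -
    have "AE u in U01. u \<in> {0..1}" by (rule AE_I2) simp
    with AEQ AE_U01_negligible_pair[OF P(1)] show ?thesis
    proof eventually_elim
      case (elim u)
      then have u: "u \<in> {0..1}" by blast
      have Pm: "(\<lambda>s. P n (s, u)) \<in> borel_measurable U01" for n
        by (rule borel_continuous_U01, rule continuous_on_compose2[OF smooth_on_continuous[OF Ps]])
          (use u in \<open>auto intro!: continuous_intros\<close>)
      have Pi: "integrable U01 (\<lambda>s. P n (s, u))" for n
        by (rule integrable_U01_bounded[OF Pm, of _ "K + 1"]) (use P(3) u in auto)
      have Gi: "integrable U01 (\<lambda>s. G (s, u))"
        by (rule integrable_U01_bounded[OF measurable_U01_slice(2)[OF QG(2)] QG(4)])
      have AEt: "AE t in U01. t \<in> {0..1}" by (rule AE_I2) simp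
      have PG: "AE t in U01. (\<lambda>n. P n (t, u)) \<longlonglongrightarrow> G (t, u)"
        using elim(2) AEt by eventually_elim (use P(4) u in auto)
      \<comment> \<open>Convergence of the velocities at almost every time integrates to convergence
        of the paths at every time.\<close>
      have I: "(\<lambda>n. integral {0..t} (\<lambda>s. P n (s, u))) \<longlonglongrightarrow> Q (t, u) - q0' u" if t: "t \<in> {0..1}" for t
      proof -
        have "(\<lambda>n. \<integral>s. indicator {0..t} s *\<^sub>R P n (s, u) \<partial>U01) \<longlonglongrightarrow> (\<integral>s. indicator {0..t} s *\<^sub>R G (s, u) \<partial>U01)"
        proof (rule integral_dominated_convergence[where w = "\<lambda>u. K + 1"])
          have i: "(\<lambda>s. indicator {0..t} s :: real) \<in> borel_measurable U01"
            by (rule measurable_U01_borel) measurable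
          show "(\<lambda>s. indicator {0..t} s *\<^sub>R P n (s, u)) \<in> borel_measurable U01" for n
            by (rule borel_measurable_scaleR[OF i Pm])
          show "(\<lambda>s. indicator {0..t} s *\<^sub>R G (s, u)) \<in> borel_measurable U01"
            by (rule borel_measurable_scaleR[OF i measurable_U01_slice(2)[OF QG(2)]])
          show "AE s in U01. (\<lambda>n. indicator {0..t} s *\<^sub>R P n (s, u)) \<longlonglongrightarrow> indicator {0..t} s *\<^sub>R G (s, u)"
            using PG by eventually_elim (rule tendsto_scaleR[OF tendsto_const])
          show "AE s in U01. norm (indicator {0..t} s *\<^sub>R P n (s, u)) \<le> K + 1" for n
            using AEt by eventually_elim (use P(3) u QG(3) in \<open>auto simp: indicator_def\<close>)
        qed simp
        then have "(\<lambda>n. integral {0..t} (\<lambda>s. P n (s, u))) \<longlonglongrightarrow> integral {0..t} (\<lambda>s. G (s, u))"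
          using integral_upto_U01[OF Pi t] integral_upto_U01[OF Gi t] by simp
        then show ?thesis using integral_unique[OF GQ[OF t u]] by simp
      qed
      have "(\<lambda>n. q1 u - q0 u - integral {0..1} (\<lambda>s. P n (s, u))) \<longlonglongrightarrow> q1 u - q0 u - (Q (1, u) - q0' u)"
        by (intro tendsto_diff tendsto_const I) simp
      \<comment> \<open>The full time integral of \<open>G\<close> is \<open>q1 u - q0 u\<close>, so
        the end point defect disappears in the limit.\<close>
      then have C: "(\<lambda>n. C n u) \<longlonglongrightarrow> 0" using q'[OF u] by (simp add: C_def Q1)
      have v0: "v \<longlonglongrightarrow> 0"
        by (rule Lim_null_comparison[OF always_eventually[OF allI[OF less_imp_le[OF v]]] LIMSEQ_inverse_real_of_nat])
      show ?case
        using elim(1) PG AEt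
      proof eventually_elim
        case (elim t)
        have "(\<lambda>n. q0 u + integral {0..t} (\<lambda>s. P n (s, u)) + t *\<^sub>R C n u + (t * (1 - t)) *\<^sub>R v n) \<longlonglongrightarrow>
            q0 u + (Q (t, u) - q0' u) + t *\<^sub>R 0 + (t * (1 - t)) *\<^sub>R 0"
          by (intro tendsto_add tendsto_const tendsto_scaleR I elim C v0)
        then have ql: "(\<lambda>n. q n (t, u)) \<longlonglongrightarrow> Q (t, u)" using q'[OF u] by (simp add: q_def)
        have "(\<lambda>n. P n (t, u) + C n u + (1 - 2 * t) *\<^sub>R v n) \<longlonglongrightarrow> G (t, u) + 0 + (1 - 2 * t) *\<^sub>R 0"
          by (intro tendsto_add tendsto_const tendsto_scaleR elim C v0)
        then have pl: "(\<lambda>n. p n (t, u)) \<longlonglongrightarrow> G (t, u)" by (simp add: p_def)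
        show ?case using tendsto_cone_metric[OF ql pl] elim u by (simp add: g)
      qed
    qed
  qed
  \<comment> \<open>The convergence set must be Borel before parameter and time are exchanged: so
    far it has full measure in time for almost every parameter, and the lengths need the opposite
    order.\<close>
  moreover have "{x. (\<lambda>n. g n x) \<longlonglongrightarrow> cone_metric l (Q x) (G x) \<and>
       cone_metric l (Q x) (G x) \<le> (cone_dist l (q0' (snd x)) (q1' (snd x)))\<^sup>2} \<in> sets borel"
  proof -
    have [measurable]: "g n \<in> borel_measurable borel" for n by (rule gm)
    have [measurable]: "q0' \<in> borel_measurable borel" "q1' \<in> borel_measurable borel"
      using c by (auto intro: borel_measurable_continuous_onI)
    have [measurable]: "snd \<in> borel_measurable (borel :: (real \<times> real) measure)"
      by (auto intro!: borel_measurable_continuous_onI continuous_intros)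
    have [measurable]: "(\<lambda>x. cone_dist l (q0' (snd x)) (q1' (snd x))) \<in> borel_measurable (borel :: (real \<times> real) measure)"
      by (intro borel_measurable_cone_dist l) measurable
    show ?thesis by measurable
  qed
  ultimately have AE: "AE t in U01. AE u in U01. (\<lambda>n. g n (t, u)) \<longlonglongrightarrow> cone_metric l (Q (t, u)) (G (t, u)) \<and>
       cone_metric l (Q (t, u)) (G (t, u)) \<le> (cone_dist l (q0' u) (q1' u))\<^sup>2"
    using AE_U01_commute[of "\<lambda>x. (\<lambda>n. g n x) \<longlonglongrightarrow> cone_metric l (Q x) (G x) \<and>
       cone_metric l (Q x) (G x) \<le> (cone_dist l (q0' (snd x)) (q1' (snd x)))\<^sup>2"] by simp
  define E where "E = (\<lambda>t. \<integral>u. cone_metric l (Q (t, u)) (G (t, u)) \<partial>U01)"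
  have gQm: "(\<lambda>x. cone_metric l (Q x) (G x)) \<in> borel_measurable borel" by measurable
  have sq: "square_integrable q0" "square_integrable q1"
    by (auto intro: square_integrable_continuous smooth_on_continuous s0 s1)
  have E0: "0 \<le> E t" for t unfolding E_def by (intro integral_nonneg_AE) (simp add: cone_metric_nonneg)
  have AE': "AE t in U01. (\<lambda>n. sqrt (\<integral>u. g n (t, u) \<partial>U01)) \<longlonglongrightarrow> sqrt (E t) \<and> sqrt (E t) \<le> cone_dist_L2 l q0 q1"
    using AE
  proof eventually_elim
    case (elim t)
    have "(\<lambda>n. \<integral>u. g n (t, u) \<partial>U01) \<longlonglongrightarrow> E t"
      unfolding E_def
    proof (rule integral_dominated_convergence[where w = "\<lambda>u. (l\<^sup>2 + 1) * R\<^sup>2"])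
      show "(\<lambda>u. cone_metric l (Q (t, u)) (G (t, u))) \<in> borel_measurable U01" by (rule measurable_U01_slice(1)[OF gQm])
      show "(\<lambda>u. g n (t, u)) \<in> borel_measurable U01" for n by (rule measurable_U01_slice(1)[OF gm])
      show "AE u in U01. norm (g n (t, u)) \<le> (l\<^sup>2 + 1) * R\<^sup>2" for n using gB by (intro AE_I2) auto
      show "AE u in U01. (\<lambda>n. g n (t, u)) \<longlonglongrightarrow> cone_metric l (Q (t, u)) (G (t, u))"
        using elim by eventually_elim blast
    qed simp
    note lim = tendsto_real_sqrt[OF this]
    have "E t \<le> (\<integral>u. (norm (cone_dist l (q0 u) (q1 u)))\<^sup>2 \<partial>U01)"
      unfolding E_def
    proof (rule integral_mono_AE)
      show int: "integrable U01 (\<lambda>u. (norm (cone_dist l (q0 u) (q1 u)))\<^sup>2)"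
        by (rule square_integrable_integrable[OF square_integrable_cone_dist[OF l sq]])
      have "AE u in U01. u \<in> {0..1}" by (rule AE_I2) simp
      with elim show le: "AE u in U01. cone_metric l (Q (t, u)) (G (t, u)) \<le> (norm (cone_dist l (q0 u) (q1 u)))\<^sup>2"
        by eventually_elim (simp add: q')
      show "integrable U01 (\<lambda>u. cone_metric l (Q (t, u)) (G (t, u)))"
        by (rule Bochner_Integration.integrable_bound[OF int measurable_U01_slice(1)[OF gQm]])
          (use le in eventually_elim, simp add: cone_metric_nonneg)
    qed
    then have "sqrt (E t) \<le> cone_dist_L2 l q0 q1" unfolding cone_dist_L2_def L2_norm_def by (rule real_sqrt_le_mono)
    with lim show ?case by blast
  qed
  have Em: "(\<lambda>t. sqrt (E t)) \<in> borel_measurable U01"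
    using borel_measurable_integral_U01[OF gQm] unfolding E_def by measurable
  have em: "(\<lambda>t. sqrt (\<integral>u. g n (t, u) \<partial>U01)) \<in> borel_measurable U01" for n
    using borel_measurable_integral_U01[OF gm[of n]] by measurable
  have eB: "0 \<le> (\<integral>u. g n (t, u) \<partial>U01) \<and> (\<integral>u. g n (t, u) \<partial>U01) \<le> (l\<^sup>2 + 1) * R\<^sup>2" for n t
  proof -
    have "integrable U01 (\<lambda>u. g n (t, u))"
      by (rule integrable_U01_bounded[OF measurable_U01_slice(1)[OF gm], where B = "(l\<^sup>2 + 1) * R\<^sup>2"])
        (use gB in auto)
    then have "(\<integral>u. g n (t, u) \<partial>U01) \<le> (\<integral>u. (l\<^sup>2 + 1) * R\<^sup>2 \<partial>U01)"
      by (intro integral_mono) (use gB in auto)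
    moreover have "0 \<le> (\<integral>u. g n (t, u) \<partial>U01)" using gB by (intro integral_nonneg_AE) auto
    ultimately show ?thesis by simp
  qed
  have "(\<lambda>n. \<integral>t. sqrt (\<integral>u. g n (t, u) \<partial>U01) \<partial>U01) \<longlonglongrightarrow> (\<integral>t. sqrt (E t) \<partial>U01)"
  proof (rule integral_dominated_convergence[OF Em em, where w = "\<lambda>t. sqrt ((l\<^sup>2 + 1) * R\<^sup>2)"])
    show "AE t in U01. (\<lambda>n. sqrt (\<integral>u. g n (t, u) \<partial>U01)) \<longlonglongrightarrow> sqrt (E t)"
      using AE' by eventually_elim blast
    show "AE t in U01. norm (sqrt (\<integral>u. g n (t, u) \<partial>U01)) \<le> sqrt ((l\<^sup>2 + 1) * R\<^sup>2)" for n
    proof (rule AE_I2)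
      fix t
      show "norm (sqrt (\<integral>u. g n (t, u) \<partial>U01)) \<le> sqrt ((l\<^sup>2 + 1) * R\<^sup>2)"
        using real_sqrt_le_mono[OF conjunct2[OF eB[of n t]]] real_sqrt_ge_zero[OF conjunct1[OF eB[of n t]]]
        by (simp only: real_norm_def abs_of_nonneg)
    qed
  qed simp
  moreover have "(\<integral>t. sqrt (E t) \<partial>U01) \<le> cone_dist_L2 l q0 q1"
  proof -
    have "integrable U01 (\<lambda>t. sqrt (E t))"
      by (rule U01.integrable_const_bound[OF _ Em, of "cone_dist_L2 l q0 q1"])
        (use AE' in eventually_elim, use E0 in simp)
    then have "(\<integral>t. sqrt (E t) \<partial>U01) \<le> (\<integral>t. cone_dist_L2 l q0 q1 \<partial>U01)"
      by (rule integral_mono_AE) (simp, use AE' in eventually_elim, blast)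
    then show ?thesis by simp
  qed
  ultimately have "\<forall>\<^sub>F n in sequentially. (\<integral>t. sqrt (\<integral>u. g n (t, u) \<partial>U01) \<partial>U01) < cone_dist_L2 l q0 q1 + e"
    using \<open>e > 0\<close> by (intro order_tendstoD(2)) auto
  then obtain n where n: "(\<integral>t. sqrt (\<integral>u. g n (t, u) \<partial>U01) \<partial>U01) < cone_dist_L2 l q0 q1 + e"
    by (auto simp: eventually_sequentially)
  have "(\<integral>t. sqrt (\<integral>u. cone_metric l (q n (t, u)) (p n (t, u)) \<partial>U01) \<partial>U01) = (\<integral>t. sqrt (\<integral>u. g n (t, u) \<partial>U01) \<partial>U01)"
    by (intro Bochner_Integration.integral_cong arg_cong[where f = sqrt]) (auto simp: g)
  with n have le: "(\<integral>t. sqrt (\<integral>u. cone_metric l (q n (t, u)) (p n (t, u)) \<partial>U01) \<partial>U01) \<le> cone_dist_L2 l q0 q1 + e" by simp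
  show ?thesis
  proof (rule that[of "q n" "p n", OF qs pc _ _ _ _ le])
    show "((\<lambda>t. q n (t, u)) has_vector_derivative p n (t, u)) (at t within {0..1})"
      if "t \<in> {0..1}" "u \<in> {0..1}" for t u
      using der[OF that, of n] by (simp add: q_def p_def)
    show "q n (0, u) = q0 u" "q n (1, u) = q1 u" if "u \<in> {0..1}" for u
      by (simp_all add: q_def C_def)
    show "q n x \<noteq> 0" if "DIM('a) \<ge> 3" "\<forall>u\<in>{0..1}. q0 u \<noteq> 0 \<and> q1 u \<noteq> 0" "x \<in> unit_square" for x
      using ne[OF that(1,2), of "fst x" "snd x" n] that(3) by (auto simp: q_def split_def)
  qed
qed

section \<open>The elastic metric and the completions\<close>

text \<open>The derivative of \<open>norm x *\<^sub>R x\<close> in direction \<open>v\<close>, also at \<open>x = 0\<close>.\<close>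

definition norm_scale_deriv :: "'a::real_inner \<Rightarrow> 'a \<Rightarrow> 'a" where
  "norm_scale_deriv x v = norm x *\<^sub>R v + (x \<bullet> v) *\<^sub>R sgn x"

lemma tendsto_norm_scale_deriv:
  fixes f g :: "'b \<Rightarrow> 'a::real_inner"
  assumes "(f \<longlongrightarrow> x) F" "(g \<longlongrightarrow> v) F"
  shows "((\<lambda>y. norm_scale_deriv (f y) (g y)) \<longlongrightarrow> norm_scale_deriv x v) F"
proof (cases "x = 0")
  case True
  have "((\<lambda>y. 2 * norm (f y) * norm (g y)) \<longlongrightarrow> 2 * norm x * norm v) F"
    by (intro tendsto_mult tendsto_const tendsto_norm assms)
  then have lim: "((\<lambda>y. 2 * norm (f y) * norm (g y)) \<longlongrightarrow> 0) F" using True by simp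
  \<comment> \<open>This bound replaces continuity of the direction, which fails at
    \<open>x = 0\<close>.\<close>
  have "norm (norm_scale_deriv x v) \<le> 2 * norm x * norm v" for x v :: 'a
  proof -
    have "norm ((x \<bullet> v) *\<^sub>R sgn x) \<le> norm x * norm v * 1"
      unfolding norm_scaleR using Cauchy_Schwarz_ineq2[of x v] by (intro mult_mono) (auto simp: norm_sgn)
    then show ?thesis using norm_triangle_ineq[of "norm x *\<^sub>R v" "(x \<bullet> v) *\<^sub>R sgn x"] by (simp add: norm_scale_deriv_def)
  qed
  then have "\<forall>\<^sub>F y in F. norm (norm_scale_deriv (f y) (g y)) \<le> 2 * norm (f y) * norm (g y)" by (intro always_eventually) blast
  from Lim_null_comparison[OF this lim] True show ?thesis by (simp add: norm_scale_deriv_def)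
next
  case False
  then show ?thesis unfolding norm_scale_deriv_def
    by (intro tendsto_add tendsto_scaleR tendsto_norm tendsto_inner tendsto_sgn assms)
qed

lemma continuous_on_norm_scale_deriv:
  "continuous_on S f \<Longrightarrow> continuous_on S g \<Longrightarrow> continuous_on S (\<lambda>x. norm_scale_deriv (f x) (g x))"
  unfolding continuous_on_def by (blast intro: tendsto_norm_scale_deriv)

text \<open>At a zero of \<open>f\<close> the norm is not differentiable, but the difference
  quotient of the product is \<open>norm (f s)\<close> times a convergent quotient and tends to
  0.\<close>

lemma has_vector_derivative_norm_scale:
  fixes f :: "real \<Rightarrow> 'a::euclidean_space"
  assumes f: "(f has_vector_derivative v) (at t within S)"
  shows "((\<lambda>t. norm (f t) *\<^sub>R f t) has_vector_derivative norm_scale_deriv (f t) v) (at t within S)"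
proof (cases "f t = 0")
  case True
  have cont: "(f \<longlongrightarrow> f t) (at t within S)"
    using has_vector_derivative_continuous[OF f] by (simp add: continuous_within)
  have "((\<lambda>s. norm (f s) * norm ((f s - f t) /\<^sub>R (s - t))) \<longlongrightarrow> norm (f t) * norm v) (at t within S)"
    by (intro tendsto_mult tendsto_norm cont has_vector_derivative_quotient_tendsto f)
  then have "((\<lambda>s. norm (norm (f s) *\<^sub>R f s) / norm (s - t)) \<longlongrightarrow> 0) (at t within S)"
    using True by (simp add: divide_inverse mult_ac)
  then show ?thesis
    using True unfolding has_vector_derivative_def has_derivative_iff_norm
    by (simp add: norm_scale_deriv_def bounded_linear_zero)
next
  case False
  have N: "((\<lambda>s. norm (f s)) has_vector_derivative v \<bullet> sgn (f t)) (at t within S)"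
    using has_derivative_compose[OF f[unfolded has_vector_derivative_def] has_derivative_norm[OF False]]
    by (simp add: has_vector_derivative_def)
  have "(v \<bullet> sgn (f t)) *\<^sub>R f t = (f t \<bullet> v) *\<^sub>R sgn (f t)"
    by (simp add: sgn_div_norm inner_commute)
  then show ?thesis
    using has_vector_derivative_scaleR[OF N[folded has_real_derivative_iff_has_vector_derivative] f]
    by (simp add: norm_scale_deriv_def)
qed

text \<open>Differentiating \<open>norm q *\<^sub>R q\<close> doubles the component of
  \<open>p\<close> along \<open>q\<close> and keeps the orthogonal one. The doubling turns
  \<open>b\<^sup>2\<close> into \<open>4 * b\<^sup>2\<close>; factoring this out leaves
  \<open>a\<^sup>2 / (4 * b\<^sup>2)\<close> for the orthogonal part, whence the scaling
  \<open>a / (2 * b)\<close>. The powers of \<open>n\<close> cancel against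
  \<open>norm (vel c u)\<close>.\<close>

lemma elastic_integrand:
  fixes c h :: "real \<Rightarrow> real ^ 'd::finite"
  assumes ab: "a > 0" "b > 0" and h: "vel h u = norm_scale_deriv (srv c u) p"
  shows "(a\<^sup>2 * (arc_deriv_bot c h u \<bullet> arc_deriv_bot c h u)
         + b\<^sup>2 * (arc_deriv_top c h u \<bullet> arc_deriv_top c h u)) * norm (vel c u)
     = 4 * b\<^sup>2 * cone_metric (a / (2 * b)) (srv c u) p"
proof (cases "srv c u = 0")
  case True
  then have "vel c u = 0" by simp
  then show ?thesis by (simp add: cone_metric_def)
next
  case False
  define q where "q = srv c u"
  define n where "n = norm q"
  define s where "s = sgn q"
  define x where "x = p \<bullet> s"
  have n: "n > 0" using False by (simp add: n_def q_def)
  have ss: "s \<bullet> s = 1" using n by (simp add: s_def n_def dot_square_norm norm_sgn)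
  have q: "q = n *\<^sub>R s" unfolding n_def s_def by (rule norm_scaleR_sgn[symmetric])
  have vc: "vel c u = n\<^sup>2 *\<^sub>R s" unfolding vel_eq_srv q_def[symmetric] n_def[symmetric]
    by (subst q) (simp add: power2_eq_square)
  have ns: "norm s = 1" using ss by (simp add: norm_eq_1)
  have nv: "norm (vel c u) = n\<^sup>2" by (simp add: vc ns)
  have T: "vel c u /\<^sub>R norm (vel c u) = s" unfolding nv unfolding vc using n by simp
  have "vel h u = n *\<^sub>R (p + x *\<^sub>R s)"
    unfolding h q_def[symmetric] norm_scale_deriv_def n_def[symmetric] s_def[symmetric]
    by (subst q) (simp add: x_def inner_commute scaleR_add_right)
  then have A: "arc_deriv c h u = (1 / n) *\<^sub>R (p + x *\<^sub>R s)"
    unfolding arc_deriv_def nv using n by (simp add: power2_eq_square divide_inverse)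
  have top: "arc_deriv_top c h u = (1 / n) *\<^sub>R ((2 * x) *\<^sub>R s)"
    unfolding arc_deriv_top_def Let_def T A by (simp add: inner_add_left ss x_def)
  have bot: "arc_deriv_bot c h u = (1 / n) *\<^sub>R (p - x *\<^sub>R s)"
    unfolding arc_deriv_bot_def top A by (simp add: scaleR_diff_right[symmetric] scaleR_2[symmetric] algebra_simps)
  have "(p - x *\<^sub>R s) \<bullet> (p - x *\<^sub>R s) = (norm p)\<^sup>2 - x\<^sup>2"
    by (simp add: inner_diff_left inner_diff_right ss x_def inner_commute[of s p] power2_norm_eq_inner)
      (simp add: power2_eq_square)
  then have b2: "arc_deriv_bot c h u \<bullet> arc_deriv_bot c h u = ((norm p)\<^sup>2 - x\<^sup>2) / n\<^sup>2"
    unfolding bot by (simp add: power2_eq_square)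
  have t2: "arc_deriv_top c h u \<bullet> arc_deriv_top c h u = 4 * x\<^sup>2 / n\<^sup>2"
    unfolding top by (simp add: ss power2_eq_square)
  have g: "cone_metric (a / (2 * b)) (srv c u) p = (a / (2 * b))\<^sup>2 * ((norm p)\<^sup>2 - x\<^sup>2) + x\<^sup>2"
    using False by (simp add: cone_metric_def x_def s_def q_def del: srv_eq_0)
  show ?thesis unfolding b2 t2 nv g using n ab
    by (simp add: power_divide power_mult_distrib distrib_right distrib_left)
qed

text \<open>Interchanging the derivatives in time and parameter: the path is recovered from its velocity by
  integration in the parameter, so the time derivative passes under the integral.\<close>

lemma vel_path_vel:
  fixes \<gamma> :: "real \<Rightarrow> 'd::finite curve" and q p :: "real \<times> real \<Rightarrow> real ^ 'd"
  assumes AC: "\<And>t. t \<in> {0..1} \<Longrightarrow> \<gamma> t \<in> AC0"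
    and srv: "\<And>t u. t \<in> {0..1} \<Longrightarrow> u \<in> {0..1} \<Longrightarrow> srv (\<gamma> t) u = q (t, u)"
    and cq: "continuous_on unit_square q" and cp: "continuous_on unit_square p"
    and der: "\<And>t u. t \<in> {0..1} \<Longrightarrow> u \<in> {0..1} \<Longrightarrow>
       ((\<lambda>t. q (t, u)) has_vector_derivative p (t, u)) (at t within {0..1})"
    and t: "t \<in> {0..1}" and u: "u \<in> {0..1}"
  shows "vel (path_vel \<gamma> t) u = norm_scale_deriv (q (t, u)) (p (t, u))"
proof -
  define w where "w = (\<lambda>x. norm (q x) *\<^sub>R q x)"
  define wt where "wt = (\<lambda>x. norm_scale_deriv (q x) (p x))"
  have cw: "continuous_on unit_square w" unfolding w_def by (intro continuous_intros cq)
  have cwt: "continuous_on unit_square wt" unfolding wt_def by (rule continuous_on_norm_scale_deriv[OF cq cp])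
  have wder: "((\<lambda>t. w (t, u)) has_vector_derivative wt (t, u)) (at t within {0..1})"
    if "t \<in> {0..1}" "u \<in> {0..1}" for t u
    unfolding w_def wt_def by (rule has_vector_derivative_norm_scale[OF der[OF that]])
  have \<gamma>: "\<gamma> t u = integral {0..u} (\<lambda>s. w (t, s))" if tu: "t \<in> {0..1}" "u \<in> {0..1}" for t u
  proof -
    have "integral {0..u} (vel (\<gamma> t)) = \<gamma> t u" by (rule integral_unique[OF AC0_integral(2)[OF AC[OF tu(1)] tu(2)]])
    moreover have "integral {0..u} (vel (\<gamma> t)) = integral {0..u} (\<lambda>s. w (t, s))"
      by (rule integral_cong) (use srv tu in \<open>auto simp: w_def vel_eq_srv\<close>)
    ultimately show ?thesis by simp
  qed
  have pv: "path_vel \<gamma> t u = integral {0..u} (\<lambda>s. wt (t, s))" if u: "u \<in> {0..1}" for u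
  proof -
    have "((\<lambda>s. \<gamma> s u) has_vector_derivative integral {0..u} (\<lambda>s. wt (t, s))) (at t within {0..1})"
      by (rule has_vector_derivative_transform[OF t _ leibniz_upto[OF cw cwt wder t u]]) (use \<gamma> u in auto)
    from vel_eqI[OF this t] show ?thesis by (simp add: path_vel_def vel_def)
  qed
  have "continuous_on {0..1} (\<lambda>s. wt (t, s))"
    by (rule continuous_on_compose2[OF cwt]) (use t in \<open>auto intro!: continuous_intros\<close>)
  from integral_has_vector_derivative[OF this u]
  have "(path_vel \<gamma> t has_vector_derivative wt (t, u)) (at u within {0..1})"
    by (rule has_vector_derivative_transform[OF u, rotated]) (simp add: pv)
  from vel_eqI[OF this u] show ?thesis by (simp add: wt_def)
qed

lemma elastic_length_eq:
  fixes \<gamma> :: "real \<Rightarrow> 'd::finite curve" and q p :: "real \<times> real \<Rightarrow> real ^ 'd"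
  assumes ab: "a > 0" "b > 0"
    and AC: "\<And>t. t \<in> {0..1} \<Longrightarrow> \<gamma> t \<in> AC0"
    and srv: "\<And>t u. t \<in> {0..1} \<Longrightarrow> u \<in> {0..1} \<Longrightarrow> srv (\<gamma> t) u = q (t, u)"
    and cq: "continuous_on unit_square q" and cp: "continuous_on unit_square p"
    and der: "\<And>t u. t \<in> {0..1} \<Longrightarrow> u \<in> {0..1} \<Longrightarrow>
       ((\<lambda>t. q (t, u)) has_vector_derivative p (t, u)) (at t within {0..1})"
  shows "elastic_length a b \<gamma> = 2 * b * (\<integral>t. sqrt (\<integral>u. cone_metric (a / (2 * b)) (q (t, u)) (p (t, u)) \<partial>U01) \<partial>U01)"
proof -
  have el: "sqrt (elastic a b (\<gamma> t) (path_vel \<gamma> t) (path_vel \<gamma> t)) =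
      2 * b * sqrt (\<integral>u. cone_metric (a / (2 * b)) (q (t, u)) (p (t, u)) \<partial>U01)" if t: "t \<in> {0..1}" for t
  proof -
    have "elastic a b (\<gamma> t) (path_vel \<gamma> t) (path_vel \<gamma> t) =
       (\<integral>u. 4 * b\<^sup>2 * cone_metric (a / (2 * b)) (q (t, u)) (p (t, u)) \<partial>U01)"
      unfolding elastic_def LINT_U01
    proof (rule Bochner_Integration.integral_cong)
      fix u assume "u \<in> space U01"
      then have u: "u \<in> {0..1}" by simp
      have "vel (path_vel \<gamma> t) u = norm_scale_deriv (srv (\<gamma> t) u) (p (t, u))"
        using vel_path_vel[OF AC srv cq cp der t u] srv[OF t u] by simp
      from elastic_integrand[OF ab this] srv[OF t u]
      show "(a\<^sup>2 * (arc_deriv_bot (\<gamma> t) (path_vel \<gamma> t) u \<bullet> arc_deriv_bot (\<gamma> t) (path_vel \<gamma> t) u)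
         + b\<^sup>2 * (arc_deriv_top (\<gamma> t) (path_vel \<gamma> t) u \<bullet> arc_deriv_top (\<gamma> t) (path_vel \<gamma> t) u)) * norm (vel (\<gamma> t) u)
         = 4 * b\<^sup>2 * cone_metric (a / (2 * b)) (q (t, u)) (p (t, u))" by simp
    qed simp
    also have "\<dots> = (2 * b)\<^sup>2 * (\<integral>u. cone_metric (a / (2 * b)) (q (t, u)) (p (t, u)) \<partial>U01)"
      by (simp add: power_mult_distrib)
    finally show ?thesis using ab by (simp add: real_sqrt_mult)
  qed
  have "elastic_length a b \<gamma> = (\<integral>t. 2 * b * sqrt (\<integral>u. cone_metric (a / (2 * b)) (q (t, u)) (p (t, u)) \<partial>U01) \<partial>U01)"
    unfolding elastic_length_def LINT_U01
    by (rule Bochner_Integration.integral_cong) (simp_all add: el)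
  then show ?thesis by simp
qed

lemma cone_dist_L2_cong:
  "(\<And>u. u \<in> {0..1} \<Longrightarrow> f u = f' u) \<Longrightarrow> (\<And>u. u \<in> {0..1} \<Longrightarrow> g u = g' u) \<Longrightarrow> cone_dist_L2 l f g = cone_dist_L2 l f' g'"
  unfolding cone_dist_L2_def L2_norm_def by (intro arg_cong[where f = sqrt] Bochner_Integration.integral_cong) auto

lemma elastic_length_ge:
  fixes \<gamma> :: "real \<Rightarrow> 'd::finite curve"
  assumes ab: "a > 0" "b > 0" and \<gamma>: "\<gamma> \<in> GeoCompl_paths"
  shows "2 * b * cone_dist_L2 (a / (2 * b)) (srv (\<gamma> 0)) (srv (\<gamma> 1)) \<le> elastic_length a b \<gamma>"
proof -
  define q where "q = (\<lambda>(t, u). srv (\<gamma> t) u)"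
  have AC: "\<And>t. t \<in> {0..1} \<Longrightarrow> \<gamma> t \<in> AC0" and sq: "smooth_on unit_square q"
    using \<gamma> by (auto simp: GeoCompl_paths_def GeoCompl_def q_def)
  obtain D where D: "\<And>x. x \<in> unit_square \<Longrightarrow> (q has_derivative D x) (at x within unit_square)"
    "\<And>v. continuous_on unit_square (\<lambda>x. D x v)" by (rule smooth_on_SucE[OF sq], rule that)
  define p where "p = (\<lambda>x. D x (1, 0))"
  have cq: "continuous_on unit_square q" by (rule smooth_on_continuous[OF sq])
  have cp: "continuous_on unit_square p" unfolding p_def by (rule D(2))
  have der: "((\<lambda>t. q (t, u)) has_vector_derivative p (t, u)) (at t within {0..1})"
    if tu: "t \<in> {0..1}" "u \<in> {0..1}" for t u
  proof -
    have "(t, u) \<in> unit_square" using tu by simp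
    from D(1)[OF this] have "((\<lambda>(t, u). q (t, u)) has_derivative D (t, u)) (at (t, u) within unit_square)" by simp
    from has_derivative_slices(1)[OF this tu] show ?thesis by (simp add: p_def)
  qed
  \<comment> \<open>The extension to the plane by clamping provides the global continuity that the
    lower bound asks for, without changing anything on the unit square.\<close>
  define cl where "cl = (\<lambda>x. (clamp01 (fst x), clamp01 (snd x)))"
  have cl: "cl (t, u) = (t, u)" if "t \<in> {0..1}" "u \<in> {0..1}" for t u using that by (simp add: cl_def)
  have clc: "continuous_on UNIV cl" "cl ` UNIV \<subseteq> unit_square"
    unfolding cl_def by (auto intro!: continuous_intros)
  have l: "a / (2 * b) > 0" using ab by simp
  have "cone_dist_L2 (a / (2 * b)) (\<lambda>u. q (cl (0, u))) (\<lambda>u. q (cl (1, u))) \<le>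
      (\<integral>t. sqrt (\<integral>u. cone_metric (a / (2 * b)) (q (cl (t, u))) (p (cl (t, u))) \<partial>U01) \<partial>U01)"
  proof (rule cone_dist_L2_le_length[OF l, of "\<lambda>x. q (cl x)" "\<lambda>x. p (cl x)"])
    show "continuous_on UNIV (\<lambda>x. q (cl x))" "continuous_on UNIV (\<lambda>x. p (cl x))"
      by (rule continuous_on_compose2[OF cq clc], rule continuous_on_compose2[OF cp clc])
    show "((\<lambda>t. q (cl (t, u))) has_vector_derivative p (cl (t, u))) (at t within {0..1})"
      if tu: "t \<in> {0..1}" "u \<in> {0..1}" for t u
      unfolding cl[OF tu] by (rule has_vector_derivative_transform[OF tu(1) _ der[OF tu]]) (simp only: cl[OF _ tu(2)])
  qed
  also have "(\<integral>t. sqrt (\<integral>u. cone_metric (a / (2 * b)) (q (cl (t, u))) (p (cl (t, u))) \<partial>U01) \<partial>U01) =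
      (\<integral>t. sqrt (\<integral>u. cone_metric (a / (2 * b)) (q (t, u)) (p (t, u)) \<partial>U01) \<partial>U01)"
    by (intro Bochner_Integration.integral_cong arg_cong[where f = sqrt]) (auto simp: cl)
  also have "cone_dist_L2 (a / (2 * b)) (\<lambda>u. q (cl (0, u))) (\<lambda>u. q (cl (1, u))) = cone_dist_L2 (a / (2 * b)) (srv (\<gamma> 0)) (srv (\<gamma> 1))"
    by (rule cone_dist_L2_cong) (simp_all add: cl q_def)
  finally show ?thesis
    using elastic_length_eq[OF ab AC _ cq cp der] ab by (simp add: q_def)
qed

text \<open>The last clause lets the same construction serve both spaces: if \<open>q\<close> avoids
  the origin, integrating the then smooth velocity yields a jointly smooth path of
  immersions.\<close>

lemma short_GeoCompl_path:
  fixes c1 c2 :: "'d::finite curve"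
  assumes ab: "a > 0" "b > 0" and card: "CARD('d) \<ge> 2" and c: "c1 \<in> GeoCompl" "c2 \<in> GeoCompl" and "e > 0"
  obtains \<gamma> where "\<gamma> \<in> GeoCompl_paths" "\<gamma> 0 = c1" "\<gamma> 1 = c2"
    "elastic_length a b \<gamma> \<le> 2 * b * cone_dist_L2 (a / (2 * b)) (srv c1) (srv c2) + e"
    "CARD('d) \<ge> 3 \<Longrightarrow> \<forall>u\<in>{0..1}. srv c1 u \<noteq> 0 \<and> srv c2 u \<noteq> 0 \<Longrightarrow> \<gamma> \<in> Imm0_paths"
proof -
  have AC: "c1 \<in> AC0" "c2 \<in> AC0" and s: "smooth_on {0..1} (srv c1)" "smooth_on {0..1} (srv c2)"
    using c by (auto simp: GeoCompl_def)
  \<comment> \<open>The error is divided by \<open>2 * b\<close> because lengths of curves are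
    \<open>2 * b\<close> times lengths in the cone.\<close>
  have l: "a / (2 * b) > 0" and dim: "DIM(real ^ 'd) \<ge> 2" and e: "e / (2 * b) > 0"
    using ab card \<open>e > 0\<close> by simp_all
  obtain q p where sq: "smooth_on unit_square q" and cp: "continuous_on unit_square p"
    and der: "\<And>t u. t \<in> {0..1} \<Longrightarrow> u \<in> {0..1} \<Longrightarrow>
       ((\<lambda>t. q (t, u)) has_vector_derivative p (t, u)) (at t within {0..1})"
    and q0: "\<And>u. u \<in> {0..1} \<Longrightarrow> q (0, u) = srv c1 u" and q1: "\<And>u. u \<in> {0..1} \<Longrightarrow> q (1, u) = srv c2 u"
    and ne: "\<And>x. DIM(real ^ 'd) \<ge> 3 \<Longrightarrow> \<forall>u\<in>{0..1}. srv c1 u \<noteq> 0 \<and> srv c2 u \<noteq> 0 \<Longrightarrow> x \<in> unit_square \<Longrightarrow> q x \<noteq> 0"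
    and le: "(\<integral>t. sqrt (\<integral>u. cone_metric (a / (2 * b)) (q (t, u)) (p (t, u)) \<partial>U01) \<partial>U01)
        \<le> cone_dist_L2 (a / (2 * b)) (srv c1) (srv c2) + e / (2 * b)"
    by (rule exists_short_path[OF l dim s e], rule that)
  have cq: "continuous_on unit_square q" by (rule smooth_on_continuous[OF sq])
  define \<gamma> where "\<gamma> = (\<lambda>t. curve_of (\<lambda>u. q (t, u)))"
  have slice: "smooth_on {0..1} (\<lambda>u. q (t, u))" if t: "t \<in> {0..1}" for t
  proof -
    have "bounded_linear (\<lambda>u :: real. (0 :: real, u))"
      by (intro bounded_linear_Pair bounded_linear_zero bounded_linear_ident)
    moreover have "(\<lambda>u. (0, u) + (t, 0)) ` {0..1} \<subseteq> unit_square" using t by auto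
    ultimately show ?thesis using smooth_on_compose_affine[OF _ _ sq, of "\<lambda>u. (0, u)" "(t, 0)" "{0..1}"] by simp
  qed
  have G: "\<gamma> t \<in> GeoCompl" if "t \<in> {0..1}" for t
    unfolding \<gamma>_def by (rule curve_of_GeoCompl[OF slice[OF that]])
  then have GA: "\<gamma> t \<in> AC0" if "t \<in> {0..1}" for t using that by (simp add: GeoCompl_def)
  have srv: "srv (\<gamma> t) u = q (t, u)" if "t \<in> {0..1}" "u \<in> {0..1}" for t u
    unfolding \<gamma>_def by (rule srv_curve_of[OF smooth_on_continuous[OF slice[OF that(1)]] that(2)])
  have paths: "\<gamma> \<in> GeoCompl_paths"
    using G sq smooth_on_cong[of unit_square "\<lambda>(t, u). srv (\<gamma> t) u" q] srv by (auto simp: GeoCompl_paths_def)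
  have "\<gamma> 0 = curve_of (srv c1)" "\<gamma> 1 = curve_of (srv c2)"
    unfolding \<gamma>_def using q0 q1 by (auto intro!: curve_of_cong)
  then have ends: "\<gamma> 0 = c1" "\<gamma> 1 = c2" using curve_of_srv AC by auto
  have "elastic_length a b \<gamma> \<le> 2 * b * (cone_dist_L2 (a / (2 * b)) (srv c1) (srv c2) + e / (2 * b))"
  proof -
    have "elastic_length a b \<gamma> = 2 * b * (\<integral>t. sqrt (\<integral>u. cone_metric (a / (2 * b)) (q (t, u)) (p (t, u)) \<partial>U01) \<partial>U01)"
      by (rule elastic_length_eq[OF ab GA srv cq cp der])
    also have "\<dots> \<le> 2 * b * (cone_dist_L2 (a / (2 * b)) (srv c1) (srv c2) + e / (2 * b))"
      using ab by (intro mult_left_mono le) auto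
    finally show ?thesis .
  qed
  then have len: "elastic_length a b \<gamma> \<le> 2 * b * cone_dist_L2 (a / (2 * b)) (srv c1) (srv c2) + e"
    using ab by (simp add: distrib_left)
  have "\<gamma> \<in> Imm0_paths" if hyps: "CARD('d) \<ge> 3" "\<forall>u\<in>{0..1}. srv c1 u \<noteq> 0 \<and> srv c2 u \<noteq> 0"
  proof -
    have q0: "q x \<noteq> 0" if "x \<in> unit_square" for x
      by (rule ne[OF _ hyps(2) that]) (use hyps(1) in simp)
    have "\<gamma> t \<in> Imm0" if "t \<in> {0..1}" for t
      unfolding \<gamma>_def by (rule curve_of_Imm0[OF slice[OF that]]) (use q0 that in auto)
    moreover have "smooth_on unit_square (\<lambda>x. integral {0..snd x} (\<lambda>s. norm (q (fst x, s)) *\<^sub>R q (fst x, s)))"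
      using smooth_on_integral_upto[OF smooth_on_norm_scale[OF sq q0]] by simp
    then have "smooth_on unit_square (\<lambda>(t, u). \<gamma> t u)"
      by (rule smooth_on_cong[THEN iffD1, rotated]) (auto simp: \<gamma>_def curve_of_def)
    ultimately show ?thesis by (simp add: Imm0_paths_def)
  qed
  then show ?thesis using that[OF paths ends len] by blast
qed

section \<open>Immersions inside the geodesic completion\<close>

lemma smooth_on_vel:
  assumes "smooth_on {0..1} c"
  shows "smooth_on {0..1} (vel c)"
    and "\<And>u. u \<in> {0..1} \<Longrightarrow> (c has_vector_derivative vel c u) (at u within {0..1})"
proof -
  have *: "\<exists>D. (\<forall>x\<in>{0..1}. (c has_derivative D x) (at x within {0..1})) \<and> (\<forall>v. Ck_on k {0..1} (\<lambda>x. D x v))" for k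
    using assms Ck_on.simps(2)[of k "{0..1}" c] unfolding smooth_on_def by blast
  have vel: "(c has_vector_derivative D x 1) (at x within {0..1}) \<and> vel c x = D x 1"
    if D: "\<forall>x\<in>{0..1}. (c has_derivative D x) (at x within {0..1})" and x: "x \<in> {0..1}" for D x
  proof -
    have d: "(c has_derivative D x) (at x within {0..1})" using D x by blast
    interpret D: bounded_linear "D x" by (rule has_derivative_bounded_linear[OF d])
    have "D x = (\<lambda>h. h *\<^sub>R D x 1)"
    proof
      show "D x h = h *\<^sub>R D x 1" for h using D.scaleR[of h 1] by simp
    qed
    then have "(c has_vector_derivative D x 1) (at x within {0..1})"
      using d unfolding has_vector_derivative_def by simp
    then show ?thesis using vel_eqI x by blast
  qed
  show "smooth_on {0..1} (vel c)"
    unfolding smooth_on_def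
  proof
    fix k
    obtain D where D: "\<forall>x\<in>{0..1}. (c has_derivative D x) (at x within {0..1})" "\<forall>v. Ck_on k {0..1} (\<lambda>x. D x v)"
      using * by blast
    have "Ck_on k {0..1} (\<lambda>x. D x 1)" using D(2) by blast
    then show "Ck_on k {0..1} (vel c)"
      by (rule Ck_on_cong[THEN iffD1, rotated]) (use vel[OF D(1)] in auto)
  qed
  show "(c has_vector_derivative vel c u) (at u within {0..1})" if "u \<in> {0..1}" for u
    using * vel that by metis
qed

lemma Imm0_subset_GeoCompl: "Imm0 \<subseteq> (GeoCompl :: 'd::finite curve set)"
proof
  fix c :: "'d curve" assume "c \<in> Imm0"
  then have c: "c \<in> extensional {0..1}" "smooth_on {0..1} c" "\<And>u. u \<in> {0..1} \<Longrightarrow> vel c u \<noteq> 0" "c 0 = 0"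
    by (auto simp: Imm0_def)
  have sv: "smooth_on {0..1} (vel c)" by (rule smooth_on_vel(1)[OF c(2)])
  obtain B where B: "\<And>u. u \<in> {0..1} \<Longrightarrow> norm (vel c u) \<le> B"
    using continuous_on_U01_bounded[OF smooth_on_continuous[OF sv]] by blast
  have "abs_continuous_on {0..1} c"
  proof (rule abs_continuous_on_lipschitz)
    show "norm (c y - c x) \<le> B * \<bar>y - x\<bar>" if "x \<in> {0..1}" "y \<in> {0..1}" for x y
      by (rule vector_derivative_lipschitz[OF smooth_on_vel(2)[OF c(2)] B]) (use that in auto)
  qed
  moreover have "smooth_on {0..1} (\<lambda>u. srv c u)"
    by (rule smooth_vel_srv[OF sv]) (use c(3) in auto)
  ultimately show "c \<in> GeoCompl" using c by (simp add: GeoCompl_def AC0_def)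
qed

text \<open>Transfers the lower bound on lengths to paths of immersions. The velocity is the
  derivative of the path in direction \<open>(0, 1)\<close>, hence jointly smooth, and it never
  vanishes, so \<open>srv\<close> is smooth too.\<close>

lemma Imm0_paths_subset: "Imm0_paths \<subseteq> (GeoCompl_paths :: (real \<Rightarrow> 'd::finite curve) set)"
proof
  fix \<gamma> :: "real \<Rightarrow> 'd curve" assume "\<gamma> \<in> Imm0_paths"
  then have I: "\<And>t. t \<in> {0..1} \<Longrightarrow> \<gamma> t \<in> Imm0" and s: "smooth_on unit_square (\<lambda>(t, u). \<gamma> t u)"
    by (auto simp: Imm0_paths_def)
  have "smooth_on unit_square (\<lambda>x. vel (\<gamma> (fst x)) (snd x))"
    unfolding smooth_on_def
  proof
    fix k
    obtain D where D: "\<forall>x\<in>unit_square. ((\<lambda>(t, u). \<gamma> t u) has_derivative D x) (at x within unit_square)"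
      "\<forall>v. Ck_on k unit_square (\<lambda>x. D x v)"
      using s Ck_on.simps(2)[of k unit_square "\<lambda>(t, u). \<gamma> t u"] unfolding smooth_on_def by blast
    have eq: "D x (0, 1) = vel (\<gamma> (fst x)) (snd x)" if x: "x \<in> unit_square" for x
    proof -
      obtain t u where tu: "x = (t, u)" "t \<in> {0..1}" "u \<in> {0..1}" using x by blast
      have "((\<lambda>(t, u). (\<lambda>(t, u). \<gamma> t u) (t, u)) has_derivative D (t, u)) (at (t, u) within unit_square)"
        using D(1) x tu(1) by simp
      from has_derivative_slices(2)[OF this tu(2,3)]
      have "(\<gamma> t has_vector_derivative D (t, u) (0, 1)) (at u within {0..1})" by simp
      from vel_eqI[OF this tu(3)] show ?thesis by (simp add: tu(1))
    qed
    have "Ck_on k unit_square (\<lambda>x. D x (0, 1))" using D(2) by blast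
    then show "Ck_on k unit_square (\<lambda>x. vel (\<gamma> (fst x)) (snd x))"
      by (rule Ck_on_cong[THEN iffD1, rotated]) (rule eq)
  qed
  then have "smooth_on unit_square (\<lambda>x. srv (\<gamma> (fst x)) (snd x))"
    by (rule smooth_vel_srv) (use I in \<open>auto simp: Imm0_def\<close>)
  then show "\<gamma> \<in> GeoCompl_paths"
    using I Imm0_subset_GeoCompl by (auto simp: GeoCompl_paths_def split_def)
qed

section \<open>Geodesic distances\<close>

lemma geodesic_dist_eqI:
  assumes "\<And>\<gamma>. \<gamma> \<in> P \<Longrightarrow> \<gamma> 0 = c1 \<Longrightarrow> \<gamma> 1 = c2 \<Longrightarrow> d \<le> elastic_length a b \<gamma>"
    and "\<And>e. e > 0 \<Longrightarrow> \<exists>\<gamma>\<in>P. \<gamma> 0 = c1 \<and> \<gamma> 1 = c2 \<and> elastic_length a b \<gamma> \<le> d + e"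
  shows "geodesic_dist P a b c1 c2 = d"
proof -
  let ?L = "elastic_length a b ` {\<gamma> \<in> P. \<gamma> 0 = c1 \<and> \<gamma> 1 = c2}"
  have lb: "\<And>x. x \<in> ?L \<Longrightarrow> d \<le> x" using assms(1) by auto
  have "?L \<noteq> {}" using assms(2)[of 1] by auto
  then have "d \<le> Inf ?L" using lb by (intro cInf_greatest)
  moreover have "Inf ?L \<le> d"
  proof (rule field_le_epsilon)
    fix e :: real assume "e > 0"
    from assms(2)[OF this] obtain \<gamma> where "\<gamma> \<in> P" "\<gamma> 0 = c1" "\<gamma> 1 = c2" "elastic_length a b \<gamma> \<le> d + e" by blast
    then show "Inf ?L \<le> d + e" using lb by (intro cInf_lower2[of "elastic_length a b \<gamma>"]) (auto simp: bdd_below_def)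
  qed
  ultimately show ?thesis by (simp add: geodesic_dist_def)
qed

definition elastic_dist :: "real \<Rightarrow> real \<Rightarrow> 'd::finite curve \<Rightarrow> 'd curve \<Rightarrow> real" where
  "elastic_dist a b c1 c2 = 2 * b * cone_dist_L2 (a / (2 * b)) (srv c1) (srv c2)"

lemma geodesic_dist_GeoCompl:
  fixes c1 c2 :: "'d::finite curve"
  assumes ab: "a > 0" "b > 0" and card: "CARD('d) \<ge> 2" and c: "c1 \<in> GeoCompl" "c2 \<in> GeoCompl"
  shows "geodesic_dist GeoCompl_paths a b c1 c2 = elastic_dist a b c1 c2"
proof (rule geodesic_dist_eqI)
  show "elastic_dist a b c1 c2 \<le> elastic_length a b \<gamma>" if "\<gamma> \<in> GeoCompl_paths" "\<gamma> 0 = c1" "\<gamma> 1 = c2" for \<gamma>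
    using elastic_length_ge[OF ab that(1)] that by (simp add: elastic_dist_def)
  fix e :: real assume "e > 0"
  obtain \<gamma> where "\<gamma> \<in> GeoCompl_paths" "\<gamma> 0 = c1" "\<gamma> 1 = c2"
    "elastic_length a b \<gamma> \<le> 2 * b * cone_dist_L2 (a / (2 * b)) (srv c1) (srv c2) + e"
    by (rule short_GeoCompl_path[OF ab card c \<open>e > 0\<close>], rule that)
  then show "\<exists>\<gamma>\<in>GeoCompl_paths. \<gamma> 0 = c1 \<and> \<gamma> 1 = c2 \<and> elastic_length a b \<gamma> \<le> elastic_dist a b c1 c2 + e"
    by (auto simp: elastic_dist_def)
qed

lemma geodesic_dist_Imm0:
  fixes c1 c2 :: "'d::finite curve"
  assumes ab: "a > 0" "b > 0" and card: "CARD('d) \<ge> 3" and c: "c1 \<in> Imm0" "c2 \<in> Imm0"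
  shows "geodesic_dist Imm0_paths a b c1 c2 = elastic_dist a b c1 c2"
proof (rule geodesic_dist_eqI)
  show "elastic_dist a b c1 c2 \<le> elastic_length a b \<gamma>" if "\<gamma> \<in> Imm0_paths" "\<gamma> 0 = c1" "\<gamma> 1 = c2" for \<gamma>
    using elastic_length_ge[OF ab, of \<gamma>] Imm0_paths_subset that by (auto simp: elastic_dist_def)
  fix e :: real assume "e > 0"
  have card2: "CARD('d) \<ge> 2" using card by simp
  have G: "c1 \<in> GeoCompl" "c2 \<in> GeoCompl" using c Imm0_subset_GeoCompl by auto
  have ne: "\<forall>u\<in>{0..1}. srv c1 u \<noteq> 0 \<and> srv c2 u \<noteq> 0" using c by (auto simp: Imm0_def)
  obtain \<gamma> where \<gamma>: "\<gamma> 0 = c1" "\<gamma> 1 = c2"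
    "elastic_length a b \<gamma> \<le> 2 * b * cone_dist_L2 (a / (2 * b)) (srv c1) (srv c2) + e"
    "CARD('d) \<ge> 3 \<Longrightarrow> \<forall>u\<in>{0..1}. srv c1 u \<noteq> 0 \<and> srv c2 u \<noteq> 0 \<Longrightarrow> \<gamma> \<in> Imm0_paths"
    by (rule short_GeoCompl_path[OF ab card2 G \<open>e > 0\<close>], rule that)
  from \<gamma>(4)[OF card ne] \<gamma>(1-3)
  show "\<exists>\<gamma>\<in>Imm0_paths. \<gamma> 0 = c1 \<and> \<gamma> 1 = c2 \<and> elastic_length a b \<gamma> \<le> elastic_dist a b c1 c2 + e"
    by (auto simp: elastic_dist_def)
qed

section \<open>The completed metric space\<close>

lemma Metric_space_elastic_dist:
  assumes ab: "a > 0" "b > 0"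
  shows "Metric_space (AC0 :: 'd::finite curve set) (elastic_dist a b)"
proof
  have l: "a / (2 * b) > 0" using ab by simp
  show "0 \<le> elastic_dist a b c1 c2" for c1 c2 :: "'d curve" using ab by (simp add: elastic_dist_def)
  show "elastic_dist a b c1 c2 = elastic_dist a b c2 c1" for c1 c2 :: "'d curve"
    using cone_dist_L2_commute[of "a / (2 * b)" "srv c1" "srv c2"] by (simp add: elastic_dist_def)
  show "(elastic_dist a b c1 c2 = 0) = (c1 = c2)" if "c1 \<in> AC0" "c2 \<in> AC0" for c1 c2 :: "'d curve"
    using cone_dist_L2_eq_0[OF l square_integrable_srv[OF that(1)] square_integrable_srv[OF that(2)]] AC0_eqI[OF that] ab
    by (auto simp: elastic_dist_def)
  show "elastic_dist a b c1 c3 \<le> elastic_dist a b c1 c2 + elastic_dist a b c2 c3"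
    if "c1 \<in> AC0" "c2 \<in> AC0" "c3 \<in> AC0" for c1 c2 c3 :: "'d curve"
    using cone_dist_L2_triangle[OF l square_integrable_srv[OF that(1)] square_integrable_srv[OF that(2)] square_integrable_srv[OF that(3)]] ab
    by (simp add: elastic_dist_def distrib_left[symmetric])
qed

text \<open>\<open>srv (curve_of q)\<close> agrees with \<open>q\<close> only almost everywhere, so
  the estimate goes through \<open>q\<close> itself, at distance 0 from it.\<close>

lemma elastic_dist_curve_of_le:
  assumes ab: "a > 0" "b > 0" and c: "c \<in> AC0" and q: "square_integrable q"
  shows "elastic_dist a b c (curve_of q) \<le> 2 * b * ((1 + 2 * (a / (2 * b))) * L2_norm (\<lambda>u. srv c u - q u))"
proof -
  have l: "a / (2 * b) > 0" using ab by simp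
  note sc = square_integrable_srv[OF c] and sq = square_integrable_srv[OF curve_of_AC0[OF q]]
  have "cone_dist_L2 (a / (2 * b)) q (srv (curve_of q)) = 0"
    using srv_curve_of_AE[OF q] by (subst cone_dist_L2_eq_0[OF l q sq]) (auto elim!: eventually_mono)
  then have "cone_dist_L2 (a / (2 * b)) (srv c) (srv (curve_of q)) \<le> (1 + 2 * (a / (2 * b))) * L2_norm (\<lambda>u. srv c u - q u)"
    using cone_dist_L2_triangle[OF l sc q sq] cone_dist_L2_le_L2_norm[OF l sc q] by simp
  then show ?thesis unfolding elastic_dist_def using ab by (intro mult_left_mono) auto
qed

text \<open>The lower comparison makes the transforms Cauchy in mean square; the curve of their
  limit \<open>r\<close> is the limit of the curves by the upper comparison.\<close>

lemma mcomplete_elastic_dist: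
  assumes ab: "a > 0" "b > 0"
  shows "Metric_space.mcomplete (AC0 :: 'd::finite curve set) (elastic_dist a b)"
proof -
  interpret M: Metric_space "AC0 :: 'd curve set" "elastic_dist a b" by (rule Metric_space_elastic_dist[OF ab])
  define l where "l = a / (2 * b)"
  have l: "l > 0" using ab by (simp add: l_def)
  show ?thesis
    unfolding M.mcomplete_def
  proof (intro allI impI)
    fix \<sigma> :: "nat \<Rightarrow> 'd curve" assume "M.MCauchy \<sigma>"
    then have \<sigma>: "\<And>n. \<sigma> n \<in> AC0"
      "\<And>e. e > 0 \<Longrightarrow> \<exists>N. \<forall>n n'. N \<le> n \<longrightarrow> N \<le> n' \<longrightarrow> elastic_dist a b (\<sigma> n) (\<sigma> n') < e"
      by (auto simp: M.MCauchy_def)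
    have sq: "square_integrable (srv (\<sigma> n))" for n by (rule square_integrable_srv[OF \<sigma>(1)])
    define k where "k = 2 * b * (min l 1 / 2)"
    have k: "k > 0" using ab l by (simp add: k_def)
    have kl: "k * L2_norm (\<lambda>u. srv (\<sigma> m) u - srv (\<sigma> n) u) \<le> elastic_dist a b (\<sigma> m) (\<sigma> n)" for m n
    proof -
      have "2 * b * (min l 1 / 2 * L2_norm (\<lambda>u. srv (\<sigma> m) u - srv (\<sigma> n) u)) \<le> elastic_dist a b (\<sigma> m) (\<sigma> n)"
        unfolding elastic_dist_def l_def[symmetric] using ab by (intro mult_left_mono L2_norm_le_cone_dist_L2 l sq) auto
      then show ?thesis by (simp only: k_def mult.assoc)
    qed
    have cauchy: "\<exists>N. \<forall>m\<ge>N. \<forall>n\<ge>N. L2_norm (\<lambda>u. srv (\<sigma> m) u - srv (\<sigma> n) u) < e" if "e > 0" for e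
    proof -
      have "k * e > 0" using k that by simp
      from \<sigma>(2)[OF this] obtain N where N: "\<And>n n'. N \<le> n \<Longrightarrow> N \<le> n' \<Longrightarrow> elastic_dist a b (\<sigma> n) (\<sigma> n') < k * e" by blast
      have "L2_norm (\<lambda>u. srv (\<sigma> m) u - srv (\<sigma> n) u) < e" if "m \<ge> N" "n \<ge> N" for m n
        using le_less_trans[OF kl N[OF that]] k by simp
      then show ?thesis by blast
    qed
    obtain r where r: "square_integrable r" "(\<lambda>n. L2_norm (\<lambda>u. srv (\<sigma> n) u - r u)) \<longlonglongrightarrow> 0"
      by (rule L2_norm_complete[OF sq cauchy], assumption, rule that)
    have up: "elastic_dist a b (\<sigma> n) (curve_of r) \<le> 2 * b * ((1 + 2 * (a / (2 * b))) * L2_norm (\<lambda>u. srv (\<sigma> n) u - r u))" for n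
      by (rule elastic_dist_curve_of_le[OF ab \<sigma>(1) r(1)])
    have lim: "(\<lambda>n. 2 * b * ((1 + 2 * (a / (2 * b))) * L2_norm (\<lambda>u. srv (\<sigma> n) u - r u))) \<longlonglongrightarrow> 0"
      using tendsto_mult[OF tendsto_const tendsto_mult[OF tendsto_const r(2)],
          of "2 * b" "1 + 2 * (a / (2 * b))"] by simp
    have "limitin M.mtopology \<sigma> (curve_of r) sequentially"
      unfolding M.limitin_metric
    proof (intro conjI allI impI)
      show "curve_of r \<in> AC0" by (rule curve_of_AC0[OF r(1)])
      fix e :: real assume "e > 0"
      then have "\<forall>\<^sub>F n in sequentially. 2 * b * ((1 + 2 * (a / (2 * b))) * L2_norm (\<lambda>u. srv (\<sigma> n) u - r u)) < e"
        by (intro order_tendstoD(2)[OF lim])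
      then show "\<forall>\<^sub>F n in sequentially. \<sigma> n \<in> AC0 \<and> elastic_dist a b (\<sigma> n) (curve_of r) < e"
        by eventually_elim (use up \<sigma>(1) le_less_trans in blast)
    qed
    then show "\<exists>x. limitin M.mtopology \<sigma> x sequentially" by blast
  qed
qed

text \<open>A nowhere vanishing smooth approximation of \<open>srv c\<close> integrates to a curve
  in both dense subsets at once.\<close>

lemma elastic_dist_dense:
  fixes c :: "'d::finite curve"
  assumes ab: "a > 0" "b > 0" and card: "CARD('d) \<ge> 2" and c: "c \<in> AC0" and "e > 0"
  obtains c' where "c' \<in> GeoCompl" "c' \<in> Imm0" "elastic_dist a b c c' < e"
proof -
  define k where "k = 2 * b * (1 + 2 * (a / (2 * b)))"
  have k: "k > 0" using ab by (simp add: k_def add_pos_pos)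
  have dim: "DIM(real ^ 'd) \<ge> 2" and ek: "e / k > 0" using card k \<open>e > 0\<close> by simp_all
  obtain p where p: "smooth_on {0..1} p" "\<And>u. u \<in> {0..1} \<Longrightarrow> p u \<noteq> 0" "L2_norm (\<lambda>u. srv c u - p u) < e / k"
    by (rule smooth_dense[OF dim square_integrable_srv[OF c] ek], rule that)
  have "elastic_dist a b c (curve_of p) \<le> k * L2_norm (\<lambda>u. srv c u - p u)"
    using elastic_dist_curve_of_le[OF ab c square_integrable_continuous[OF smooth_on_continuous[OF p(1)]]]
    by (simp only: k_def mult.assoc)
  also have "\<dots> < e" using p(3) k by (simp add: pos_less_divide_eq mult.commute)
  finally show ?thesis using that curve_of_GeoCompl[OF p(1)] curve_of_Imm0[OF p(1,2)] by blast
qed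

lemma metric_completion_elastic_dist:
  fixes M :: "'d::finite curve set"
  assumes ab: "a > 0" "b > 0" and "M \<subseteq> AC0"
    and "\<And>c1 c2. c1 \<in> M \<Longrightarrow> c2 \<in> M \<Longrightarrow> d c1 c2 = elastic_dist a b c1 c2"
    and dense: "\<And>c e. c \<in> AC0 \<Longrightarrow> e > 0 \<Longrightarrow> \<exists>c'\<in>M. elastic_dist a b c c' < e"
  shows "metric_completion M d AC0 (elastic_dist a b)"
proof -
  interpret M: Metric_space "AC0 :: 'd curve set" "elastic_dist a b" by (rule Metric_space_elastic_dist[OF ab])
  have "M.mtopology closure_of M = AC0"
    unfolding M.metric_closure_of using dense assms(3) by (fastforce simp: M.in_mball)
  then show ?thesis
    using assms mcomplete_elastic_dist[OF ab] M.Metric_space_axioms by (auto simp: metric_completion_def)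
qed

theorem corollary2p1:
  fixes a b :: real
  assumes "CARD('d::finite) \<ge> 2" and "a > 0" and "b > 0"
  shows "\<exists>dist_ab :: 'd curve \<Rightarrow> 'd curve \<Rightarrow> real.
    metric_completion GeoCompl (geodesic_dist GeoCompl_paths a b) AC0 dist_ab \<and>
    (CARD('d) \<ge> 3 \<longrightarrow>
       metric_completion Imm0 (geodesic_dist Imm0_paths a b) AC0 dist_ab) \<and>
    (\<forall>c1\<in>AC0. \<forall>c2\<in>AC0.
       dist_ab c1 c2 =
         2 * b * sqrt (curve_length c1 + curve_length c2
           - 2 * (LINT u:{0..1}|lebesgue.
                    sqrt (norm (vel c1 u) * norm (vel c2 u)) * cos (a / (2 * b) * theta a b c1 c2 u))))"
proof (intro exI[of _ "elastic_dist a b"] conjI impI ballI)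
  note ab = assms(2,3) and card = assms(1)
  have GA: "GeoCompl \<subseteq> (AC0 :: 'd curve set)" by (auto simp: GeoCompl_def)
  have IA: "Imm0 \<subseteq> (AC0 :: 'd curve set)" using Imm0_subset_GeoCompl GA by blast
  show "metric_completion GeoCompl (geodesic_dist GeoCompl_paths a b) AC0 (elastic_dist a b :: 'd curve \<Rightarrow> _)"
  proof (rule metric_completion_elastic_dist[OF ab GA geodesic_dist_GeoCompl[OF ab card]])
    show "\<exists>c'\<in>GeoCompl. elastic_dist a b c c' < e" if "c \<in> AC0" "e > 0" for c :: "'d curve" and e
      by (rule elastic_dist_dense[OF ab card that]) blast
  qed
  show "metric_completion Imm0 (geodesic_dist Imm0_paths a b) AC0 (elastic_dist a b :: 'd curve \<Rightarrow> _)"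
    if "CARD('d) \<ge> 3"
  proof (rule metric_completion_elastic_dist[OF ab IA geodesic_dist_Imm0[OF ab that]])
    show "\<exists>c'\<in>Imm0. elastic_dist a b c c' < e" if "c \<in> AC0" "e > 0" for c :: "'d curve" and e
      by (rule elastic_dist_dense[OF ab card that]) blast
  qed
  show "elastic_dist a b c1 c2 = 2 * b * sqrt (curve_length c1 + curve_length c2
           - 2 * (LINT u:{0..1}|lebesgue.
                    sqrt (norm (vel c1 u) * norm (vel c2 u)) * cos (a / (2 * b) * theta a b c1 c2 u)))"
    if "c1 \<in> AC0" "c2 \<in> AC0" for c1 c2 :: "'d curve"
    unfolding elastic_dist_def dist_formula[OF ab that] ..
qed

end
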